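(* Let $d>6$, let $\mathcal G$ be either the nearest-neighbour graph on $\mathbb Z^d$ or the spread-out graph on $\mathbb Z^d$ with spread parameter $L\ge 1$, and consider critical Bernoulli bond percolation $\mathbb P=\mathbb P_{p_c}$ on $\mathcal G$. Assume that there are constants $0<c_*\le C_*<\infty$ such that for all $x,y\in\mathbb Z^d$, $$\frac{c_*}{1+|x-y|^{d-2}}\le \tau(x,y)\le \frac{C_*}{1+|x-y|^{d-2}}.$$ Then there exists $C>0$ such that, for every integer $n\ge0$, $$\varphi_{p_c}(\mathbb H_n):=p_c\sum_{\substack{x\in\mathbb H_n,\ y\notin\mathbb H_n\\ x\sim y}}\tau_{\mathbb H_n}(0,x)\le C.$$
   Context: Graphs: the nearest-neighbour graph has vertex set $\mathbb Z^d$ and edges $\{x,y\}$ with $\|x-y\|_1=1$; the spread-out graph with parameter $L\ge1$ has vertex set $\mathbb Z^d$ and edges $\{x,y\}$ ($x\neq y$) with $\|x-y\|_1\le L$. We write $x\sim y$ if $\{x,y\}$ is an edge. Under $\mathbb P_p$ each edge is kept (open) independently with probability $p$ and deleted otherwise. $p_c:=\inf\{p\in[0,1]:\mathbb P_p[0\text{ lies in an infinite open connected component}]>0\}$, and $\mathbb P:=\mathbb P_{p_c}$. For $A\subset\mathbb Z^d$, $\tau_A(x,y):=\mathbb P[x\xleftrightarrow{A}y]$, where $\{x\xleftrightarrow{A}y\}$ is the event that there is an open path fully contained in $A$ connecting $x$ and $y$; $\tau:=\tau_{\mathbb Z^d}$. $|\cdot|$ is the $\ell^\infty$ norm on $\mathbb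 R^d$. $\mathbb H:=\{x\in\mathbb Z^d:x_1\ge0\}$ and $\mathbb H_n:=\mathbb H-n\mathbf e_1=\{x\in\mathbb Z^d: x_1\ge -n\}$, with $\mathbf e_1=(1,0,\dots,0)$. *)

theory Defs
  imports "HOL-Probability.Probability"
begin

type_synonym 'd site = "int ^ 'd"

definition l1_norm :: "'d::finite site \<Rightarrow> int" where
  "l1_norm x = (\<Sum>i\<in>UNIV. \<bar>x $ i\<bar>)"

definition linf_norm :: "'d::finite site \<Rightarrow> real" where
  "linf_norm x = infnorm (\<chi> i. real_of_int (x $ i) :: real ^ 'd)"

text \<open>A graph on the lattice is given by its set of edges, each edge being a two-element set
  of sites.\<close>

definition nearest_neighbour :: "'d::finite site set set" where
  "nearest_neighbour = {{x, y} | x y. l1_norm (x - y) = 1}"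

definition spread_out :: "nat \<Rightarrow> 'd::finite site set set" where
  "spread_out L = {{x, y} | x y. x \<noteq> y \<and> l1_norm (x - y) \<le> int L}"

text \<open>Bond percolation: a configuration maps each edge to \<^const>\<open>True\<close> (open) or
  \<^const>\<open>False\<close> (closed), and is undefined off the edge set.\<close>

definition percolation :: "'v set set \<Rightarrow> real \<Rightarrow> ('v set \<Rightarrow> bool) measure" where
  "percolation E p = (\<Pi>\<^sub>M e\<in>E. measure_pmf (bernoulli_pmf p))"

text \<open>The one-vertex path is allowed, so a site of \<open>A\<close> is connected to itself in \<open>A\<close>,
  while a site outside \<open>A\<close> is connected to nothing in \<open>A\<close>.\<close>

definition connected_in ::
    "'v set set \<Rightarrow> ('v set \<Rightarrow> bool) \<Rightarrow> 'v set \<Rightarrow> 'v \<Rightarrow> 'v \<Rightarrow> bool" where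
  "connected_in E \<omega> A x y \<longleftrightarrow>
     (\<exists>xs. xs \<noteq> [] \<and> hd xs = x \<and> last xs = y \<and> set xs \<subseteq> A \<and>
           successively (\<lambda>u v. {u, v} \<in> E \<and> \<omega> {u, v}) xs)"

definition two_point :: "'v set set \<Rightarrow> real \<Rightarrow> 'v set \<Rightarrow> 'v \<Rightarrow> 'v \<Rightarrow> real" where
  "two_point E p A x y = \<P>(\<omega> in percolation E p. connected_in E \<omega> A x y)"

definition percolation_prob :: "'d::finite site set set \<Rightarrow> real \<Rightarrow> real" where
  "percolation_prob E p =
     \<P>(\<omega> in percolation E p. infinite {y. connected_in E \<omega> UNIV 0 y})"

definition p_crit :: "'d::finite site set set \<Rightarrow> real" where
  "p_crit E = Inf {p \<in> {0..1}. percolation_prob E p > 0}"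

text \<open>The sum may have infinitely many terms, so it is taken in \<^typ>\<open>ennreal\<close>, where every
  sum of nonnegative terms converges.\<close>

definition phi :: "'d::finite site set set \<Rightarrow> real \<Rightarrow> 'd site set \<Rightarrow> ennreal" where
  "phi E p S =
     ennreal p *
       (\<Sum>\<^sub>\<infinity>(x, y)\<in>{(x, y). x \<in> S \<and> y \<notin> S \<and> {x, y} \<in> E}. ennreal (two_point E p S 0 x))"

text \<open>The index \<open>k\<close> plays the role of the first coordinate; a finite type has no
  distinguished element, so it is a parameter.\<close>

definition half_space :: "'d::finite \<Rightarrow> nat \<Rightarrow> 'd site set" where
  "half_space k n = {x. x $ k \<ge> - int n}"

end

(*
  Write S for the half-space, tau_S for the two-point function inside S, and let A(R) be the sum of
  tau_S(0, x) over the boundary layer of S in the cube of radius R. Below each boundary site x hang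
  an edge leaving S followed by a straight segment of length K; opening it and continuing from its
  end y produces a connection from 0 to a distant z, provided the cluster of y avoids the cluster of
  0. These events are disjoint for different x, and summing over z in a cube of radius comparable to
  R turns them into a bound for A(R), up to the error made when the two clusters meet. A meeting
  point is attached to an open path from 0 to x at a site v of S, at distance r > K from y; the
  green function estimates weigh such a v by r^(4-d).

  The number of sites of a selected path from 0 to x in the r-cube around x has moments of order q
  at most C r^(2q) times the tau_S-mass of that cube, by the BK inequality. The mass of the cube is
  at most polynomial in r times the boundary mass, by a Harnack-type estimate. Taking q large, the
  path has at most r^(5/2) sites in the cube up to a negligible error, and the sum of r^(5/2) r^(4-d)
  over dyadic r > K is small since d > 6. Hence A(R) <= M + delta A(2R) with delta as small as we
  please, and the trivial polynomial bound on A(R) lets this inequality be iterated.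
*)

theory Submission
  imports Defs "HOL-Library.Sublist"
begin

section \<open>Bernoulli configurations on a finite set\<close>

text \<open>Bounding a visit to v by tau_S(0, v) tau_S(v, x) is circular: summed over x the second
  factor is a boundary sum again, seen from v, and the first is bulk mass, which is controlled by
  boundary mass only up to a power of r. A high moment escapes this. Exceeding r^(5/2) visits, where
  r^2 is typical, costs a factor r^(-q/2), and q is chosen after all polynomial losses are known;
  the typical part is charged to tau_S(0, x) itself, hence to the boundary sum one wants to bound.
  Opening the segment costs p^(K+1), but in the main term and in the error term alike, so this cost
  enters M and not delta, and K can be chosen to make delta small. Delta has to be below 2^(-d),
  because the trivial bound grows like 2^d when R doubles. All inequalities are proved in finite
  boxes, where expectations are finite sums, with constants that depend neither on the box nor on n
  nor on R.\<close>

locale bernoulli_param =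
  fixes p :: real
  assumes p_nonneg: "0 \<le> p" and p_le_1: "p \<le> 1"
begin

text \<open>A configuration is encoded as the set of its open edges, so increasing events are those
  closed under supersets.\<close>

definition bexp :: "'e set \<Rightarrow> ('e set \<Rightarrow> real) \<Rightarrow> real" where
  "bexp E f = (\<Sum>\<omega>\<in>Pow E. p ^ card \<omega> * (1 - p) ^ card (E - \<omega>) * f \<omega>)"

abbreviation bprob :: "'e set \<Rightarrow> ('e set \<Rightarrow> bool) \<Rightarrow> real" where
  "bprob E Q \<equiv> bexp E (\<lambda>\<omega>. of_bool (Q \<omega>))"

lemma bexp_empty [simp]: "bexp {} f = f {}"
  by (simp add: bexp_def)

lemma bexp_insert:
  assumes "finite E" "e \<notin> E"
  shows "bexp (insert e E) f = p * bexp E (\<lambda>\<omega>. f (insert e \<omega>)) + (1 - p) * bexp E f"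
proof -
  have 1: "Pow (insert e E) = insert e ` Pow E \<union> Pow E"
    by (simp add: Pow_insert Un_commute)
  have 2: "insert e ` Pow E \<inter> Pow E = {}"
    using assms by auto
  have 3: "inj_on (insert e) (Pow E)"
    using assms by (auto simp: inj_on_def)
  have a: "card (insert e \<omega>) = Suc (card \<omega>)" "insert e E - insert e \<omega> = E - \<omega>" if "\<omega> \<subseteq> E" for \<omega>
    using that assms finite_subset[OF that] by (auto intro!: card_insert_disjoint)
  have b: "card (insert e E - \<omega>) = Suc (card (E - \<omega>))" if "\<omega> \<subseteq> E" for \<omega>
  proof -
    have "insert e E - \<omega> = insert e (E - \<omega>)" using that assms by auto
    then show ?thesis using assms by simp
  qed
  have "bexp (insert e E) f =
      (\<Sum>\<omega>\<in>Pow E. p ^ card (insert e \<omega>) * (1 - p) ^ card (insert e E - insert e \<omega>) * f (insert e \<omega>))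
      + (\<Sum>\<omega>\<in>Pow E. p ^ card \<omega> * (1 - p) ^ card (insert e E - \<omega>) * f \<omega>)"
    unfolding bexp_def 1 using assms 2 3 by (subst sum.union_disjoint) (auto simp: sum.reindex)
  also have "\<dots> = p * bexp E (\<lambda>\<omega>. f (insert e \<omega>)) + (1 - p) * bexp E f"
    unfolding bexp_def sum_distrib_left using a b by (intro arg_cong2[where f = "(+)"] sum.cong) auto
  finally show ?thesis .
qed

lemma bexp_cong: "(\<And>\<omega>. \<omega> \<subseteq> E \<Longrightarrow> f \<omega> = g \<omega>) \<Longrightarrow> bexp E f = bexp E g"
  unfolding bexp_def by (intro sum.cong) auto

lemma bexp_mono: "(\<And>\<omega>. \<omega> \<subseteq> E \<Longrightarrow> f \<omega> \<le> g \<omega>) \<Longrightarrow> bexp E f \<le> bexp E g"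
  unfolding bexp_def using p_nonneg p_le_1 by (intro sum_mono mult_left_mono) auto

lemma bexp_add: "bexp E (\<lambda>\<omega>. f \<omega> + g \<omega>) = bexp E f + bexp E g"
  unfolding bexp_def by (simp add: sum.distrib algebra_simps)

lemma bexp_cmult: "bexp E (\<lambda>\<omega>. c * f \<omega>) = c * bexp E f"
  unfolding bexp_def sum_distrib_left by (intro sum.cong) (simp_all add: mult_ac)

lemma bexp_cmult_right: "bexp E (\<lambda>\<omega>. f \<omega> * c) = bexp E f * c"
  unfolding bexp_def sum_distrib_right by (intro sum.cong) (simp_all add: mult_ac)

lemma bexp_sum: "bexp E (\<lambda>\<omega>. \<Sum>i\<in>I. f i \<omega>) = (\<Sum>i\<in>I. bexp E (f i))"
  unfolding bexp_def by (subst sum.swap) (simp add: sum_distrib_left)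

lemma bexp_const: "finite E \<Longrightarrow> bexp E (\<lambda>_. c) = c"
  by (induction E rule: finite_induct) (auto simp: bexp_insert algebra_simps)

lemma bexp_nonneg: "(\<And>\<omega>. \<omega> \<subseteq> E \<Longrightarrow> 0 \<le> f \<omega>) \<Longrightarrow> 0 \<le> bexp E f"
  unfolding bexp_def using p_nonneg p_le_1 by (intro sum_nonneg mult_nonneg_nonneg) auto

lemma bprob_le_1: "finite E \<Longrightarrow> bprob E Q \<le> 1"
  using bexp_mono[of E "\<lambda>\<omega>. of_bool (Q \<omega>)" "\<lambda>_. 1"] by (simp add: bexp_const)

lemma bexp_Un:
  assumes "finite E1" "finite E2" "E1 \<inter> E2 = {}"
  shows "bexp (E1 \<union> E2) f = bexp E1 (\<lambda>\<omega>1. bexp E2 (\<lambda>\<omega>2. f (\<omega>1 \<union> \<omega>2)))"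
  using assms
proof (induction E1 arbitrary: f rule: finite_induct)
  case empty
  then show ?case by simp
next
  case (insert e E1)
  then have "bexp (insert e E1 \<union> E2) f =
      p * bexp (E1 \<union> E2) (\<lambda>\<omega>. f (insert e \<omega>)) + (1 - p) * bexp (E1 \<union> E2) f"
    by (simp add: bexp_insert)
  with insert show ?case
    by (simp add: bexp_insert)
qed

lemma bexp_restrict:
  assumes "finite E" "F \<subseteq> E"
  shows "bexp E (\<lambda>\<omega>. f (\<omega> \<inter> F)) = bexp F f"
proof -
  have E: "E = F \<union> (E - F)" "finite F" using assms by (auto intro: finite_subset)
  have "bexp E (\<lambda>\<omega>. f (\<omega> \<inter> F)) =
      bexp F (\<lambda>\<omega>1. bexp (E - F) (\<lambda>\<omega>2. f ((\<omega>1 \<union> \<omega>2) \<inter> F)))"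
    using bexp_Un[of F "E - F"] assms E by simp
  also have "\<dots> = bexp F (\<lambda>\<omega>1. bexp (E - F) (\<lambda>\<omega>2. f \<omega>1))"
    by (intro bexp_cong arg_cong[where f = f]) auto
  finally show ?thesis using assms by (simp add: bexp_const)
qed

lemma bexp_indep:
  assumes "finite E" "E1 \<subseteq> E" "E2 \<subseteq> E" "E1 \<inter> E2 = {}"
  shows "bexp E (\<lambda>\<omega>. f (\<omega> \<inter> E1) * g (\<omega> \<inter> E2)) = bexp E1 f * bexp E2 g"
proof -
  have fin: "finite E1" "finite E2" using assms(1-3) by (meson finite_subset)+
  have "bexp E (\<lambda>\<omega>. f (\<omega> \<inter> E1) * g (\<omega> \<inter> E2)) =
        bexp E (\<lambda>\<omega>. (\<lambda>\<omega>. f (\<omega> \<inter> E1) * g (\<omega> \<inter> E2)) (\<omega> \<inter> (E1 \<union> E2)))"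
    by (intro bexp_cong arg_cong2[where f = "(*)"] arg_cong[where f = f] arg_cong[where f = g]) auto
  also have "\<dots> = bexp (E1 \<union> E2) (\<lambda>\<omega>. f (\<omega> \<inter> E1) * g (\<omega> \<inter> E2))"
    using assms by (intro bexp_restrict) auto
  also have "\<dots> = bexp E1 (\<lambda>\<omega>1. bexp E2 (\<lambda>\<omega>2. f \<omega>1 * g \<omega>2))"
    unfolding bexp_Un[OF fin assms(4)] using assms(4)
    by (intro bexp_cong arg_cong2[where f = "(*)"] arg_cong[where f = f] arg_cong[where f = g]) auto
  also have "\<dots> = bexp E1 f * bexp E2 g"
    by (simp add: bexp_cmult bexp_cmult_right)
  finally show ?thesis .
qed

lemma bexp_open:
  assumes "finite E" "F \<subseteq> E"
  shows "bexp E (\<lambda>\<omega>. of_bool (F \<subseteq> \<omega>) * f \<omega>) = p ^ card F * bexp (E - F) (\<lambda>\<omega>. f (\<omega> \<union> F))"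
proof -
  have E: "E = F \<union> (E - F)" "finite F" using assms by (auto intro: finite_subset)
  have "bexp E (\<lambda>\<omega>. of_bool (F \<subseteq> \<omega>) * f \<omega>) =
      bexp F (\<lambda>\<omega>1. bexp (E - F) (\<lambda>\<omega>2. of_bool (F \<subseteq> \<omega>1 \<union> \<omega>2) * f (\<omega>1 \<union> \<omega>2)))"
    using bexp_Un[of F "E - F"] assms E by simp
  also have "\<dots> = bexp F (\<lambda>\<omega>1. of_bool (\<omega>1 = F) * bexp (E - F) (\<lambda>\<omega>2. f (\<omega>2 \<union> F)))"
    unfolding bexp_cmult[symmetric] by (intro bexp_cong) (auto simp: Un_commute)
  also have "\<dots> = (\<Sum>\<omega>\<in>Pow F. if \<omega> = F then p ^ card F * bexp (E - F) (\<lambda>\<omega>. f (\<omega> \<union> F)) else 0)"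
    unfolding bexp_def[of F] by (intro sum.cong) auto
  also have "\<dots> = p ^ card F * bexp (E - F) (\<lambda>\<omega>. f (\<omega> \<union> F))"
    using E by simp
  finally show ?thesis .
qed

section \<open>Correlation inequalities: Harris and BK\<close>

lemma harris:
  assumes "finite E"
    and "\<And>\<omega> \<omega>'. \<omega> \<subseteq> \<omega>' \<Longrightarrow> f \<omega> \<le> f \<omega>'" and "\<And>\<omega> \<omega>'. \<omega> \<subseteq> \<omega>' \<Longrightarrow> g \<omega> \<le> g \<omega>'"
  shows "bexp E f * bexp E g \<le> bexp E (\<lambda>\<omega>. f \<omega> * g \<omega>)"
  using assms
proof (induction E arbitrary: f g rule: finite_induct)
  case empty
  then show ?case by simp
next
  case (insert e E)
  define F0 F1 G0 G1 where "F0 = bexp E f" "F1 = bexp E (\<lambda>\<omega>. f (insert e \<omega>))"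
    "G0 = bexp E g" "G1 = bexp E (\<lambda>\<omega>. g (insert e \<omega>))"
  note defs = this
  have le: "F0 \<le> F1" "G0 \<le> G1"
    unfolding defs by (intro bexp_mono insert.prems; auto)+
  have 1: "F0 * G0 \<le> bexp E (\<lambda>\<omega>. f \<omega> * g \<omega>)"
    unfolding defs using insert.prems by (intro insert.IH) auto
  have 2: "F1 * G1 \<le> bexp E (\<lambda>\<omega>. f (insert e \<omega>) * g (insert e \<omega>))"
    unfolding defs by (intro insert.IH insert.prems) auto
  \<comment> \<open>Chebyshev's identity for a single edge: the covariance of the two conditional
    expectations is \<open>p * (1 - p)\<close> times the product of their increments, which are both
    nonnegative.\<close>
  have "(p * F1 + (1 - p) * F0) * (p * G1 + (1 - p) * G0) + p * (1 - p) * ((F1 - F0) * (G1 - G0))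
      = p * (F1 * G1) + (1 - p) * (F0 * G0)"
    by (simp add: algebra_simps)
  moreover have "0 \<le> p * (1 - p) * ((F1 - F0) * (G1 - G0))"
    using le p_nonneg p_le_1 by (intro mult_nonneg_nonneg) auto
  moreover have "p * (F1 * G1) + (1 - p) * (F0 * G0) \<le>
     p * bexp E (\<lambda>\<omega>. f (insert e \<omega>) * g (insert e \<omega>)) + (1 - p) * bexp E (\<lambda>\<omega>. f \<omega> * g \<omega>)"
    using 1 2 p_nonneg p_le_1 by (intro add_mono mult_left_mono) auto
  ultimately show ?case
    using insert.hyps by (simp add: bexp_insert defs)
qed

lemma bexp_add4: "bexp E f + bexp E g \<le> bexp E h + bexp E k"
  if "\<And>\<omega>. \<omega> \<subseteq> E \<Longrightarrow> f \<omega> + g \<omega> \<le> h \<omega> + k \<omega>"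
  using bexp_mono[of E "\<lambda>\<omega>. f \<omega> + g \<omega>" "\<lambda>\<omega>. h \<omega> + k \<omega>"] that by (simp add: bexp_add)

text \<open>In the induction step the edge \<open>e\<close> is replaced by two independent copies, one for each
  component of the pair; disjointness means that at most one of the copies is ever needed.\<close>

lemma bk_pairs:
  fixes G :: "('e set \<times> 'e set) set"
  assumes "finite E" and "\<And>F1 F2. (F1, F2) \<in> G \<Longrightarrow> F1 \<inter> F2 = {}"
  shows "bprob E (\<lambda>\<omega>. \<exists>(F1, F2)\<in>G. F1 \<subseteq> \<omega> \<and> F2 \<subseteq> \<omega>)
    \<le> bexp E (\<lambda>\<omega>1. bprob E (\<lambda>\<omega>2. \<exists>(F1, F2)\<in>G. F1 \<subseteq> \<omega>1 \<and> F2 \<subseteq> \<omega>2))"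
  using assms
proof (induction E arbitrary: G rule: finite_induct)
  case empty
  then show ?case by auto
next
  case (insert e E)
  define two where "two H = bexp E (\<lambda>\<omega>1. bprob E (\<lambda>\<omega>2. \<exists>(F1, F2)\<in>H. F1 \<subseteq> \<omega>1 \<and> F2 \<subseteq> \<omega>2))"
    for H :: "('e set \<times> 'e set) set"
  define G0 where "G0 = {(F1, F2) \<in> G. e \<notin> F1 \<and> e \<notin> F2}"
  define G1 where "G1 = {(F1 - {e}, F2) | F1 F2. (F1, F2) \<in> G \<and> e \<notin> F2}"
  define G2 where "G2 = {(F1, F2 - {e}) | F1 F2. (F1, F2) \<in> G \<and> e \<notin> F1}"
  define GA where "GA = {(F1 - {e}, F2 - {e}) | F1 F2. (F1, F2) \<in> G}"
  \<comment> \<open>Disjointness enters here: no pair has \<open>e\<close> in both components, so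
    removing \<open>e\<close> from both amounts to removing it from at most one.\<close>
  have GA: "GA = G1 \<union> G2"
  proof
    show "GA \<subseteq> G1 \<union> G2"
    proof
      fix x assume "x \<in> GA"
      then obtain F1 F2 where x: "x = (F1 - {e}, F2 - {e})" "(F1, F2) \<in> G" by (auto simp: GA_def)
      then have "F1 \<inter> F2 = {}" using insert.prems by auto
      then consider "e \<notin> F2" | "e \<notin> F1" by auto
      then show "x \<in> G1 \<union> G2"
      proof cases
        case 1
        then have "F2 - {e} = F2" by auto
        then show ?thesis using x 1 unfolding G1_def by auto
      next
        case 2
        then have "F1 - {e} = F1" by auto
        then show ?thesis using x 2 unfolding G2_def by auto
      qed
    qed
    show "G1 \<union> G2 \<subseteq> GA" unfolding GA_def G1_def G2_def by fastforce
  qed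
  have G0: "G0 \<subseteq> G1" "G0 \<subseteq> G2" unfolding G0_def G1_def G2_def by fastforce+
  have disjA: "F1 \<inter> F2 = {}" if "(F1, F2) \<in> GA" for F1 F2
    using that insert.prems unfolding GA_def by blast
  have disj0: "F1 \<inter> F2 = {}" if "(F1, F2) \<in> G0" for F1 F2
    using that insert.prems unfolding G0_def by blast
  let ?ev = "\<lambda>\<omega>. \<exists>(F1, F2)\<in>G. F1 \<subseteq> \<omega> \<and> F2 \<subseteq> \<omega>"
  let ?ev2 = "\<lambda>\<omega>1 \<omega>2. \<exists>(F1, F2)\<in>G. F1 \<subseteq> \<omega>1 \<and> F2 \<subseteq> \<omega>2"
  have e: "e \<notin> \<omega>" if "\<omega> \<subseteq> E" for \<omega> using that insert.hyps by auto
  have exA: "(\<exists>(F1, F2)\<in>GA. F1 \<subseteq> A \<and> F2 \<subseteq> B) \<longleftrightarrow> (\<exists>F1 F2. (F1, F2) \<in> G \<and> F1 - {e} \<subseteq> A \<and> F2 - {e} \<subseteq> B)" for A B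
    unfolding GA_def by blast
  have ex1: "(\<exists>(F1, F2)\<in>G1. F1 \<subseteq> A \<and> F2 \<subseteq> B) \<longleftrightarrow> (\<exists>F1 F2. (F1, F2) \<in> G \<and> F1 - {e} \<subseteq> A \<and> F2 \<subseteq> B \<and> e \<notin> F2)" for A B
    unfolding G1_def by blast
  have ex2: "(\<exists>(F1, F2)\<in>G2. F1 \<subseteq> A \<and> F2 \<subseteq> B) \<longleftrightarrow> (\<exists>F1 F2. (F1, F2) \<in> G \<and> F1 \<subseteq> A \<and> F2 - {e} \<subseteq> B \<and> e \<notin> F1)" for A B
    unfolding G2_def by blast
  have si: "F \<subseteq> insert e A \<longleftrightarrow> F - {e} \<subseteq> A" for F A by blast
  have ev1: "?ev (insert e \<omega>) \<longleftrightarrow> (\<exists>(F1, F2)\<in>GA. F1 \<subseteq> \<omega> \<and> F2 \<subseteq> \<omega>)" for \<omega>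
    unfolding exA si by blast
  have ev0: "?ev \<omega> \<longleftrightarrow> (\<exists>(F1, F2)\<in>G0. F1 \<subseteq> \<omega> \<and> F2 \<subseteq> \<omega>)" if "\<omega> \<subseteq> E" for \<omega>
    unfolding G0_def using e[OF that] by blast
  have ev11: "?ev2 (insert e \<omega>1) (insert e \<omega>2) \<longleftrightarrow> (\<exists>(F1, F2)\<in>GA. F1 \<subseteq> \<omega>1 \<and> F2 \<subseteq> \<omega>2)" for \<omega>1 \<omega>2
    unfolding exA si by blast
  have ev10: "?ev2 (insert e \<omega>1) \<omega>2 \<longleftrightarrow> (\<exists>(F1, F2)\<in>G1. F1 \<subseteq> \<omega>1 \<and> F2 \<subseteq> \<omega>2)" if "\<omega>2 \<subseteq> E" for \<omega>1 \<omega>2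
    unfolding ex1 si using e[OF that] by blast
  have ev01: "?ev2 \<omega>1 (insert e \<omega>2) \<longleftrightarrow> (\<exists>(F1, F2)\<in>G2. F1 \<subseteq> \<omega>1 \<and> F2 \<subseteq> \<omega>2)" if "\<omega>1 \<subseteq> E" for \<omega>1 \<omega>2
    unfolding ex2 si using e[OF that] by blast
  have ev00: "?ev2 \<omega>1 \<omega>2 \<longleftrightarrow> (\<exists>(F1, F2)\<in>G0. F1 \<subseteq> \<omega>1 \<and> F2 \<subseteq> \<omega>2)" if "\<omega>1 \<subseteq> E" "\<omega>2 \<subseteq> E" for \<omega>1 \<omega>2
    unfolding G0_def using e[OF that(1)] e[OF that(2)] by blast
  have "bprob (insert e E) ?ev = p * bprob E (\<lambda>\<omega>. \<exists>(F1, F2)\<in>GA. F1 \<subseteq> \<omega> \<and> F2 \<subseteq> \<omega>)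
      + (1 - p) * bprob E (\<lambda>\<omega>. \<exists>(F1, F2)\<in>G0. F1 \<subseteq> \<omega> \<and> F2 \<subseteq> \<omega>)"
    unfolding bexp_insert[OF insert.hyps] ev1
    by (intro arg_cong2[where f = "(+)"] arg_cong2[where f = "(*)"] bexp_cong refl) (simp only: ev0)
  also have "\<dots> \<le> p * two GA + (1 - p) * two G0"
    unfolding two_def using disjA disj0 p_nonneg p_le_1 by (intro add_mono mult_left_mono insert.IH) auto
  \<comment> \<open>Split according to the states of the two copies of \<open>e\<close>. Only the
    terms with exactly one open copy differ from the target, and there a pointwise comparison of
    indicators suffices.\<close>
  also have "\<dots> = p * p * two GA + p * (1 - p) * (two GA + two G0) + (1 - p) * (1 - p) * two G0"
    by (simp add: algebra_simps)
  also have "\<dots> \<le> p * p * two GA + p * (1 - p) * (two G1 + two G2) + (1 - p) * (1 - p) * two G0"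
  proof -
    have "two GA + two G0 \<le> two G1 + two G2"
      unfolding two_def
    proof (intro bexp_add4)
      fix \<omega>1 \<omega>2 :: "'e set"
      let ?e = "\<lambda>H. \<exists>(F1, F2)\<in>H. F1 \<subseteq> \<omega>1 \<and> F2 \<subseteq> \<omega>2"
      have "?e GA \<Longrightarrow> ?e G1 \<or> ?e G2" unfolding GA by blast
      moreover have "?e G0 \<Longrightarrow> ?e G1 \<and> ?e G2" using G0 by blast
      moreover have "?e G1 \<Longrightarrow> ?e GA" "?e G2 \<Longrightarrow> ?e GA" unfolding GA by blast+
      ultimately show "of_bool (?e GA) + of_bool (?e G0) \<le> (of_bool (?e G1) + of_bool (?e G2) :: real)"
        by (cases "?e GA"; cases "?e G0"; cases "?e G1"; cases "?e G2") simp_all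
    qed
    then show ?thesis
      using p_nonneg p_le_1 by (intro add_right_mono add_left_mono mult_left_mono) auto
  qed
  also have "\<dots> = bexp (insert e E) (\<lambda>\<omega>1. bprob (insert e E) (\<lambda>\<omega>2. ?ev2 \<omega>1 \<omega>2))"
  proof -
    have 10: "bexp E (\<lambda>\<omega>1. bprob E (\<lambda>\<omega>2. ?ev2 (insert e \<omega>1) \<omega>2)) = two G1"
      unfolding two_def by (intro bexp_cong) (simp only: ev10)
    have 01: "bexp E (\<lambda>\<omega>1. bprob E (\<lambda>\<omega>2. ?ev2 \<omega>1 (insert e \<omega>2))) = two G2"
      unfolding two_def by (intro bexp_cong) (simp only: ev01)
    have 00: "bexp E (\<lambda>\<omega>1. bprob E (\<lambda>\<omega>2. ?ev2 \<omega>1 \<omega>2)) = two G0"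
      unfolding two_def by (intro bexp_cong) (simp only: ev00)
    have 11: "bexp E (\<lambda>\<omega>1. bprob E (\<lambda>\<omega>2. ?ev2 (insert e \<omega>1) (insert e \<omega>2))) = two GA"
      unfolding two_def by (simp only: ev11)
    show ?thesis
      unfolding bexp_insert[OF insert.hyps] bexp_add bexp_cmult 10 01 00 11
      by (simp add: algebra_simps)
  qed
  finally show ?case .
qed

text \<open>Edge-disjoint witnesses inside \<open>\<omega>\<close> are all that has to be exhibited
  for \<open>Q\<close>; the two independent copies of \<open>bk_pairs\<close> then decouple the
  witnesses into a product.\<close>

lemma bk:
  fixes E :: "'e set"
  assumes "finite E"
    and ev: "\<And>\<omega>. \<omega> \<subseteq> E \<Longrightarrow> Q \<omega> \<Longrightarrow> \<exists>F1 F2. F1 \<inter> F2 = {} \<and> F1 \<subseteq> \<omega> \<and> F2 \<subseteq> \<omega> \<and> Q1 F1 \<and> Q2 F2"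
    and Q1: "\<And>F F'. Q1 F \<Longrightarrow> F \<subseteq> F' \<Longrightarrow> Q1 F'" and Q2: "\<And>F F'. Q2 F \<Longrightarrow> F \<subseteq> F' \<Longrightarrow> Q2 F'"
  shows "bprob E Q \<le> bprob E Q1 * bprob E Q2"
proof -
  define G where "G = {(F1, F2). F1 \<inter> F2 = {} \<and> Q1 F1 \<and> Q2 F2}"
  have "bprob E Q \<le> bprob E (\<lambda>\<omega>. \<exists>(F1, F2)\<in>G. F1 \<subseteq> \<omega> \<and> F2 \<subseteq> \<omega>)"
  proof (rule bexp_mono)
    fix \<omega> assume "\<omega> \<subseteq> E"
    have "\<exists>(F1, F2)\<in>G. F1 \<subseteq> \<omega> \<and> F2 \<subseteq> \<omega>" if Q: "Q \<omega>"
    proof -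
      obtain F1 F2 where "F1 \<inter> F2 = {}" "F1 \<subseteq> \<omega>" "F2 \<subseteq> \<omega>" "Q1 F1" "Q2 F2"
        using ev[OF \<open>\<omega> \<subseteq> E\<close> Q] by (elim exE conjE)
      then show ?thesis by (intro bexI[of _ "(F1, F2)"]) (simp_all add: G_def)
    qed
    then show "of_bool (Q \<omega>) \<le> (of_bool (\<exists>(F1, F2)\<in>G. F1 \<subseteq> \<omega> \<and> F2 \<subseteq> \<omega>) :: real)"
      by (cases "Q \<omega>") simp_all
  qed
  also have "\<dots> \<le> bexp E (\<lambda>\<omega>1. bprob E (\<lambda>\<omega>2. \<exists>(F1, F2)\<in>G. F1 \<subseteq> \<omega>1 \<and> F2 \<subseteq> \<omega>2))"
    by (intro bk_pairs assms) (auto simp: G_def)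
  also have "\<dots> \<le> bexp E (\<lambda>\<omega>1. bexp E (\<lambda>\<omega>2. of_bool (Q1 \<omega>1) * of_bool (Q2 \<omega>2)))"
  proof (intro bexp_mono)
    fix \<omega>1 \<omega>2 :: "'e set"
    have "Q1 \<omega>1 \<and> Q2 \<omega>2" if "\<exists>(F1, F2)\<in>G. F1 \<subseteq> \<omega>1 \<and> F2 \<subseteq> \<omega>2"
    proof -
      from that obtain F1 F2 where "Q1 F1" "Q2 F2" "F1 \<subseteq> \<omega>1" "F2 \<subseteq> \<omega>2"
        by (auto simp: G_def)
      then show ?thesis using Q1[of F1 \<omega>1] Q2[of F2 \<omega>2] by simp
    qed
    then show "of_bool (\<exists>(F1, F2)\<in>G. F1 \<subseteq> \<omega>1 \<and> F2 \<subseteq> \<omega>2) \<le> (of_bool (Q1 \<omega>1) * of_bool (Q2 \<omega>2) :: real)"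
      by (cases "\<exists>(F1, F2)\<in>G. F1 \<subseteq> \<omega>1 \<and> F2 \<subseteq> \<omega>2") simp_all
  qed
  also have "\<dots> = bprob E Q1 * bprob E Q2"
    by (simp only: bexp_cmult bexp_cmult_right)
  finally show ?thesis .
qed

lemma bprob_union:
  assumes "finite I" "\<And>\<omega>. \<omega> \<subseteq> E \<Longrightarrow> Q \<omega> \<Longrightarrow> \<exists>i\<in>I. R i \<omega>"
  shows "bprob E Q \<le> (\<Sum>i\<in>I. bprob E (R i))"
proof -
  have "bprob E Q \<le> bexp E (\<lambda>\<omega>. \<Sum>i\<in>I. of_bool (R i \<omega>))"
  proof (rule bexp_mono)
    fix \<omega> assume "\<omega> \<subseteq> E"
    show "(of_bool (Q \<omega>) :: real) \<le> (\<Sum>i\<in>I. of_bool (R i \<omega>))"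
    proof (cases "Q \<omega>")
      case True
      then obtain i where i: "i \<in> I" "R i \<omega>" using assms(2) \<open>\<omega> \<subseteq> E\<close> by blast
      have "(1::real) = of_bool (R i \<omega>)" using i by simp
      also have "\<dots> \<le> (\<Sum>i\<in>I. of_bool (R i \<omega>))"
        using i assms(1) by (intro member_le_sum) auto
      finally show ?thesis using True by simp
    qed (auto intro: sum_nonneg)
  qed
  then show ?thesis by (simp add: bexp_sum)
qed

lemma bprob_disjoint_union:
  assumes "finite I" "\<And>i \<omega>. \<omega> \<subseteq> E \<Longrightarrow> i \<in> I \<Longrightarrow> R i \<omega> \<Longrightarrow> Q \<omega>"
    "\<And>i j \<omega>. \<omega> \<subseteq> E \<Longrightarrow> i \<in> I \<Longrightarrow> j \<in> I \<Longrightarrow> R i \<omega> \<Longrightarrow> R j \<omega> \<Longrightarrow> i = j"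
  shows "(\<Sum>i\<in>I. bprob E (R i)) \<le> bprob E Q"
proof -
  have "(\<Sum>i\<in>I. bprob E (R i)) = bexp E (\<lambda>\<omega>. \<Sum>i\<in>I. of_bool (R i \<omega>))"
    by (simp add: bexp_sum)
  also have "\<dots> \<le> bprob E Q"
  proof (rule bexp_mono)
    fix \<omega> assume \<omega>: "\<omega> \<subseteq> E"
    show "(\<Sum>i\<in>I. of_bool (R i \<omega>)) \<le> (of_bool (Q \<omega>) :: real)"
    proof (cases "\<exists>i\<in>I. R i \<omega>")
      case True
      then obtain i where i: "i \<in> I" "R i \<omega>" by blast
      have "(\<Sum>j\<in>I. of_bool (R j \<omega>)) = (\<Sum>j\<in>I. if j = i then 1 else 0 :: real)"
        using assms(3)[OF \<omega>] i by (intro sum.cong) auto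
      then show ?thesis using assms(1) assms(2)[OF \<omega>] i by simp
    qed auto
  qed
  finally show ?thesis .
qed

end

section \<open>Open paths\<close>

fun pedges :: "'v list \<Rightarrow> 'v set set" where
  "pedges (x # y # xs) = insert {x, y} (pedges (y # xs))"
| "pedges [x] = {}"
| "pedges [] = {}"

lemma pedges_append: "pedges (us @ v # ws) = pedges (us @ [v]) \<union> pedges (v # ws)"
  by (induction us rule: pedges.induct) auto

lemma pedges_snoc: "us \<noteq> [] \<Longrightarrow> pedges (us @ [v]) = insert {last us, v} (pedges us)"
  by (induction us rule: pedges.induct) auto

lemma pedges_rev [simp]: "pedges (rev xs) = pedges xs"
proof (induction xs rule: pedges.induct)
  case (1 x y xs)
  have "pedges (rev (x # y # xs)) = insert {y, x} (pedges (rev (y # xs)))"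
    using pedges_snoc[of "rev (y # xs)" x] by simp
  with 1 show ?case by (simp add: insert_commute)
qed auto

lemma pedges_edge:
  "distinct xs \<Longrightarrow> e \<in> pedges xs \<Longrightarrow> \<exists>a b. a \<noteq> b \<and> e = {a, b} \<and> a \<in> set xs \<and> b \<in> set xs"
  by (induction xs rule: pedges.induct) auto

lemma pedges_subset: "e \<in> pedges xs \<Longrightarrow> e \<subseteq> set xs"
  by (induction xs rule: pedges.induct) auto

lemma pedges_nth: "e \<in> pedges xs \<Longrightarrow> \<exists>t. Suc t < length xs \<and> e = {xs ! t, xs ! Suc t}"
proof (induction xs rule: pedges.induct)
  case (1 x y xs)
  from 1(2) consider "e = {x, y}" | "e \<in> pedges (y # xs)" by auto
  then show ?case
  proof cases
    case 1
    then show ?thesis by (intro exI[of _ 0]) simp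
  next
    case 2
    then obtain t where "Suc t < length (y # xs)" "e = {(y # xs) ! t, (y # xs) ! Suc t}"
      using 1(1) by blast
    then show ?thesis by (intro exI[of _ "Suc t"]) simp
  qed
qed auto

lemma pedges_disjoint:
  assumes "distinct (us @ v # ws)"
  shows "pedges (us @ [v]) \<inter> pedges (v # ws) = {}"
proof (rule equals0I)
  fix e assume e: "e \<in> pedges (us @ [v]) \<inter> pedges (v # ws)"
  then have "e \<subseteq> set (us @ [v])" "e \<subseteq> set (v # ws)" using pedges_subset by blast+
  then have "e \<subseteq> {v}" using assms by auto
  moreover have "distinct (us @ [v])" using assms by simp
  with e obtain a b where "a \<noteq> b" "e = {a, b}" using pedges_edge by blast
  ultimately show False by auto
qed

lemma finite_pedges: "finite (pedges xs)"
  by (induction xs rule: pedges.induct) auto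

text \<open>Paths are self-avoiding, unlike the walks of \<open>connected_in\<close>: cutting one at
  a vertex then leaves two edge-disjoint pieces, which is what BK needs.\<close>

definition opath :: "'v set set \<Rightarrow> 'v set \<Rightarrow> 'v \<Rightarrow> 'v \<Rightarrow> 'v list \<Rightarrow> bool" where
  "opath \<omega> A x y xs \<longleftrightarrow>
     xs \<noteq> [] \<and> hd xs = x \<and> last xs = y \<and> distinct xs \<and> set xs \<subseteq> A \<and> pedges xs \<subseteq> \<omega>"

definition conn :: "'v set set \<Rightarrow> 'v set \<Rightarrow> 'v \<Rightarrow> 'v \<Rightarrow> bool" where
  "conn \<omega> A x y \<longleftrightarrow> (\<exists>xs. opath \<omega> A x y xs)"

lemma opath_mono: "opath \<omega> A x y xs \<Longrightarrow> \<omega> \<subseteq> \<omega>' \<Longrightarrow> A \<subseteq> A' \<Longrightarrow> opath \<omega>' A' x y xs"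
  unfolding opath_def by auto

lemma conn_mono: "conn \<omega> A x y \<Longrightarrow> \<omega> \<subseteq> \<omega>' \<Longrightarrow> A \<subseteq> A' \<Longrightarrow> conn \<omega>' A' x y"
  unfolding conn_def by (elim exE, rule exI, rule opath_mono)

lemma opath_split:
  assumes "opath \<omega> A x y (us @ v # ws)"
  shows "opath (pedges (us @ [v])) A x v (us @ [v])" "opath (pedges (v # ws)) A v y (v # ws)"
    "pedges (us @ [v]) \<inter> pedges (v # ws) = {}" "pedges (us @ [v]) \<subseteq> \<omega>" "pedges (v # ws) \<subseteq> \<omega>"
proof -
  have d: "distinct (us @ v # ws)" using assms by (simp add: opath_def)
  show "pedges (us @ [v]) \<inter> pedges (v # ws) = {}" by (rule pedges_disjoint[OF d])
  show "opath (pedges (us @ [v])) A x v (us @ [v])" "opath (pedges (v # ws)) A v y (v # ws)"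
    using assms unfolding opath_def by (cases us; simp)+
  show "pedges (us @ [v]) \<subseteq> \<omega>" "pedges (v # ws) \<subseteq> \<omega>"
    using assms pedges_append[of us v ws] by (auto simp: opath_def)
qed

lemma opath_prefix_suffix:
  assumes "opath \<omega> A x y (us @ v # ws)"
  shows "opath \<omega> A x v (us @ [v])" "opath \<omega> A v y (v # ws)"
  using opath_split[OF assms] opath_mono[OF _ _ order.refl] by metis+

lemma opath_rev: "opath \<omega> A x y xs \<Longrightarrow> opath \<omega> A y x (rev xs)"
  by (auto simp: opath_def hd_rev last_rev)

lemma conn_sym: "conn \<omega> A x y \<Longrightarrow> conn \<omega> A y x"
  unfolding conn_def by (elim exE, rule exI, rule opath_rev)

lemma conn_refl [simp]: "conn \<omega> A x x \<longleftrightarrow> x \<in> A"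
  unfolding conn_def opath_def by (force intro: exI[of _ "[x]"])

lemma conn_in: "conn \<omega> A x y \<Longrightarrow> x \<in> A" "conn \<omega> A x y \<Longrightarrow> y \<in> A"
  unfolding conn_def opath_def using hd_in_set last_in_set by fastforce+

text \<open>If \<open>x\<close> already lies on the path, the part of the path from \<open>x\<close>
  on is taken instead, so that the result stays self-avoiding.\<close>

lemma conn_step:
  assumes "conn \<omega> A y z" "x \<in> A" "{x, y} \<in> \<omega>"
  shows "conn \<omega> A x z"
proof -
  obtain xs where xs: "opath \<omega> A y z xs" using assms(1) by (auto simp: conn_def)
  show ?thesis
  proof (cases "x \<in> set xs")
    case True
    then obtain us ws where "xs = us @ x # ws" by (meson split_list)
    then have "opath \<omega> A x z (x # ws)" using opath_prefix_suffix(2) xs by metis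
    then show ?thesis by (auto simp: conn_def)
  next
    case False
    then have "opath \<omega> A x z (x # xs)" using xs assms by (cases xs) (auto simp: opath_def)
    then show ?thesis by (auto simp: conn_def)
  qed
qed

lemma conn_walk:
  "xs \<noteq> [] \<Longrightarrow> set xs \<subseteq> A \<Longrightarrow> pedges xs \<subseteq> \<omega> \<Longrightarrow> conn \<omega> A (hd xs) (last xs)"
proof (induction xs rule: pedges.induct)
  case (1 x y xs)
  then have "conn \<omega> A y (last (y # xs))" by simp
  moreover have "x \<in> A" "{x, y} \<in> \<omega>" using 1 by auto
  ultimately have "conn \<omega> A x (last (y # xs))" using conn_step by metis
  then show ?case by simp
qed auto

lemma conn_trans:
  assumes "conn \<omega> A x y" "conn \<omega> A y z"
  shows "conn \<omega> A x z"
proof -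
  have "conn \<omega> A (last xs) z \<Longrightarrow> xs \<noteq> [] \<Longrightarrow> set xs \<subseteq> A \<Longrightarrow> pedges xs \<subseteq> \<omega> \<Longrightarrow> conn \<omega> A (hd xs) z" for xs
    by (induction xs rule: pedges.induct) (auto intro: conn_step)
  then show ?thesis using assms unfolding conn_def[of _ _ x y] opath_def by blast
qed

lemma successively_pedges: "successively (\<lambda>u v. {u, v} \<in> F) xs \<longleftrightarrow> pedges xs \<subseteq> F"
  by (induction xs rule: pedges.induct) auto

lemma connected_in_conn: "connected_in E \<omega> A x y \<longleftrightarrow> conn {e \<in> E. \<omega> e} A x y"
proof -
  have eq: "(\<lambda>u v. {u, v} \<in> E \<and> \<omega> {u, v}) = (\<lambda>u v. {u, v} \<in> {e \<in> E. \<omega> e})" by auto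
  show ?thesis
    unfolding connected_in_def eq successively_pedges
  proof
    assume "\<exists>xs. xs \<noteq> [] \<and> hd xs = x \<and> last xs = y \<and> set xs \<subseteq> A \<and> pedges xs \<subseteq> {e \<in> E. \<omega> e}"
    then obtain xs where "xs \<noteq> []" "hd xs = x" "last xs = y" "set xs \<subseteq> A" "pedges xs \<subseteq> {e \<in> E. \<omega> e}"
      by (elim exE conjE)
    then show "conn {e \<in> E. \<omega> e} A x y" using conn_walk[of xs A "{e \<in> E. \<omega> e}"] by simp
  next
    assume "conn {e \<in> E. \<omega> e} A x y"
    then show "\<exists>xs. xs \<noteq> [] \<and> hd xs = x \<and> last xs = y \<and> set xs \<subseteq> A \<and> pedges xs \<subseteq> {e \<in> E. \<omega> e}"
      unfolding conn_def opath_def by (elim exE, intro exI) (elim conjE, intro conjI)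
  qed
qed

lemma conn_restrict: "conn \<omega> A x y \<longleftrightarrow> conn (\<omega> \<inter> {e. e \<subseteq> A}) A x y"
proof
  assume "conn \<omega> A x y"
  then obtain xs where xs: "opath \<omega> A x y xs" by (auto simp: conn_def)
  then have "e \<subseteq> A" if "e \<in> pedges xs" for e
    using pedges_subset[OF that] by (auto simp: opath_def)
  with xs have "opath (\<omega> \<inter> {e. e \<subseteq> A}) A x y xs" by (auto simp: opath_def)
  then show "conn (\<omega> \<inter> {e. e \<subseteq> A}) A x y" by (auto simp: conn_def)
qed (auto elim: conn_mono)

text \<open>Invariant form of connectivity: a set that no open edge leaves within \<open>V\<close>
  traps the whole cluster. It replaces inductions along paths later on.\<close>

lemma conn_closed:
  assumes "conn \<omega> V x y" "x \<in> A" "\<And>u v. u \<in> A \<Longrightarrow> {u, v} \<in> \<omega> \<Longrightarrow> v \<in> V \<Longrightarrow> v \<in> A"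
  shows "y \<in> A"
proof -
  have "xs \<noteq> [] \<Longrightarrow> hd xs \<in> A \<Longrightarrow> set xs \<subseteq> V \<Longrightarrow> pedges xs \<subseteq> \<omega> \<Longrightarrow> last xs \<in> A" for xs
    by (induction xs rule: pedges.induct) (use assms(3) in auto)
  then show ?thesis using assms(1,2) by (auto simp: conn_def opath_def)
qed

section \<open>Percolation on a finite graph\<close>

locale finite_percolation = bernoulli_param +
  fixes V :: "'v set" and E :: "'v set set"
  assumes finite_V: "finite V" and E_sub: "E \<subseteq> Pow V"
begin

lemma finite_E: "finite E"
  using finite_V E_sub finite_subset by auto

definition tau :: "'v set \<Rightarrow> 'v \<Rightarrow> 'v \<Rightarrow> real" where
  "tau A x y = bprob E (\<lambda>\<omega>. conn \<omega> A x y)"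

lemma tau_nonneg: "0 \<le> tau A x y"
  unfolding tau_def by (intro bexp_nonneg) auto

lemma tau_le_1: "tau A x y \<le> 1"
  unfolding tau_def by (intro bprob_le_1 finite_E)

lemma bprob_mono: "(\<And>\<omega>. \<omega> \<subseteq> E \<Longrightarrow> P \<omega> \<Longrightarrow> Q \<omega>) \<Longrightarrow> bprob E P \<le> bprob E Q"
  by (intro bexp_mono) auto

lemma tau_mono: "A \<subseteq> B \<Longrightarrow> tau A x y \<le> tau B x y"
  unfolding tau_def by (intro bprob_mono) (auto elim: conn_mono)

lemma tau_harris: "tau A x y * tau A y z \<le> tau A x z"
proof -
  have "tau A x y * tau A y z \<le> bexp E (\<lambda>\<omega>. of_bool (conn \<omega> A x y) * of_bool (conn \<omega> A y z))"
    unfolding tau_def by (intro harris finite_E) (auto elim: conn_mono)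
  also have "\<dots> \<le> tau A x z"
    unfolding tau_def by (intro bexp_mono) (auto intro: conn_trans)
  finally show ?thesis .
qed

text \<open>An open path avoids \<open>W\<close> or can be cut at one of its visits to
  \<open>W\<close> into two edge-disjoint pieces; BK and a union bound do the rest. It controls both
  the loss from avoiding another cluster and the loss from confining a connection to a cube.\<close>

lemma tau_remove:
  assumes "finite A"
  shows "tau A a b \<le> tau (A - W) a b + (\<Sum>w\<in>W \<inter> A. tau A a w * tau A w b)"
proof -
  let ?R = "\<lambda>w \<omega>. \<exists>us ws. opath \<omega> A a b (us @ w # ws)"
  have "tau A a b \<le> bexp E (\<lambda>\<omega>. of_bool (conn \<omega> (A - W) a b) + of_bool (\<exists>w\<in>W \<inter> A. ?R w \<omega>))"
    unfolding tau_def
  proof (rule bexp_mono)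
    fix \<omega>
    have "conn \<omega> (A - W) a b \<or> (\<exists>w\<in>W \<inter> A. ?R w \<omega>)" if c: "conn \<omega> A a b"
    proof -
      obtain xs where xs: "opath \<omega> A a b xs" using c by (auto simp: conn_def)
      show ?thesis
      proof (cases "set xs \<inter> W = {}")
        case True
        then have "opath \<omega> (A - W) a b xs" using xs by (auto simp: opath_def)
        then show ?thesis by (auto simp: conn_def)
      next
        case False
        then obtain w where w: "w \<in> set xs" "w \<in> W" by auto
        then obtain us ws where "xs = us @ w # ws" by (meson split_list)
        then have "?R w \<omega>" using xs by auto
        moreover have "w \<in> A" using w xs by (auto simp: opath_def)
        ultimately show ?thesis using w by blast
      qed
    qed
    then show "of_bool (conn \<omega> A a b) \<le>
        (of_bool (conn \<omega> (A - W) a b) + of_bool (\<exists>w\<in>W \<inter> A. ?R w \<omega>) :: real)" by auto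
  qed
  also have "\<dots> = tau (A - W) a b + bprob E (\<lambda>\<omega>. \<exists>w\<in>W \<inter> A. ?R w \<omega>)"
    by (simp add: bexp_add tau_def)
  also have "bprob E (\<lambda>\<omega>. \<exists>w\<in>W \<inter> A. ?R w \<omega>) \<le> (\<Sum>w\<in>W \<inter> A. bprob E (?R w))"
    using assms by (intro bprob_union) auto
  also have "\<dots> \<le> (\<Sum>w\<in>W \<inter> A. tau A a w * tau A w b)"
  proof (rule sum_mono)
    fix w
    show "bprob E (?R w) \<le> tau A a w * tau A w b"
      unfolding tau_def
    proof (rule bk[OF finite_E])
      fix \<omega> assume "?R w \<omega>"
      then obtain us ws where "opath \<omega> A a b (us @ w # ws)" by blast
      from opath_split[OF this] show "\<exists>F1 F2. F1 \<inter> F2 = {} \<and> F1 \<subseteq> \<omega> \<and> F2 \<subseteq> \<omega> \<and> conn F1 A a w \<and> conn F2 A w b"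
        by (intro exI[of _ "pedges (us @ [w])"] exI[of _ "pedges (w # ws)"]) (auto simp: conn_def)
    qed (auto elim: conn_mono)
  qed
  finally show ?thesis by simp
qed

text \<open>The value that iterated BK assigns to a path from \<open>a\<close> to \<open>b\<close>
  visiting the listed sites in this order.\<close>

fun chain :: "'v set \<Rightarrow> 'v \<Rightarrow> 'v list \<Rightarrow> 'v \<Rightarrow> real" where
  "chain A a [] b = tau A a b"
| "chain A a (v # vs) b = tau A a v * chain A v vs b"

lemma visit_chain:
  "bprob E (\<lambda>\<omega>. \<exists>xs. opath \<omega> A a b xs \<and> subseq vs xs) \<le> chain A a vs b"
proof (induction vs arbitrary: a)
  case Nil
  then show ?case by (simp add: tau_def conn_def)
next
  case (Cons v vs)
  let ?Q = "\<lambda>\<omega>. \<exists>xs. opath \<omega> A v b xs \<and> subseq vs xs"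
  have "bprob E (\<lambda>\<omega>. \<exists>xs. opath \<omega> A a b xs \<and> subseq (v # vs) xs)
      \<le> bprob E (\<lambda>\<omega>. conn \<omega> A a v) * bprob E ?Q"
  proof (rule bk[OF finite_E])
    fix \<omega> assume "\<exists>xs. opath \<omega> A a b xs \<and> subseq (v # vs) xs"
    then obtain xs where xs: "opath \<omega> A a b xs" "subseq (v # vs) xs" by blast
    then obtain us ws where s: "xs = us @ v # ws" "subseq vs ws"
      by (auto dest: list_emb_ConsD)
    from opath_split[OF xs(1)[unfolded s]] s(2)
    show "\<exists>F1 F2. F1 \<inter> F2 = {} \<and> F1 \<subseteq> \<omega> \<and> F2 \<subseteq> \<omega> \<and> conn F1 A a v \<and> ?Q F2"
      by (intro exI[of _ "pedges (us @ [v])"] exI[of _ "pedges (v # ws)"]) (auto simp: conn_def)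
  next
    fix F F' :: "'v set set" assume "?Q F" "F \<subseteq> F'"
    then show "?Q F'" by (meson opath_mono order.refl)
  qed (auto elim: conn_mono)
  also have "\<dots> \<le> tau A a v * chain A v vs b"
    unfolding tau_def[symmetric] by (intro mult_left_mono Cons.IH tau_nonneg)
  finally show ?case by simp
qed

section \<open>A canonical open path and the connections branching off it\<close>

definition paths :: "'v set \<Rightarrow> 'v \<Rightarrow> 'v \<Rightarrow> 'v list set" where
  "paths A x y = {xs. xs \<noteq> [] \<and> hd xs = x \<and> last xs = y \<and> distinct xs \<and> set xs \<subseteq> A}"

lemma finite_paths: "finite A \<Longrightarrow> finite (paths A x y)"
  by (rule finite_subset[OF _ finite_subset_distinct[of A]]) (auto simp: paths_def)

lemma opath_paths: "opath \<omega> A x y xs \<longleftrightarrow> xs \<in> paths A x y \<and> pedges xs \<subseteq> \<omega>"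
  by (auto simp: opath_def paths_def)

text \<open>An arbitrary injective ranking; the open path of least rank will be the selected one.
  Injectivity makes the selection unique, and minimality makes it a decreasing condition on the
  remaining edges once the path itself is open.\<close>

definition path_index :: "'v list \<Rightarrow> nat" where
  "path_index = (SOME i. inj_on i {xs. distinct xs \<and> set xs \<subseteq> V})"

lemma inj_path_index: "inj_on path_index {xs. distinct xs \<and> set xs \<subseteq> V}"
proof -
  have "finite {xs. distinct xs \<and> set xs \<subseteq> V}"
    using finite_subset_distinct[OF finite_V] by (rule rev_finite_subset) auto
  then have "\<exists>i::'v list \<Rightarrow> nat. inj_on i {xs. distinct xs \<and> set xs \<subseteq> V}"
    using finite_imp_inj_to_nat_seg by blast
  then show ?thesis unfolding path_index_def by (rule someI_ex)
qed

definition sel :: "'v set \<Rightarrow> 'v \<Rightarrow> 'v \<Rightarrow> 'v set set \<Rightarrow> 'v list \<Rightarrow> bool" where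
  "sel A x y \<omega> xs \<longleftrightarrow> opath \<omega> A x y xs \<and> (\<forall>ys. opath \<omega> A x y ys \<longrightarrow> path_index xs \<le> path_index ys)"

lemma sel_unique: "A \<subseteq> V \<Longrightarrow> sel A x y \<omega> xs \<Longrightarrow> sel A x y \<omega> ys \<Longrightarrow> xs = ys"
  by (rule inj_onD[OF inj_path_index]) (auto simp: sel_def opath_def intro: order.antisym)

lemma sel_exists: "conn \<omega> A x y \<Longrightarrow> \<exists>xs. sel A x y \<omega> xs"
proof -
  assume "conn \<omega> A x y"
  then obtain xs where "opath \<omega> A x y xs" by (auto simp: conn_def)
  from ex_has_least_nat[of "opath \<omega> A x y", OF this, of path_index] show ?thesis
    unfolding sel_def by auto
qed

definition wt :: "'v set \<Rightarrow> 'v \<Rightarrow> 'v \<Rightarrow> 'v list \<Rightarrow> real" where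
  "wt A x y xs = bprob E (\<lambda>\<omega>. sel A x y \<omega> xs)"

lemma wt_nonneg: "0 \<le> wt A x y xs"
  unfolding wt_def by (intro bexp_nonneg) auto

text \<open>At most one path is selected, so the weights of all paths with a given property add up
  to at most the probability that some open path has it.\<close>

lemma wt_subseq_sum:
  assumes "A \<subseteq> V"
  shows "(\<Sum>xs\<in>{xs \<in> paths A x y. subseq vs xs}. wt A x y xs) \<le> chain A x vs y"
proof -
  have "(\<Sum>xs\<in>{xs \<in> paths A x y. subseq vs xs}. wt A x y xs)
     \<le> bprob E (\<lambda>\<omega>. \<exists>xs. opath \<omega> A x y xs \<and> subseq vs xs)"
    unfolding wt_def using finite_paths finite_subset[OF assms finite_V] sel_unique[OF assms]
    by (intro bprob_disjoint_union) (auto simp: sel_def)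
  also note visit_chain
  finally show ?thesis .
qed

lemma wt_sum: "A \<subseteq> V \<Longrightarrow> (\<Sum>xs\<in>paths A x y. wt A x y xs) \<le> tau A x y"
  using wt_subseq_sum[of A x y "[]"] by simp

lemma harris_neg:
  assumes "finite F"
    and f: "\<And>\<omega> \<omega>'. \<omega> \<subseteq> \<omega>' \<Longrightarrow> f \<omega> \<ge> f \<omega>'" and g: "\<And>\<omega> \<omega>'. \<omega> \<subseteq> \<omega>' \<Longrightarrow> g \<omega> \<le> g \<omega>'"
  shows "bexp F (\<lambda>\<omega>. f \<omega> * g \<omega>) \<le> bexp F f * bexp F g"
proof -
  have "bexp F (\<lambda>\<omega>. - f \<omega>) * bexp F g \<le> bexp F (\<lambda>\<omega>. - f \<omega> * g \<omega>)"
    using assms by (intro harris) auto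
  then show ?thesis
    using bexp_cmult[of F "- 1" f] bexp_cmult[of F "- 1" "\<lambda>\<omega>. f \<omega> * g \<omega>"] by simp
qed

text \<open>Given that \<open>xs\<close> is the selected path, the other edges are conditioned on a decreasing event.\<close>

lemma sel_conn:
  "bprob E (\<lambda>\<omega>. sel A x y \<omega> xs \<and> conn (\<omega> - pedges xs) B v w) \<le> wt A x y xs * tau B v w"
proof (cases "pedges xs \<subseteq> E \<and> xs \<in> paths A x y")
  case False
  have "bprob E (\<lambda>\<omega>. sel A x y \<omega> xs \<and> conn (\<omega> - pedges xs) B v w) \<le> bexp E (\<lambda>_. 0)"
    using False by (intro bexp_mono) (auto simp: sel_def opath_paths)
  also have "\<dots> = 0" by (simp add: bexp_const finite_E)
  finally show ?thesis using wt_nonneg[of A x y xs] tau_nonneg[of B v w] by (meson mult_nonneg_nonneg order_trans)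
next
  case True
  define P where "P = pedges xs"
  define D where "D \<omega> = (of_bool (\<forall>ys. opath \<omega> A x y ys \<longrightarrow> path_index xs \<le> path_index ys) :: real)" for \<omega>
  have P: "P \<subseteq> E" and xs: "xs \<in> paths A x y" using True by (auto simp: P_def)
  have wt: "wt A x y xs = p ^ card P * bexp (E - P) (\<lambda>\<omega>. D (\<omega> \<union> P))"
    unfolding bexp_open[OF finite_E P, symmetric] wt_def
    by (intro bexp_cong) (use xs in \<open>auto simp: sel_def D_def opath_paths[of _ _ _ _ xs] P_def\<close>)
  have "bprob E (\<lambda>\<omega>. sel A x y \<omega> xs \<and> conn (\<omega> - P) B v w)
      = bexp E (\<lambda>\<omega>. of_bool (P \<subseteq> \<omega>) * (D \<omega> * of_bool (conn (\<omega> - P) B v w)))"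
    by (intro bexp_cong) (use xs in \<open>auto simp: sel_def D_def opath_paths[of _ _ _ _ xs] P_def\<close>)
  also have "\<dots> = p ^ card P * bexp (E - P) (\<lambda>\<omega>. D (\<omega> \<union> P) * of_bool (conn ((\<omega> \<union> P) - P) B v w))"
    by (rule bexp_open[OF finite_E P])
  also have "bexp (E - P) (\<lambda>\<omega>. D (\<omega> \<union> P) * of_bool (conn ((\<omega> \<union> P) - P) B v w))
      = bexp (E - P) (\<lambda>\<omega>. D (\<omega> \<union> P) * of_bool (conn \<omega> B v w))"
  proof (rule bexp_cong)
    fix \<omega> assume "\<omega> \<subseteq> E - P"
    then have "(\<omega> \<union> P) - P = \<omega>" by auto
    then show "D (\<omega> \<union> P) * of_bool (conn ((\<omega> \<union> P) - P) B v w) = D (\<omega> \<union> P) * of_bool (conn \<omega> B v w)" by simp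
  qed
  also have "\<dots> \<le> bexp (E - P) (\<lambda>\<omega>. D (\<omega> \<union> P)) * bprob (E - P) (\<lambda>\<omega>. conn \<omega> B v w)"
  proof (rule harris_neg)
    fix \<omega> \<omega>' :: "'v set set" assume le: "\<omega> \<subseteq> \<omega>'"
    have "opath (\<omega>' \<union> P) A x y ys" if "opath (\<omega> \<union> P) A x y ys" for ys
      using that le by (auto elim: opath_mono)
    then show "D (\<omega>' \<union> P) \<le> D (\<omega> \<union> P)" by (auto simp: D_def)
    show "of_bool (conn \<omega> B v w) \<le> (of_bool (conn \<omega>' B v w) :: real)"
      using le by (auto elim: conn_mono)
  qed (simp add: finite_E)
  also have "bprob (E - P) (\<lambda>\<omega>. conn \<omega> B v w) = bprob E (\<lambda>\<omega>. conn (\<omega> \<inter> (E - P)) B v w)"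
    using bexp_restrict[OF finite_E, of "E - P" "\<lambda>\<omega>. of_bool (conn \<omega> B v w)"] by simp
  also have "\<dots> \<le> tau B v w"
    unfolding tau_def by (intro bprob_mono) (auto elim: conn_mono)
  finally show ?thesis unfolding wt P_def[symmetric]
    using p_nonneg by (simp add: mult_left_mono bexp_nonneg D_def mult.assoc)
qed

text \<open>Follow a connection from \<open>w\<close> towards \<open>x\<close> and stop at the first
  site \<open>v\<close> of the selected path. The piece travelled so far uses none of the edges of
  that path, so \<open>sel_conn\<close> separates it from the selection.\<close>

lemma branch_bound:
  assumes "A \<subseteq> V" "B \<subseteq> V"
  shows "bprob E (\<lambda>\<omega>. conn \<omega> A x y \<and> conn \<omega> B x w)
    \<le> (\<Sum>xs\<in>paths A x y. \<Sum>v\<in>set xs. wt A x y xs * tau B v w)"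
proof -
  have finA: "finite A" using assms finite_V finite_subset by blast
  let ?R = "\<lambda>(xs, v) \<omega>. sel A x y \<omega> xs \<and> conn (\<omega> - pedges xs) B v w"
  have "bprob E (\<lambda>\<omega>. conn \<omega> A x y \<and> conn \<omega> B x w) \<le> (\<Sum>i\<in>Sigma (paths A x y) set. bprob E (?R i))"
  proof (rule bprob_union)
    show "finite (Sigma (paths A x y) set)" using finite_paths[OF finA] by auto
    fix \<omega> assume c: "conn \<omega> A x y \<and> conn \<omega> B x w"
    then obtain xs where xs: "sel A x y \<omega> xs" using sel_exists by blast
    obtain zs where zs: "opath \<omega> B w x zs" using c conn_sym by (meson conn_def)
    have "x \<in> set xs" using xs hd_in_set[of xs] by (auto simp: sel_def opath_def)
    moreover have "x \<in> set zs" using zs last_in_set[of zs] by (auto simp: opath_def)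
    ultimately have "\<exists>v\<in>set zs. v \<in> set xs" by blast
    from split_list_first_prop[OF this]
    obtain us v ws where s: "zs = us @ v # ws" "v \<in> set xs" "\<forall>u\<in>set us. u \<notin> set xs"
      by (elim exE conjE)
    have "pedges (us @ [v]) \<inter> pedges xs = {}"
    proof (rule equals0I)
      fix e assume e: "e \<in> pedges (us @ [v]) \<inter> pedges xs"
      have "distinct (us @ [v])" using zs s by (simp add: opath_def)
      then obtain a b where "a \<noteq> b" "e = {a, b}" "a \<in> set (us @ [v])" "b \<in> set (us @ [v])"
        using e pedges_edge by blast
      moreover have "e \<subseteq> set xs" using e pedges_subset by blast
      ultimately show False using s(3) by auto
    qed
    then have "conn (\<omega> - pedges xs) B w v"
      using opath_split(1,4)[OF zs[unfolded s]] unfolding conn_def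
      by (intro exI[of _ "us @ [v]"]) (auto elim!: opath_mono)
    then have "?R (xs, v) \<omega>" using xs conn_sym by auto
    moreover have "(xs, v) \<in> Sigma (paths A x y) set" using xs s(2) by (auto simp: sel_def opath_paths)
    ultimately show "\<exists>i\<in>Sigma (paths A x y) set. ?R i \<omega>" by blast
  qed
  also have "\<dots> \<le> (\<Sum>(xs, v)\<in>Sigma (paths A x y) set. wt A x y xs * tau B v w)"
    by (rule sum_mono) (auto intro: sel_conn simp: split_beta)
  also have "\<dots> = (\<Sum>xs\<in>paths A x y. \<Sum>v\<in>set xs. wt A x y xs * tau B v w)"
    using finite_paths[OF finA] by (subst sum.Sigma) auto
  finally show ?thesis .
qed


section \<open>Conditioning on the cluster of a site\<close>

lemma conn_in_cluster:
  assumes C: "{v. conn \<omega> V a v} = A" and "\<omega> \<subseteq> E" "B \<subseteq> V" "conn \<omega> B a v"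
  shows "conn (\<omega> \<inter> {e \<in> E. e \<inter> A \<noteq> {}}) B a v"
proof -
  obtain xs where xs: "opath \<omega> B a v xs" using assms(4) by (auto simp: conn_def)
  have "u \<in> A" if "u \<in> set xs" for u
  proof -
    obtain us ws where "xs = us @ u # ws" using split_list \<open>u \<in> set xs\<close> by metis
    then have "opath \<omega> B a u (us @ [u])" using xs opath_prefix_suffix(1) by metis
    then have "conn \<omega> B a u" unfolding conn_def by (rule exI)
    then have "conn \<omega> V a u" using \<open>B \<subseteq> V\<close> by (rule conn_mono[OF _ order.refl])
    then show ?thesis using C by auto
  qed
  moreover have "e \<noteq> {} \<and> e \<subseteq> set xs" if "e \<in> pedges xs" for e
    using pedges_subset[OF that] pedges_edge[OF _ that] xs by (auto simp: opath_def)
  ultimately have "e \<inter> A \<noteq> {}" if "e \<in> pedges xs" for e using that by blast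
  then have "opath (\<omega> \<inter> {e \<in> E. e \<inter> A \<noteq> {}}) B a v xs"
    using xs \<open>\<omega> \<subseteq> E\<close> by (auto simp: opath_def)
  then show ?thesis by (auto simp: conn_def)
qed

text \<open>Whether the cluster of \<open>a\<close> equals \<open>A\<close> is decided by the edges
  that meet \<open>A\<close>: those inside build it, those leaving it are closed. The edges within
  \<open>V - A\<close> are therefore independent of this event.\<close>

lemma cluster_local:
  fixes A :: "'v set"
  assumes "\<omega> \<subseteq> E" "S \<subseteq> V" "a \<in> V"
  defines "T \<equiv> {e \<in> E. e \<inter> A \<noteq> {}}"
  shows "{v. conn \<omega> V a v} = A \<and> conn \<omega> S a x \<longleftrightarrow>
         {v. conn (\<omega> \<inter> T) V a v} = A \<and> conn (\<omega> \<inter> T) S a x"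
proof
  have mono: "conn (\<omega> \<inter> T) B a v \<Longrightarrow> conn \<omega> B a v" for B v by (rule conn_mono) auto
  {
    assume *: "{v. conn \<omega> V a v} = A \<and> conn \<omega> S a x"
    then have "conn \<omega> B a v \<Longrightarrow> B \<subseteq> V \<Longrightarrow> conn (\<omega> \<inter> T) B a v" for B v
      unfolding T_def using conn_in_cluster[of \<omega> a A B v] assms(1) by simp
    note loc = this
    have "conn (\<omega> \<inter> T) V a v \<longleftrightarrow> conn \<omega> V a v" for v
      using loc[of V v] mono[of V v] by blast
    moreover have "conn (\<omega> \<inter> T) S a x" using loc[of S x] * assms(2) by simp
    ultimately show "{v. conn (\<omega> \<inter> T) V a v} = A \<and> conn (\<omega> \<inter> T) S a x" using * by simp
  }
  {
    assume *: "{v. conn (\<omega> \<inter> T) V a v} = A \<and> conn (\<omega> \<inter> T) S a x"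
    have "v \<in> A" if "conn \<omega> V a v" for v
    proof (rule conn_closed[OF that])
      have "a \<in> {v. conn (\<omega> \<inter> T) V a v}" using assms(3) by simp
      then show "a \<in> A" using * by simp
      fix u v assume uv: "u \<in> A" "{u, v} \<in> \<omega>" "v \<in> V"
      then have "{v, u} \<in> \<omega> \<inter> T" using assms(1) by (auto simp: T_def insert_commute)
      moreover have "u \<in> {v. conn (\<omega> \<inter> T) V a v}" using * uv(1) by simp
      then have "conn (\<omega> \<inter> T) V u a" using conn_sym[of "\<omega> \<inter> T" V a u] by simp
      ultimately have "conn (\<omega> \<inter> T) V v a" using uv(3) conn_step by metis
      then have "v \<in> {v. conn (\<omega> \<inter> T) V a v}" using conn_sym[of "\<omega> \<inter> T" V v a] by simp
      then show "v \<in> A" using * by simp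
    qed
    note sub = this
    have "v \<in> A \<Longrightarrow> conn \<omega> V a v" for v using * mono[of V v] by auto
    with sub have "{v. conn \<omega> V a v} = A" by auto
    then show "{v. conn \<omega> V a v} = A \<and> conn \<omega> S a x" using * mono[of S x] by simp
  }
qed

text \<open>Given the cluster \<open>A\<close> of \<open>a\<close>, the configuration inside \<open>V - A\<close> is fresh.\<close>

lemma avoid_bound:
  assumes S: "S \<subseteq> V" and a: "a \<in> V"
  shows "tau S a x * tau V y z
      - (\<Sum>w\<in>V. bprob E (\<lambda>\<omega>. conn \<omega> S a x \<and> conn \<omega> V a w) * (tau V y w * tau V w z))
    \<le> bprob E (\<lambda>\<omega>. conn \<omega> S a x \<and> conn \<omega> V y z \<and> \<not> conn \<omega> V a y)"
proof -
  define C where "C \<omega> = {v. conn \<omega> V a v}" for \<omega>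
  define q where "q A = bprob E (\<lambda>\<omega>. C \<omega> = A \<and> conn \<omega> S a x)" for A
  define t where "t w = tau V y w * tau V w z" for w
  have CV: "C \<omega> \<in> Pow V" for \<omega> unfolding C_def by (auto dest: conn_in)
  have finP: "finite (Pow V)" using finite_V by simp
  have q0: "0 \<le> q A" for A unfolding q_def by (intro bexp_nonneg) auto
  have t0: "0 \<le> t w" for w unfolding t_def by (simp add: tau_nonneg)
  have factor: "bprob E (\<lambda>\<omega>. C \<omega> = A \<and> conn \<omega> S a x \<and> conn \<omega> (V - A) y z) = q A * tau (V - A) y z" for A
  proof -
    define T where "T = {e \<in> E. e \<inter> A \<noteq> {}}"
    define T' where "T' = {e \<in> E. e \<subseteq> V - A}"
    have Q: "C \<omega> = A \<and> conn \<omega> S a x \<longleftrightarrow> C (\<omega> \<inter> T) = A \<and> conn (\<omega> \<inter> T) S a x" if "\<omega> \<subseteq> E" for \<omega>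
      unfolding C_def T_def using that S a by (rule cluster_local)
    have R: "conn \<omega> (V - A) y z \<longleftrightarrow> conn (\<omega> \<inter> T') (V - A) y z" if "\<omega> \<subseteq> E" for \<omega>
    proof -
      have "\<omega> \<inter> T' = \<omega> \<inter> {e. e \<subseteq> V - A}" using that by (auto simp: T'_def)
      then show ?thesis using conn_restrict[of \<omega> "V - A"] by simp
    qed
    have TT: "T \<subseteq> E" "T' \<subseteq> E" "T \<inter> T' = {}" by (auto simp: T_def T'_def)
    have q: "q A = bprob T (\<lambda>\<omega>. C \<omega> = A \<and> conn \<omega> S a x)"
      unfolding q_def by (subst bexp_restrict[OF finite_E TT(1), symmetric]) (intro bexp_cong, simp only: Q)
    have t: "tau (V - A) y z = bprob T' (\<lambda>\<omega>. conn \<omega> (V - A) y z)"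
      unfolding tau_def by (subst bexp_restrict[OF finite_E TT(2), symmetric]) (intro bexp_cong, simp only: R)
    have "bprob E (\<lambda>\<omega>. C \<omega> = A \<and> conn \<omega> S a x \<and> conn \<omega> (V - A) y z) =
      bexp E (\<lambda>\<omega>. of_bool (C (\<omega> \<inter> T) = A \<and> conn (\<omega> \<inter> T) S a x) * of_bool (conn (\<omega> \<inter> T') (V - A) y z))"
      by (intro bexp_cong) (simp only: Q[symmetric] R[symmetric] of_bool_conj[symmetric] conj_assoc)
    then show ?thesis unfolding q t
      using bexp_indep[OF finite_E TT, of "\<lambda>\<omega>. of_bool (C \<omega> = A \<and> conn \<omega> S a x)"
          "\<lambda>\<omega>. of_bool (conn \<omega> (V - A) y z)"] by simp
  qed
  \<comment> \<open>The cluster takes one value \<open>A\<close> only, which gives disjointness, and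
    a connection from \<open>y\<close> inside \<open>V - A\<close> forces \<open>y\<close> out of
    the cluster.\<close>
  have "(\<Sum>A\<in>Pow V. q A * tau (V - A) y z)
      \<le> bprob E (\<lambda>\<omega>. conn \<omega> S a x \<and> conn \<omega> V y z \<and> \<not> conn \<omega> V a y)"
    unfolding factor[symmetric]
  proof (rule bprob_disjoint_union[OF finP])
    fix A \<omega> assume *: "C \<omega> = A \<and> conn \<omega> S a x \<and> conn \<omega> (V - A) y z"
    then have "y \<notin> A" by (auto dest: conn_in)
    then have "\<not> conn \<omega> V a y" using * by (auto simp: C_def)
    moreover have "conn \<omega> V y z" using * by (auto elim: conn_mono)
    ultimately show "conn \<omega> S a x \<and> conn \<omega> V y z \<and> \<not> conn \<omega> V a y" using * by blast
  qed simp
  \<comment> \<open>Forbidding \<open>A\<close> to the connection from \<open>y\<close> to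
    \<open>z\<close> costs at most the sum over \<open>w\<close> in \<open>A\<close> of the BK price
    of passing through \<open>w\<close>.\<close>
  moreover have "(\<Sum>A\<in>Pow V. q A * tau V y z) - (\<Sum>A\<in>Pow V. q A * (\<Sum>w\<in>A. t w))
      \<le> (\<Sum>A\<in>Pow V. q A * tau (V - A) y z)"
    unfolding sum_subtractf[symmetric] right_diff_distrib[symmetric]
  proof (intro sum_mono mult_left_mono q0)
    fix A assume "A \<in> Pow V"
    then have "A \<inter> V = A" by auto
    then show "tau V y z - (\<Sum>w\<in>A. t w) \<le> tau (V - A) y z"
      using tau_remove[OF finite_V, of y z A] unfolding t_def by simp
  qed
  moreover have "tau S a x \<le> (\<Sum>A\<in>Pow V. q A)"
    unfolding tau_def q_def using CV by (intro bprob_union finP) blast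
  then have "tau S a x * tau V y z \<le> (\<Sum>A\<in>Pow V. q A * tau V y z)"
    unfolding sum_distrib_right[symmetric] by (intro mult_right_mono tau_nonneg)
  moreover have "(\<Sum>A\<in>Pow V. q A * (\<Sum>w\<in>A. t w))
      \<le> (\<Sum>w\<in>V. bprob E (\<lambda>\<omega>. conn \<omega> S a x \<and> conn \<omega> V a w) * t w)"
  proof -
    have "(\<Sum>A\<in>Pow V. q A * (\<Sum>w\<in>A. t w)) = (\<Sum>A\<in>Pow V. \<Sum>w\<in>V. if w \<in> A then q A * t w else 0)"
    proof (rule sum.cong[OF refl])
      fix A assume "A \<in> Pow V"
      then have A: "V \<inter> A = A" by auto
      show "q A * (\<Sum>w\<in>A. t w) = (\<Sum>w\<in>V. if w \<in> A then q A * t w else 0)"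
        using sum.inter_restrict[OF finite_V, of "\<lambda>w. q A * t w" A] unfolding A
        by (simp add: sum_distrib_left)
    qed
    also have "\<dots> = (\<Sum>w\<in>V. \<Sum>A\<in>Pow V. if w \<in> A then q A * t w else 0)" by (rule sum.swap)
    also have "\<dots> = (\<Sum>w\<in>V. (\<Sum>A\<in>{A \<in> Pow V. w \<in> A}. q A) * t w)"
      using finP by (intro sum.cong refl) (auto simp: sum.inter_filter sum_distrib_right simp del: Pow_iff intro!: sum.cong)
    also have "\<dots> \<le> (\<Sum>w\<in>V. bprob E (\<lambda>\<omega>. conn \<omega> S a x \<and> conn \<omega> V a w) * t w)"
    proof (intro sum_mono mult_right_mono t0)
      fix w
      show "(\<Sum>A\<in>{A \<in> Pow V. w \<in> A}. q A) \<le> bprob E (\<lambda>\<omega>. conn \<omega> S a x \<and> conn \<omega> V a w)"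
        unfolding q_def using finP by (intro bprob_disjoint_union) (auto simp: C_def)
    qed
    finally show ?thesis .
  qed
  ultimately show ?thesis unfolding t_def by linarith
qed

section \<open>Opening a segment that leaves the set\<close>

lemma card_pedges: "card (pedges xs) \<le> length xs - 1"
proof (induction xs rule: pedges.induct)
  case (1 x y xs)
  then show ?case using card_insert_le_m1[of "length (x # y # xs) - 1" "pedges (y # xs)" "{x, y}"]
    by (simp add: card_insert_if finite_pedges)
qed auto

text \<open>Follow a path from \<open>z\<close> until it first meets one of the two lines, say the one at \<open>x'\<close>:
  then \<open>z\<close> reaches \<open>a\<close> through \<open>x'\<close> without using the line at \<open>x\<close>.\<close>

lemma lines_exclusive_aux:
  assumes S: "S \<subseteq> V"
    and ls: "distinct ls" "set ls \<subseteq> V" and ls': "distinct ls'" "set ls' \<subseteq> V" "ls' \<noteq> []" "hd ls' = x'"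
    and off: "\<And>e. e \<in> pedges ls \<Longrightarrow> \<not> e \<subseteq> S" and disj: "pedges ls \<inter> pedges ls' = {}"
    and op: "pedges ls' \<subseteq> \<omega>" "conn \<omega> S a x'"
    and us: "opath \<omega> V z t (us @ [t])" "set us \<inter> set ls = {}" and t: "t \<in> set ls'"
  shows "conn (\<omega> - pedges ls) V a z"
proof -
  have "pedges (us @ [t]) \<inter> pedges ls = {}"
  proof (rule equals0I)
    fix e assume e: "e \<in> pedges (us @ [t]) \<inter> pedges ls"
    have "distinct (us @ [t])" using us by (simp add: opath_def)
    then obtain u v where "u \<noteq> v" "e = {u, v}" "u \<in> set (us @ [t])" "v \<in> set (us @ [t])"
      using e pedges_edge by blast
    moreover have "e \<subseteq> set ls" using e pedges_subset by blast
    ultimately show False using us(2) by auto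
  qed
  then have "opath (\<omega> - pedges ls) V z t (us @ [t])" using us(1) by (auto simp: opath_def)
  then have zt: "conn (\<omega> - pedges ls) V z t" by (auto simp: conn_def)
  have "pedges ls' \<subseteq> \<omega> - pedges ls" using op disj by auto
  moreover obtain bs ds where "ls' = bs @ t # ds" using t by (meson split_list)
  moreover have "opath (pedges ls') V x' (last ls') ls'" using ls' by (auto simp: opath_def)
  ultimately have "opath (\<omega> - pedges ls) V x' t (bs @ [t])"
    using opath_prefix_suffix(1) opath_mono by (metis order.refl)
  then have "conn (\<omega> - pedges ls) V x' t" by (auto simp: conn_def)
  moreover have "conn (\<omega> - pedges ls) V a x'"
  proof -
    have "conn (\<omega> \<inter> {e. e \<subseteq> S}) S a x'" using op(2) conn_restrict by metis
    moreover have "\<omega> \<inter> {e. e \<subseteq> S} \<subseteq> \<omega> - pedges ls" using off by auto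
    ultimately show ?thesis using S by (rule conn_mono)
  qed
  ultimately show ?thesis using zt conn_trans conn_sym by metis
qed

text \<open>The edges of \<open>ls\<close>, taken together, are pivotal for the connection from
  \<open>a\<close> to \<open>z\<close>. Pivotality is what makes these events exclusive for
  edge-disjoint segments.\<close>

definition via :: "'v set \<Rightarrow> 'v \<Rightarrow> 'v list \<Rightarrow> 'v \<Rightarrow> 'v set set \<Rightarrow> bool" where
  "via S a ls z \<omega> \<longleftrightarrow> pedges ls \<subseteq> \<omega> \<and> conn \<omega> S a (hd ls) \<and> conn \<omega> V a z \<and> \<not> conn (\<omega> - pedges ls) V a z"

text \<open>Since no edge of the segment lies within \<open>S\<close>, closing the segment leaves
  every connection inside \<open>S\<close> intact.\<close>

definition good_line :: "'v set \<Rightarrow> 'v list \<Rightarrow> bool" where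
  "good_line S ls \<longleftrightarrow> ls \<noteq> [] \<and> distinct ls \<and> set ls \<subseteq> V \<and> pedges ls \<subseteq> E \<and> (\<forall>e\<in>pedges ls. \<not> e \<subseteq> S)"

text \<open>A path from \<open>z\<close> to \<open>a\<close> must touch one of the segments, as
  otherwise it would survive closing \<open>ls\<close>. The segment touched first, followed back to
  its start and continued through \<open>S\<close>, leads to \<open>a\<close> without the other one,
  which is then not pivotal.\<close>

lemma lines_exclusive:
  assumes S: "S \<subseteq> V" and ls: "good_line S ls" "good_line S ls'" "pedges ls \<inter> pedges ls' = {}"
    and v: "via S a ls z \<omega>" "via S a ls' z \<omega>"
  shows False
proof -
  obtain zs where zs: "opath \<omega> V z a zs" using v conn_sym unfolding via_def conn_def by metis
  have "\<exists>t\<in>set zs. t \<in> set ls \<union> set ls'"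
  proof (rule ccontr)
    assume *: "\<not> ?thesis"
    have "pedges zs \<inter> pedges ls = {}"
    proof (rule equals0I)
      fix e assume e: "e \<in> pedges zs \<inter> pedges ls"
      then obtain u v where "e = {u, v}" "u \<in> set zs"
        using pedges_edge[of zs e] zs by (auto simp: opath_def)
      then show False using e pedges_subset[of e ls] * by auto
    qed
    then have "opath (\<omega> - pedges ls) V z a zs" using zs by (auto simp: opath_def)
    then show False using v(1) conn_sym unfolding via_def conn_def by metis
  qed
  from split_list_first_prop[OF this]
  obtain us t ws where s: "zs = us @ t # ws" "t \<in> set ls \<union> set ls'" "\<forall>u\<in>set us. u \<notin> set ls \<union> set ls'"
    by (elim exE conjE)
  have us: "opath \<omega> V z t (us @ [t])" "set us \<inter> set ls = {}" "set us \<inter> set ls' = {}"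
    using opath_prefix_suffix(1) zs s by auto
  from s(2) consider "t \<in> set ls'" | "t \<in> set ls" by auto
  then show False
  proof cases
    case 1
    have "conn (\<omega> - pedges ls) V a z"
      by (rule lines_exclusive_aux[where x' = "hd ls'" and ls' = ls' and S = S and us = us and t = t])
        (use S ls v us 1 in \<open>auto simp: via_def good_line_def\<close>)
    then show False using v(1) by (simp add: via_def)
  next
    case 2
    have "conn (\<omega> - pedges ls') V a z"
      by (rule lines_exclusive_aux[where x' = "hd ls" and ls' = ls and S = S and us = us and t = t])
        (use S ls v us 2 in \<open>auto simp: via_def good_line_def\<close>)
    then show False using v(2) by (simp add: via_def)
  qed
qed

text \<open>When \<open>a\<close> and \<open>last ls\<close> lie in different clusters, opening the
  segment joins them, while closing it leaves \<open>a\<close> separated from \<open>z\<close>. The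
  resulting event \<open>h\<close> can be read off the edges outside the segment, so opening the
  segment contributes an independent factor.\<close>

lemma via_prob:
  assumes S: "S \<subseteq> V" and ls: "good_line S ls" "length ls \<le> Suc m"
  shows "p ^ m * bprob E (\<lambda>\<omega>. conn \<omega> S a (hd ls) \<and> conn \<omega> V (last ls) z \<and> \<not> conn \<omega> V a (last ls))
    \<le> bprob E (via S a ls z)"
proof -
  define P where "P = pedges ls"
  define G where "G \<omega> \<longleftrightarrow> conn \<omega> S a (hd ls) \<and> conn \<omega> V (last ls) z \<and> \<not> conn \<omega> V a (last ls)" for \<omega>
  define h where "h \<omega> \<longleftrightarrow> conn (\<omega> \<union> P) S a (hd ls) \<and> conn (\<omega> \<union> P) V a z \<and> \<not> conn \<omega> V a z" for \<omega>
  have P: "P \<subseteq> E" using ls by (simp add: P_def good_line_def)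
  have "bprob E G \<le> bprob E (\<lambda>\<omega>. h (\<omega> \<inter> (E - P)))"
  proof (rule bprob_mono)
    fix \<omega> assume \<omega>: "\<omega> \<subseteq> E" "G \<omega>"
    have eq: "\<omega> \<inter> (E - P) \<union> P = \<omega> \<union> P" using \<omega> P by auto
    have 1: "conn (\<omega> \<union> P) S a (hd ls)" using \<omega> by (auto simp: G_def elim: conn_mono)
    have "opath (\<omega> \<union> P) V (hd ls) (last ls) ls" using ls by (auto simp: opath_def P_def good_line_def)
    then have "conn (\<omega> \<union> P) V (hd ls) (last ls)" by (auto simp: conn_def)
    moreover have "conn (\<omega> \<union> P) V a (hd ls)" using 1 S by (auto elim: conn_mono)
    moreover have "conn (\<omega> \<union> P) V (last ls) z" using \<omega> by (auto simp: G_def elim: conn_mono)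
    ultimately have 2: "conn (\<omega> \<union> P) V a z" using conn_trans by metis
    have 3: "\<not> conn (\<omega> \<inter> (E - P)) V a z"
    proof
      assume "conn (\<omega> \<inter> (E - P)) V a z"
      then have "conn \<omega> V a z" by (rule conn_mono) auto
      moreover have "conn \<omega> V z (last ls)" using \<omega> conn_sym by (auto simp: G_def)
      ultimately show False using \<omega> conn_trans unfolding G_def by metis
    qed
    from 1 2 3 show "h (\<omega> \<inter> (E - P))" unfolding h_def eq by simp
  qed
  also have "\<dots> = bprob (E - P) h"
    using bexp_restrict[OF finite_E, of "E - P" "\<lambda>\<omega>. of_bool (h \<omega>)"] by simp
  finally have "p ^ m * bprob E G \<le> p ^ card P * bprob (E - P) h"
    using ls(2) card_pedges[of ls] p_nonneg p_le_1 unfolding P_def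
    by (intro mult_mono power_decreasing bexp_nonneg) auto
  also have "\<dots> = p ^ card P * bexp (E - P) (\<lambda>\<omega>. of_bool (h ((\<omega> \<union> P) - P)))"
  proof -
    have "bprob (E - P) h = bexp (E - P) (\<lambda>\<omega>. of_bool (h ((\<omega> \<union> P) - P)))"
    proof (rule bexp_cong)
      fix \<omega> assume "\<omega> \<subseteq> E - P"
      then have "(\<omega> \<union> P) - P = \<omega>" by auto
      then show "of_bool (h \<omega>) = (of_bool (h ((\<omega> \<union> P) - P)) :: real)" by simp
    qed
    then show ?thesis by simp
  qed
  also have "\<dots> = bexp E (\<lambda>\<omega>. of_bool (P \<subseteq> \<omega>) * of_bool (h (\<omega> - P)))"
    by (rule bexp_open[OF finite_E P, symmetric])
  also have "\<dots> = bprob E (via S a ls z)"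
  proof (rule bexp_cong)
    fix \<omega>
    have "\<omega> - P \<union> P = \<omega>" if "P \<subseteq> \<omega>" using that by auto
    then show "of_bool (P \<subseteq> \<omega>) * of_bool (h (\<omega> - P)) = (of_bool (via S a ls z \<omega>) :: real)"
      by (auto simp: via_def h_def P_def)
  qed
  finally show ?thesis unfolding G_def .
qed

text \<open>The \<open>via\<close> events exclude one another and each contains the connection from
  \<open>a\<close> to \<open>z\<close>, so their probabilities add up to at most
  \<open>tau V a z\<close>. Each is bounded below by \<open>via_prob\<close> and
  \<open>avoid_bound\<close>, with \<open>branch_bound\<close> applied to the double connection in
  the error.\<close>

lemma extension_sum:
  assumes S: "S \<subseteq> V" and a: "a \<in> V" and X: "finite X"
    and line: "\<And>x. x \<in> X \<Longrightarrow> good_line S (line x) \<and> hd (line x) = x \<and> length (line x) \<le> Suc m"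
    and disj: "\<And>x x'. x \<in> X \<Longrightarrow> x' \<in> X \<Longrightarrow> x \<noteq> x' \<Longrightarrow> pedges (line x) \<inter> pedges (line x') = {}"
  shows "(\<Sum>x\<in>X. p ^ m * (tau S a x * tau V (last (line x)) z - (\<Sum>w\<in>V.
      (\<Sum>xs\<in>paths S a x. \<Sum>v\<in>set xs. wt S a x xs * tau V v w) * (tau V (last (line x)) w * tau V w z))))
    \<le> tau V a z"
proof -
  have "(\<Sum>x\<in>X. p ^ m * (tau S a x * tau V (last (line x)) z - (\<Sum>w\<in>V.
      (\<Sum>xs\<in>paths S a x. \<Sum>v\<in>set xs. wt S a x xs * tau V v w) * (tau V (last (line x)) w * tau V w z))))
    \<le> (\<Sum>x\<in>X. bprob E (via S a (line x) z))"
  proof (rule sum_mono)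
    fix x assume x: "x \<in> X"
    let ?y = "last (line x)"
    let ?lhs = "p ^ m * (tau S a x * tau V ?y z - (\<Sum>w\<in>V.
        (\<Sum>xs\<in>paths S a x. \<Sum>v\<in>set xs. wt S a x xs * tau V v w) * (tau V ?y w * tau V w z)))"
    have "tau S a x * tau V ?y z - (\<Sum>w\<in>V.
        (\<Sum>xs\<in>paths S a x. \<Sum>v\<in>set xs. wt S a x xs * tau V v w) * (tau V ?y w * tau V w z))
      \<le> tau S a x * tau V ?y z
      - (\<Sum>w\<in>V. bprob E (\<lambda>\<omega>. conn \<omega> S a x \<and> conn \<omega> V a w) * (tau V ?y w * tau V w z))"
      by (intro diff_left_mono sum_mono mult_right_mono branch_bound S order.refl mult_nonneg_nonneg tau_nonneg)
    also note avoid_bound[OF S a]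
    finally have "?lhs
      \<le> p ^ m * bprob E (\<lambda>\<omega>. conn \<omega> S a x \<and> conn \<omega> V ?y z \<and> \<not> conn \<omega> V a ?y)"
      using p_nonneg by (intro mult_left_mono) auto
    also have "\<dots> \<le> bprob E (via S a (line x) z)"
      using via_prob[OF S, of "line x" m a z] line[OF x] by simp
    finally show "?lhs
      \<le> bprob E (via S a (line x) z)" .
  qed
  also have "\<dots> \<le> tau V a z"
    unfolding tau_def
  proof (rule bprob_disjoint_union[OF X])
    fix i j \<omega> assume "i \<in> X" "j \<in> X" "via S a (line i) z \<omega>" "via S a (line j) z \<omega>"
    then show "i = j" using lines_exclusive[OF S, of "line i" "line j" a z \<omega>] line disj by metis
  qed (simp add: via_def)
  finally show ?thesis .
qed

section \<open>Moments of the number of visits of the selected path\<close>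

text \<open>Listing a set of visited sites in the order of the path gives a subsequence, and
  different sets give different ones. This turns a binomial moment into sums that
  \<open>chain\<close> controls.\<close>

lemma choose_subseq:
  assumes "distinct xs"
  shows "card (set xs \<inter> B) choose q \<le> card {vs. length vs = q \<and> set vs \<subseteq> B \<inter> set xs \<and> subseq vs xs}"
proof -
  let ?L = "{vs. length vs = q \<and> set vs \<subseteq> B \<inter> set xs \<and> subseq vs xs}"
  let ?Y = "{Y. Y \<subseteq> set xs \<inter> B \<and> card Y = q}"
  let ?f = "\<lambda>Y. filter (\<lambda>v. v \<in> Y) xs"
  have "card (set xs \<inter> B) choose q = card ?Y"
    by (rule n_subsets[symmetric]) simp
  also have "\<dots> = card (?f ` ?Y)"
  proof (rule card_image[symmetric], rule inj_onI)
    fix Y Z assume *: "Y \<in> ?Y" "Z \<in> ?Y"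
      and "?f Y = ?f Z"
    then have "set (?f Y) = set (?f Z)" by simp
    then show "Y = Z" using * by auto
  qed
  also have "\<dots> \<le> card ?L"
  proof (rule card_mono)
    have "finite {vs. set vs \<subseteq> set xs \<and> length vs = q}" by (rule finite_lists_length_eq) simp
    then show "finite ?L"
      by (rule rev_finite_subset) auto
    show "?f ` ?Y
        \<subseteq> ?L"
    proof (rule image_subsetI)
      fix Y assume Y: "Y \<in> ?Y"
      have "set (?f Y) = Y" using Y by auto
      moreover have "distinct (?f Y)" using assms by simp
      ultimately have "length (?f Y) = q" using Y distinct_card[of "?f Y"] by simp
      then show "?f Y \<in> ?L"
        using Y by auto
    qed
  qed
  finally show ?thesis .
qed

text \<open>Truncation at \<open>q * l\<close>: beyond it \<open>N / (q * l)\<close> exceeds 1,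
  hence is at most its \<open>q\<close>-th power, and \<open>(N / q) ^ q\<close> is at most
  \<open>N choose q\<close>. The excess is thus paid for by a moment with \<open>l ^ q\<close> in
  the denominator.\<close>

lemma le_choose_bound:
  fixes l :: real
  assumes "1 \<le> l" "1 \<le> q"
  shows "real N \<le> q * l + q * l / l ^ q * real (N choose q)"
proof (cases "real N \<le> q * l")
  case True
  moreover have "0 \<le> q * l / l ^ q * real (N choose q)" using assms by simp
  ultimately show ?thesis by linarith
next
  case False
  have ql: "0 < real q * l" using assms by simp
  have "real q \<le> q * l" using assms by simp
  then have "q \<le> N" using False by linarith
  have 1: "1 \<le> real N / (q * l)" using False ql by simp
  have "q * l * (real N / (q * l)) = real N" by (rule nonzero_mult_div_cancel_left[OF less_imp_neq[OF ql, symmetric], unfolded times_divide_eq_right[symmetric]])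
  then have "real N = q * l * (real N / (q * l))" by (rule sym)
  also have "\<dots> \<le> q * l * (real N / (q * l)) ^ q"
    using ql self_le_power[OF 1] assms by (intro mult_left_mono) auto
  also have "\<dots> = q * l / l ^ q * (real N / q) ^ q"
    by (simp add: power_divide power_mult_distrib)
  also have "\<dots> \<le> q * l / l ^ q * real (N choose q)"
    using binomial_ge_n_over_k_pow_k[OF \<open>q \<le> N\<close>, where 'a = real] assms by (intro mult_left_mono) auto
  finally show ?thesis using ql by linarith
qed

lemma chain_sum:
  assumes "finite B" and D: "\<And>v. (\<Sum>u\<in>B. tau S v u) \<le> D"
  shows "(\<Sum>vs | set vs \<subseteq> B \<and> length vs = n. chain S v vs x) \<le> D ^ n"
proof (induction n arbitrary: v)
  case 0
  have "{vs. set vs \<subseteq> B \<and> vs = []} = {[]}" by auto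
  then show ?case by (simp add: tau_le_1)
next
  case (Suc n)
  have D0: "0 \<le> D" using D[of v] sum_nonneg[of B "tau S v"] tau_nonneg by (meson order_trans)
  have "(\<Sum>vs | set vs \<subseteq> B \<and> length vs = Suc n. chain S v vs x)
     = (\<Sum>(u, us)\<in>B \<times> {vs. set vs \<subseteq> B \<and> length vs = n}. chain S v (u # us) x)"
    by (rule sum.reindex_bij_witness[of _ "\<lambda>(u, us). u # us" "\<lambda>vs. (hd vs, tl vs)"])
      (auto simp: length_Suc_conv)
  also have "\<dots> = (\<Sum>u\<in>B. tau S v u * (\<Sum>vs | set vs \<subseteq> B \<and> length vs = n. chain S u vs x))"
    by (simp add: sum.cartesian_product[symmetric] sum_distrib_left)
  also have "\<dots> \<le> (\<Sum>u\<in>B. tau S v u * D ^ n)"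
    by (intro sum_mono mult_left_mono Suc.IH tau_nonneg)
  also have "\<dots> \<le> D * D ^ n"
    unfolding sum_distrib_right[symmetric] using D D0 by (intro mult_right_mono) auto
  finally show ?case by simp
qed

text \<open>The first step is not bounded by \<open>D\<close>: the mass that \<open>a\<close> puts
  on \<open>B\<close> has to be kept, since summed over many cubes \<open>B\<close> it will be
  compared with the boundary sum.\<close>

lemma chain_sum_start:
  assumes "finite B" and D: "\<And>v. (\<Sum>u\<in>B. tau S v u) \<le> D"
  shows "(\<Sum>vs | set vs \<subseteq> B \<and> length vs = Suc n. chain S a vs x) \<le> D ^ n * (\<Sum>u\<in>B. tau S a u)"
proof -
  have "(\<Sum>vs | set vs \<subseteq> B \<and> length vs = Suc n. chain S a vs x)
     = (\<Sum>(u, us)\<in>B \<times> {vs. set vs \<subseteq> B \<and> length vs = n}. chain S a (u # us) x)"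
    by (rule sum.reindex_bij_witness[of _ "\<lambda>(u, us). u # us" "\<lambda>vs. (hd vs, tl vs)"])
      (auto simp: length_Suc_conv)
  also have "\<dots> = (\<Sum>u\<in>B. tau S a u * (\<Sum>vs | set vs \<subseteq> B \<and> length vs = n. chain S u vs x))"
    by (simp add: sum.cartesian_product[symmetric] sum_distrib_left)
  also have "\<dots> \<le> (\<Sum>u\<in>B. tau S a u * D ^ n)"
    by (intro sum_mono mult_left_mono chain_sum assms tau_nonneg)
  also have "\<dots> = D ^ n * (\<Sum>u\<in>B. tau S a u)"
    unfolding sum_distrib_left by (intro sum.cong) (simp_all add: mult.commute)
  finally show ?thesis .
qed

lemma visits_bound:
  fixes l :: real
  assumes S: "S \<subseteq> V" and l: "1 \<le> l" and B: "finite B"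
    and D: "\<And>v. (\<Sum>u\<in>B. tau S v u) \<le> D"
  shows "(\<Sum>xs\<in>paths S a x. wt S a x xs * real (card (set xs \<inter> B)))
    \<le> Suc n * l * tau S a x + Suc n * l / l ^ Suc n * (D ^ n * (\<Sum>u\<in>B. tau S a u))"
proof -
  let ?q = "Suc n"
  let ?L = "{vs. set vs \<subseteq> B \<and> length vs = ?q}"
  let ?c = "\<lambda>xs. real (card {vs \<in> ?L. subseq vs xs})"
  let ?s = "\<Sum>vs\<in>?L. \<Sum>xs\<in>{xs \<in> paths S a x. subseq vs xs}. wt S a x xs"
  have fin: "finite (paths S a x)" using finite_paths S finite_V finite_subset by blast
  have finL: "finite ?L" by (rule finite_lists_length_eq[OF B])
  have "(\<Sum>xs\<in>paths S a x. wt S a x xs * real (card (set xs \<inter> B)))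
     \<le> (\<Sum>xs\<in>paths S a x. wt S a x xs * (?q * l + ?q * l / l ^ ?q * ?c xs))"
  proof (intro sum_mono mult_left_mono wt_nonneg)
    fix xs assume xs: "xs \<in> paths S a x"
    have "real (card (set xs \<inter> B)) \<le> ?q * l + ?q * l / l ^ ?q * real (card (set xs \<inter> B) choose ?q)"
      by (rule le_choose_bound[OF l]) simp
    moreover have "card (set xs \<inter> B) choose ?q \<le> card {vs \<in> ?L. subseq vs xs}"
    proof -
      have "card (set xs \<inter> B) choose ?q \<le> card {vs. length vs = ?q \<and> set vs \<subseteq> B \<inter> set xs \<and> subseq vs xs}"
        using xs by (intro choose_subseq) (simp add: paths_def)
      also have "\<dots> \<le> card {vs \<in> ?L. subseq vs xs}"
        by (intro card_mono finite_subset[OF _ finL]) auto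
      finally show ?thesis .
    qed
    then have "?q * l / l ^ ?q * real (card (set xs \<inter> B) choose ?q)
        \<le> ?q * l / l ^ ?q * ?c xs"
      using l by (intro mult_left_mono) auto
    ultimately show "real (card (set xs \<inter> B)) \<le> ?q * l + ?q * l / l ^ ?q * ?c xs"
      by linarith
  qed
  also have "\<dots> = ?q * l * (\<Sum>xs\<in>paths S a x. wt S a x xs)
     + ?q * l / l ^ ?q * (\<Sum>xs\<in>paths S a x. wt S a x xs * ?c xs)"
    by (simp add: distrib_left sum.distrib sum_distrib_left mult_ac)
  also have "(\<Sum>xs\<in>paths S a x. wt S a x xs * ?c xs)
      = ?s"
  proof -
    have "(\<Sum>xs\<in>paths S a x. wt S a x xs * ?c xs)
        = (\<Sum>xs\<in>paths S a x. \<Sum>vs\<in>?L. if subseq vs xs then wt S a x xs else 0)"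
      using finL by (intro sum.cong refl) (simp add: sum.inter_filter[symmetric])
    also have "\<dots> = (\<Sum>vs\<in>?L. \<Sum>xs\<in>paths S a x. if subseq vs xs then wt S a x xs else 0)"
      by (rule sum.swap)
    finally show ?thesis using fin by (simp add: sum.inter_filter)
  qed
  also have "?q * l * (\<Sum>xs\<in>paths S a x. wt S a x xs)
     + ?q * l / l ^ ?q * ?s
    \<le> ?q * l * tau S a x + ?q * l / l ^ ?q * (D ^ n * (\<Sum>u\<in>B. tau S a u))"
  proof (intro add_mono mult_left_mono wt_sum[OF S])
    have "?s \<le> (\<Sum>vs\<in>?L. chain S a vs x)"
      by (intro sum_mono wt_subseq_sum S)
    also have "\<dots> \<le> D ^ n * (\<Sum>u\<in>B. tau S a u)"
      by (rule chain_sum_start[OF B D])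
    finally show "?s
        \<le> D ^ n * (\<Sum>u\<in>B. tau S a u)" .
  qed (use l in auto)
  finally show ?thesis .
qed

end

section \<open>From the infinite product measure to finite graphs\<close>

text \<open>\<^const>\<open>bernoulli_pmf\<close> clamps its parameter to the unit interval, so this is the probability
  that an edge is open whatever \<open>p\<close> is.\<close>

definition open_prob :: "real \<Rightarrow> real" where
  "open_prob p = pmf (bernoulli_pmf p) True"

lemma open_prob_bounds: "0 \<le> open_prob p" "open_prob p \<le> 1"
  by (auto simp: open_prob_def pmf_le_1)

text \<open>An event read off finitely many edges is a finite disjoint union of cylinders, one for
  each configuration in it.\<close>

lemma percolation_cylinder:
  assumes "finite F" "F \<subseteq> E"
  shows "{\<omega> \<in> space (percolation E p). Q {e \<in> F. \<omega> e}} \<in> sets (percolation E p)"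
    and "\<P>(\<omega> in percolation E p. Q {e \<in> F. \<omega> e})
      = bernoulli_param.bexp (open_prob p) F (\<lambda>\<eta>. of_bool (Q \<eta>))"
proof -
  interpret product_prob_space "\<lambda>_. measure_pmf (bernoulli_pmf p)" E
    by standard
  interpret bernoulli_param "open_prob p"
    by standard (rule open_prob_bounds)+
  define M where "M = percolation E p"
  have M: "M = PiM E (\<lambda>_. measure_pmf (bernoulli_pmf p))" by (simp add: M_def percolation_def)
  interpret M: prob_space M unfolding M by (rule P.prob_space_axioms)
  define cyl where "cyl \<eta> = prod_emb E (\<lambda>_. measure_pmf (bernoulli_pmf p)) F (Pi\<^sub>E F (\<lambda>e. {e \<in> \<eta>}))" for \<eta>
  have cyl: "cyl \<eta> = {\<omega> \<in> space M. \<forall>e\<in>F. \<omega> e \<longleftrightarrow> e \<in> \<eta>}" for \<eta>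
    unfolding cyl_def M prod_emb_def using assms by (auto simp: space_PiM PiE_iff extensional_def)
  have cyl_sets: "cyl \<eta> \<in> sets M" for \<eta>
    unfolding cyl_def M using assms by (intro sets_PiM_I) auto
  have cyl_prob: "measure M (cyl \<eta>) = open_prob p ^ card \<eta> * (1 - open_prob p) ^ card (F - \<eta>)"
    if "\<eta> \<subseteq> F" for \<eta>
  proof -
    have "measure M (cyl \<eta>) = (\<Prod>e\<in>F. measure (measure_pmf (bernoulli_pmf p)) {e \<in> \<eta>})"
      unfolding cyl_def M using assms by (intro measure_PiM_emb) auto
    also have "\<dots> = (\<Prod>e\<in>F. if e \<in> \<eta> then open_prob p else 1 - open_prob p)"
      by (intro prod.cong) (auto simp: measure_pmf_single open_prob_def pmf_False_conv_True)
    also have "\<dots> = (\<Prod>e\<in>F \<inter> {e. e \<in> \<eta>}. open_prob p) * (\<Prod>e\<in>F \<inter> - {e. e \<in> \<eta>}. 1 - open_prob p)"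
      using assms by (intro prod.If_cases) auto
    moreover have "F \<inter> {e. e \<in> \<eta>} = \<eta>" "F \<inter> - {e. e \<in> \<eta>} = F - \<eta>" using that by auto
    ultimately show ?thesis by simp
  qed
  define J where "J = {\<eta> \<in> Pow F. Q \<eta>}"
  have J: "finite J" using assms by (simp add: J_def)
  have eq: "{\<omega> \<in> space M. Q {e \<in> F. \<omega> e}} = (\<Union>\<eta>\<in>J. cyl \<eta>)"
  proof (intro set_eqI iffI)
    fix \<omega> assume "\<omega> \<in> {\<omega> \<in> space M. Q {e \<in> F. \<omega> e}}"
    then have "{e \<in> F. \<omega> e} \<in> J" "\<omega> \<in> cyl {e \<in> F. \<omega> e}" by (auto simp: J_def cyl)
    then show "\<omega> \<in> (\<Union>\<eta>\<in>J. cyl \<eta>)" by blast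
  next
    fix \<omega> assume "\<omega> \<in> (\<Union>\<eta>\<in>J. cyl \<eta>)"
    then obtain \<eta> where \<eta>: "\<eta> \<subseteq> F" "Q \<eta>" "\<omega> \<in> cyl \<eta>" by (auto simp: J_def)
    then have "{e \<in> F. \<omega> e} = \<eta>" by (auto simp: cyl)
    then show "\<omega> \<in> {\<omega> \<in> space M. Q {e \<in> F. \<omega> e}}" using \<eta> by (simp add: cyl)
  qed
  have disj: "disjoint_family_on cyl J"
  proof (unfold disjoint_family_on_def, intro ballI impI)
    fix \<eta> \<eta>' assume *: "\<eta> \<in> J" "\<eta>' \<in> J" "\<eta> \<noteq> \<eta>'"
    then have "\<exists>e\<in>F. (e \<in> \<eta>) \<noteq> (e \<in> \<eta>')" by (auto simp: J_def)
    then show "cyl \<eta> \<inter> cyl \<eta>' = {}" by (auto simp: cyl)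
  qed
  show "{\<omega> \<in> space (percolation E p). Q {e \<in> F. \<omega> e}} \<in> sets (percolation E p)"
    unfolding M_def[symmetric] eq using J cyl_sets by auto
  have "measure M {\<omega> \<in> space M. Q {e \<in> F. \<omega> e}} = (\<Sum>\<eta>\<in>J. measure M (cyl \<eta>))"
    unfolding eq using J disj cyl_sets by (intro M.finite_measure_finite_Union) auto
  also have "\<dots> = (\<Sum>\<eta>\<in>J. open_prob p ^ card \<eta> * (1 - open_prob p) ^ card (F - \<eta>))"
    using cyl_prob by (intro sum.cong) (auto simp: J_def)
  also have "\<dots> = bexp F (\<lambda>\<eta>. of_bool (Q \<eta>))"
    unfolding bexp_def J_def using assms by (intro sum.mono_neutral_cong_left) auto
  finally show "\<P>(\<omega> in percolation E p. Q {e \<in> F. \<omega> e}) = bexp F (\<lambda>\<eta>. of_bool (Q \<eta>))"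
    by (simp add: M_def)
qed

lemma prob_space_percolation: "prob_space (percolation E p)"
  unfolding percolation_def by (intro prob_space_PiM prob_space_measure_pmf)

lemma finite_percolation_open_prob:
  "finite V \<Longrightarrow> finite_percolation (open_prob p) V {e \<in> E. e \<subseteq> V}"
  using open_prob_bounds by unfold_locales auto

lemma connected_in_finite:
  assumes "A \<subseteq> V"
  shows "connected_in E \<omega> A x y \<longleftrightarrow> conn {e \<in> {e \<in> E. e \<subseteq> V}. \<omega> e} A x y"
proof -
  have "{e \<in> E. \<omega> e} \<inter> {e. e \<subseteq> A} = {e \<in> {e \<in> E. e \<subseteq> V}. \<omega> e} \<inter> {e. e \<subseteq> A}" using assms by auto
  then show ?thesis
    unfolding connected_in_conn using conn_restrict[of "{e \<in> E. \<omega> e}" A x y]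
      conn_restrict[of "{e \<in> {e \<in> E. e \<subseteq> V}. \<omega> e}" A x y] by simp
qed

lemma two_point_finite:
  assumes "finite V" "A \<subseteq> V"
  shows "two_point E p A x y = finite_percolation.tau (open_prob p) {e \<in> E. e \<subseteq> V} A x y"
proof -
  interpret finite_percolation "open_prob p" V "{e \<in> E. e \<subseteq> V}"
    by (rule finite_percolation_open_prob[OF assms(1)])
  show ?thesis
    unfolding two_point_def tau_def connected_in_finite[OF assms(2)]
    by (rule percolation_cylinder(2)[OF finite_E]) auto
qed

lemma connected_in_measurable:
  assumes "finite A"
  shows "{\<omega> \<in> space (percolation E p). connected_in E \<omega> A x y} \<in> sets (percolation E p)"
  unfolding connected_in_finite[OF order.refl[of A]]
  using assms by (intro percolation_cylinder(1)) auto

text \<open>A path visits finitely many sites and so lies in some \<open>B N\<close>. The connection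
  event is therefore an increasing union of measurable events, and continuity from below
  applies.\<close>

lemma two_point_exhaustion:
  fixes B :: "nat \<Rightarrow> 'v set"
  assumes fin: "\<And>N. finite (B N)" and inc: "incseq B" and un: "(\<Union>N. B N) = UNIV"
  shows "(\<lambda>N. two_point E p (A \<inter> B N) x y) \<longlonglongrightarrow> two_point E p A x y"
    and "two_point E p (A \<inter> B N) x y \<le> two_point E p A x y"
proof -
  interpret prob_space "percolation E p" by (rule prob_space_percolation)
  define ev where "ev A = {\<omega> \<in> space (percolation E p). connected_in E \<omega> A x y}" for A
  have mono: "ev A \<subseteq> ev A'" if "A \<subseteq> A'" for A A' :: "'v set"
    unfolding ev_def connected_in_def using that by blast
  have sets: "ev (A \<inter> B N) \<in> sets (percolation E p)" for N
    unfolding ev_def using fin by (intro connected_in_measurable) auto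
  have incs: "incseq (\<lambda>N. ev (A \<inter> B N))"
    by (intro incseq_SucI mono) (use incseq_SucD[OF inc] in auto)
  have eq: "ev A = (\<Union>N. ev (A \<inter> B N))"
  proof
    show "ev A \<subseteq> (\<Union>N. ev (A \<inter> B N))"
    proof
      fix \<omega> assume \<omega>: "\<omega> \<in> ev A"
      then obtain xs where xs: "xs \<noteq> []" "hd xs = x" "last xs = y" "set xs \<subseteq> A"
        "successively (\<lambda>u v. {u, v} \<in> E \<and> \<omega> {u, v}) xs"
        unfolding ev_def connected_in_def by auto
      have "finite X \<Longrightarrow> \<exists>N. X \<subseteq> B N" for X
      proof (induction X rule: finite_induct)
        case (insert v X)
        then obtain N where "X \<subseteq> B N" by auto
        moreover obtain N' where "v \<in> B N'" using un by blast
        ultimately have "insert v X \<subseteq> B (max N N')"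
          using incseqD[OF inc, of N "max N N'"] incseqD[OF inc, of N' "max N N'"] by auto
        then show ?case by blast
      qed auto
      then obtain N where "set xs \<subseteq> B N" by (meson finite_set)
      with xs \<omega> have "\<omega> \<in> ev (A \<inter> B N)" unfolding ev_def connected_in_def by auto
      then show "\<omega> \<in> (\<Union>N. ev (A \<inter> B N))" by blast
    qed
    show "(\<Union>N. ev (A \<inter> B N)) \<subseteq> ev A" using mono by blast
  qed
  have lim: "(\<lambda>N. measure (percolation E p) (ev (A \<inter> B N))) \<longlonglongrightarrow> measure (percolation E p) (ev A)"
    unfolding eq using sets incs by (intro finite_Lim_measure_incseq) auto
  then show "(\<lambda>N. two_point E p (A \<inter> B N) x y) \<longlonglongrightarrow> two_point E p A x y"
    by (simp add: two_point_def ev_def)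
  have "ev A \<in> sets (percolation E p)" unfolding eq using sets by auto
  then have "measure (percolation E p) (ev (A \<inter> B N)) \<le> measure (percolation E p) (ev A)"
    by (intro finite_measure_mono mono) auto
  then show "two_point E p (A \<inter> B N) x y \<le> two_point E p A x y"
    by (simp add: two_point_def ev_def)
qed

section \<open>Counting lattice points\<close>

text \<open>The sup norm with values in \<open>nat\<close>, so that shells and cubes have natural
  radii; \<open>linf_norm_nrm\<close> links it to \<open>linf_norm\<close>.\<close>

definition nrm :: "'d::finite site \<Rightarrow> nat" where
  "nrm x = Max (range (\<lambda>i. nat \<bar>x $ i\<bar>))"

lemma nrm_le_iff: "nrm x \<le> r \<longleftrightarrow> (\<forall>i. \<bar>x $ i\<bar> \<le> int r)"
  unfolding nrm_def by (subst Max_le_iff) (auto simp: nat_le_iff)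

lemma nrm_component: "\<bar>x $ i\<bar> \<le> int (nrm x)"
  using nrm_le_iff[of x "nrm x"] by simp

lemma nrm_zero [simp]: "nrm 0 = 0"
  using nrm_le_iff[of 0 0] by simp

lemma nrm_triangle: "nrm (x + y) \<le> nrm x + nrm y"
  unfolding nrm_le_iff
proof
  fix i
  show "\<bar>(x + y) $ i\<bar> \<le> int (nrm x + nrm y)"
    using nrm_component[of x i] nrm_component[of y i] by simp
qed

lemma nrm_minus_commute: "nrm (x - y) = nrm (y - x)"
  by (intro order.antisym) (auto simp: nrm_le_iff abs_minus_commute intro: order_trans[OF _ nrm_component])

lemma nrm_diff_triangle: "nrm (x - z) \<le> nrm (x - y) + nrm (y - z)"
  using nrm_triangle[of "x - y" "y - z"] by simp

lemma linf_norm_nrm: "linf_norm x = real (nrm x)" for x :: "'d::finite site"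
proof (rule order.antisym)
  let ?v = "\<chi> i. real_of_int (x $ i) :: real ^ 'd"
  have le: "\<bar>?v $ i\<bar> \<le> real (nrm x)" for i
    using nrm_component[of x i] by simp
  then show "linf_norm x \<le> real (nrm x)"
    unfolding linf_norm_def infnorm_cart by (intro cSup_least) auto
  have "nrm x \<in> range (\<lambda>i. nat \<bar>x $ i\<bar>)"
    unfolding nrm_def by (intro Max_in) auto
  then obtain i where "nrm x = nat \<bar>x $ i\<bar>" by blast
  then have "real (nrm x) = \<bar>?v $ i\<bar>" by simp
  then show "real (nrm x) \<le> linf_norm x"
    unfolding linf_norm_def using component_le_infnorm_cart[of ?v i] by simp
qed

definition cube :: "'d::finite site \<Rightarrow> nat \<Rightarrow> 'd site set" where
  "cube a r = {x. nrm (x - a) \<le> r}"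

lemma cube_image: "cube a r = vec_lambda ` (\<Pi>\<^sub>E i\<in>UNIV. {a $ i - int r..a $ i + int r})"
proof
  show "cube a r \<subseteq> vec_lambda ` (\<Pi>\<^sub>E i\<in>UNIV. {a $ i - int r..a $ i + int r})"
  proof
    fix x assume x: "x \<in> cube a r"
    have "\<bar>x $ i - a $ i\<bar> \<le> int r" for i using x unfolding cube_def nrm_le_iff by simp
    then have "a $ i - int r \<le> x $ i \<and> x $ i \<le> a $ i + int r" for i by (smt (verit))
    then show "x \<in> vec_lambda ` (\<Pi>\<^sub>E i\<in>UNIV. {a $ i - int r..a $ i + int r})"
      by (intro image_eqI[of _ _ "vec_nth x"]) (auto simp: PiE_UNIV_domain)
  qed
  show "vec_lambda ` (\<Pi>\<^sub>E i\<in>UNIV. {a $ i - int r..a $ i + int r}) \<subseteq> cube a r"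
  proof (intro image_subsetI)
    fix f assume "f \<in> (\<Pi>\<^sub>E i\<in>UNIV. {a $ i - int r..a $ i + int r})"
    then have "a $ i - int r \<le> f i \<and> f i \<le> a $ i + int r" for i by auto
    then have "\<bar>f i - a $ i\<bar> \<le> int r" for i by (smt (verit))
    then show "vec_lambda f \<in> cube a r" unfolding cube_def nrm_le_iff by simp
  qed
qed

lemma inj_vec_lambda: "inj_on vec_lambda A"
  by (auto simp: inj_on_def vec_lambda_inject)

lemma finite_cube [simp]: "finite (cube a r)"
  unfolding cube_image by (intro finite_imageI finite_PiE) auto

lemma card_cube: "card (cube a r) = (2 * r + 1) ^ CARD('d)" for a :: "'d::finite site"
  unfolding cube_image card_image[OF inj_vec_lambda]
  by (subst card_PiE) (simp_all add: nat_add_distrib nat_mult_distrib)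

lemma cube_mono: "r \<le> s \<Longrightarrow> cube a r \<subseteq> cube a s"
  by (auto simp: cube_def)

lemma incseq_cube: "incseq (cube a)"
  by (intro incseq_SucI cube_mono) simp

lemma UN_cube: "(\<Union>r. cube a r) = UNIV"
  by (auto simp: cube_def)

lemma power_split: "n = a + b \<Longrightarrow> x ^ n = x ^ a * (x ^ b :: real)"
  by (simp add: power_add)

lemma power_diff_le:
  fixes a b :: real
  assumes "0 \<le> b" "b \<le> a"
  shows "a ^ Suc n - b ^ Suc n \<le> Suc n * (a - b) * a ^ n"
proof (induction n)
  case (Suc n)
  have "a ^ Suc (Suc n) - b ^ Suc (Suc n) = a * (a ^ Suc n - b ^ Suc n) + (a - b) * b ^ Suc n"
    by (simp add: algebra_simps)
  also have "\<dots> \<le> a * (Suc n * (a - b) * a ^ n) + (a - b) * a ^ Suc n"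
    using assms Suc by (intro add_mono mult_left_mono power_mono) auto
  finally show ?case by (simp add: algebra_simps)
qed simp

text \<open>Each term is at most a difference of consecutive values of \<open>1 / (1 + k)\<close>;
  the subtracted last term lets the induction telescope.\<close>

lemma sum_inverse_squares: "\<rho> \<le> M \<Longrightarrow> (\<Sum>k=\<rho>..M. 1 / (1 + real k) ^ 2) \<le> 2 / (1 + real \<rho>) - 1 / (1 + real M)"
proof (induction M rule: dec_induct)
  case base
  have "(1 + real \<rho>) * 1 \<le> (1 + real \<rho>) ^ 2" unfolding power2_eq_square by (intro mult_left_mono) auto
  then have "1 / (1 + real \<rho>) ^ 2 \<le> 1 / (1 + real \<rho>)" by (intro divide_left_mono) auto
  then show ?case by simp
next
  case (step M)
  have "1 / (1 + real (Suc M)) ^ 2 \<le> 1 / ((1 + real M) * (1 + real (Suc M)))"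
    unfolding power2_eq_square by (intro divide_left_mono mult_right_mono) auto
  also have "\<dots> = 1 / (1 + real M) - 1 / (1 + real (Suc M))"
    by (simp add: divide_simps)
  finally have "1 / (1 + real (Suc M)) ^ 2 \<le> 1 / (1 + real M) - 1 / (1 + real (Suc M))" .
  then show ?case using step by simp
qed

lemma geometric_tail: "(\<Sum>j\<in>{k0<..k1}. 1 / 2 ^ j) \<le> (1 / 2 ^ k0 :: real)"
proof (cases "k0 \<le> k1")
  case True
  then have "(\<Sum>j\<in>{k0<..k1}. 1 / 2 ^ j) = (1 / 2 ^ k0 - 1 / 2 ^ k1 :: real)"
  proof (induction k1 rule: dec_induct)
    case (step k)
    then have "{k0<..Suc k} = insert (Suc k) {k0<..k}" by auto
    then show ?case using step by simp
  qed simp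
  then show ?thesis by simp
qed simp

text \<open>Writing d as \<open>e + 7\<close> keeps the exponents free of truncated subtraction:
  \<open>e + 6\<close> is d - 1, \<open>e + 5\<close> is d - 2 and \<open>e + 3\<close> is d -
  4.\<close>

locale dim_gt_6 =
  fixes e :: nat and dim :: "'d::finite itself"
  assumes dim: "CARD('d) = e + 7"
begin

text \<open>Powers of 1 + |x| multiply and split cleanly; they replace the expression 1 + |x|^(d-2)
  of the theorem, to which they are comparable.\<close>

definition wgt :: "'d site \<Rightarrow> real" where
  "wgt x = 1 + real (nrm x)"

lemma wgt_pos: "0 < wgt x"
  by (simp add: wgt_def)

lemma wgt_commute: "wgt (x - y) = wgt (y - x)"
  unfolding wgt_def nrm_minus_commute[of x y] ..

definition shell_const :: real where
  "shell_const = 2 * (real e + 7) * 2 ^ (e + 6)"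

lemma shell_const_ge_1: "1 \<le> shell_const"
proof -
  have "(1::real) * 1 \<le> (2 * (real e + 7)) * 2 ^ (e + 6)" by (intro mult_mono one_le_power) auto
  then show ?thesis by (simp add: shell_const_def)
qed

lemma card_shell:
  fixes a :: "'d site"
  shows "real (card {x. nrm (x - a) = k}) \<le> shell_const * (1 + real k) ^ (e + 6)"
proof (cases k)
  case 0
  have "{x. nrm (x - a) = 0} = cube a 0" by (auto simp: cube_def)
  then have "card {x. nrm (x - a) = k} = 1" using 0 by (simp add: card_cube)
  then show ?thesis using 0 shell_const_ge_1 by simp
next
  case (Suc j)
  have "{x. nrm (x - a) = k} = cube a k - cube a j" using Suc by (auto simp: cube_def)
  then have "real (card {x. nrm (x - a) = k}) = real ((2 * k + 1) ^ (e + 7)) - real ((2 * j + 1) ^ (e + 7))"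
    using card_Diff_subset[of "cube a j" "cube a k"] cube_mono[of j k a] Suc
      card_mono[of "cube a k" "cube a j"]
    by (simp add: card_cube dim of_nat_diff del: of_nat_power of_nat_add of_nat_mult)
  also have "\<dots> = (2 * real k + 1) ^ Suc (e + 6) - (2 * real j + 1) ^ Suc (e + 6)"
  proof -
    have "e + 7 = Suc (e + 6)" by simp
    then show ?thesis by (simp only: of_nat_power of_nat_add of_nat_mult of_nat_numeral of_nat_1)
  qed
  also have "\<dots> \<le> Suc (e + 6) * ((2 * real k + 1) - (2 * real j + 1)) * (2 * real k + 1) ^ (e + 6)"
    using Suc by (intro power_diff_le) auto
  also have "\<dots> = 2 * (real e + 7) * (2 * real k + 1) ^ (e + 6)" using Suc by simp
  also have "\<dots> \<le> 2 * (real e + 7) * (2 * (1 + real k)) ^ (e + 6)"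
    by (intro mult_left_mono power_mono) auto
  also have "\<dots> = shell_const * (1 + real k) ^ (e + 6)"
    by (simp only: shell_const_def power_mult_distrib mult.assoc)
  finally show ?thesis .
qed

lemma shell_sum:
  fixes a :: "'d site"
  assumes B: "finite B" and K: "finite K" "\<And>x. x \<in> B \<Longrightarrow> nrm (x - a) \<in> K"
    and f: "\<And>k. 0 \<le> f k"
  shows "(\<Sum>x\<in>B. f (nrm (x - a))) \<le> (\<Sum>k\<in>K. shell_const * (1 + real k) ^ (e + 6) * f k)"
proof -
  have "(\<Sum>x\<in>B. f (nrm (x - a))) = (\<Sum>k\<in>K. \<Sum>x\<in>{x \<in> B. nrm (x - a) = k}. f (nrm (x - a)))"
    using B K by (intro sum.group[symmetric]) auto
  also have "\<dots> = (\<Sum>k\<in>K. real (card {x \<in> B. nrm (x - a) = k}) * f k)"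
    by (intro sum.cong) auto
  also have "\<dots> \<le> (\<Sum>k\<in>K. shell_const * (1 + real k) ^ (e + 6) * f k)"
  proof (intro sum_mono mult_right_mono f)
    fix k
    have "{x. nrm (x - a) = k} \<subseteq> cube a k" by (auto simp: cube_def)
    then have "finite {x. nrm (x - a) = k}" using finite_cube finite_subset by blast
    then have "card {x \<in> B. nrm (x - a) = k} \<le> card {x. nrm (x - a) = k}"
      by (intro card_mono) auto
    then show "real (card {x \<in> B. nrm (x - a) = k}) \<le> shell_const * (1 + real k) ^ (e + 6)"
      using card_shell[of a k] by linarith
  qed
  finally show ?thesis .
qed

lemma near_sum:
  fixes a :: "'d site"
  assumes "finite B" "\<And>x. x \<in> B \<Longrightarrow> nrm (x - a) \<le> r"
  shows "(\<Sum>x\<in>B. 1 / wgt (x - a) ^ (e + 5)) \<le> shell_const * (1 + real r) ^ 2"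
proof -
  have "(\<Sum>x\<in>B. 1 / wgt (x - a) ^ (e + 5))
      \<le> (\<Sum>k\<in>{..r}. shell_const * (1 + real k) ^ (e + 6) * (1 / (1 + real k) ^ (e + 5)))"
    unfolding wgt_def using assms by (intro shell_sum) auto
  also have "\<dots> = (\<Sum>k\<in>{..r}. shell_const * (1 + real k))"
  proof (intro sum.cong refl)
    fix k
    have "(1 + real k) ^ (e + 6) = (1 + real k) * (1 + real k) ^ (e + 5)"
      using power_split[of "e + 6" 1 "e + 5" "1 + real k"] by simp
    then show "shell_const * (1 + real k) ^ (e + 6) * (1 / (1 + real k) ^ (e + 5)) = shell_const * (1 + real k)"
      by simp
  qed
  also have "\<dots> \<le> (\<Sum>k\<in>{..r}. shell_const * (1 + real r))"
    using shell_const_ge_1 by (intro sum_mono mult_left_mono) auto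
  also have "\<dots> = shell_const * (1 + real r) ^ 2" by (simp add: power2_eq_square)
  finally show ?thesis .
qed

lemma far_sum:
  fixes a :: "'d site"
  assumes B: "finite B" "\<And>x. x \<in> B \<Longrightarrow> \<rho> \<le> nrm (x - a)"
  shows "(\<Sum>x\<in>B. 1 / wgt (x - a) ^ (2 * e + 10)) \<le> 2 * shell_const / (1 + real \<rho>) ^ (e + 3)"
proof -
  define M where "M = Max (insert \<rho> ((\<lambda>x. nrm (x - a)) ` B))"
  have M: "nrm (x - a) \<le> M" if "x \<in> B" for x unfolding M_def using that B by (intro Max_ge) auto
  have "\<rho> \<le> M" unfolding M_def using B by (intro Max_ge) auto
  have "(\<Sum>x\<in>B. 1 / wgt (x - a) ^ (2 * e + 10))
      \<le> (\<Sum>k\<in>{\<rho>..M}. shell_const * (1 + real k) ^ (e + 6) * (1 / (1 + real k) ^ (2 * e + 10)))"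
    unfolding wgt_def using B M by (intro shell_sum) auto
  \<comment> \<open>The net power of 1 + k is -(e + 4). All but two of these powers are frozen at
    \<open>\<rho>\<close>, which leaves a summable inverse square.\<close>
  also have "\<dots> \<le> (\<Sum>k\<in>{\<rho>..M}. shell_const / (1 + real \<rho>) ^ (e + 2) * (1 / (1 + real k) ^ 2))"
  proof (rule sum_mono)
    fix k assume k: "k \<in> {\<rho>..M}"
    have "(1 + real k) ^ (e + 6) * (1 / (1 + real k) ^ (2 * e + 10)) = 1 / (1 + real k) ^ (e + 4)"
    proof -
      have "(1 + real k) ^ (2 * e + 10) = (1 + real k) ^ (e + 6) * (1 + real k) ^ (e + 4)"
        by (rule power_split) simp
      then show ?thesis by simp
    qed
    also have "\<dots> = 1 / (1 + real k) ^ (e + 2) * (1 / (1 + real k) ^ 2)"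
    proof -
      have "(1 + real k) ^ (e + 4) = (1 + real k) ^ (e + 2) * (1 + real k) ^ 2"
        by (rule power_split) simp
      then show ?thesis by simp
    qed
    also have "\<dots> \<le> 1 / (1 + real \<rho>) ^ (e + 2) * (1 / (1 + real k) ^ 2)"
      using k by (intro mult_right_mono divide_left_mono power_mono) auto
    finally have "shell_const * ((1 + real k) ^ (e + 6) * (1 / (1 + real k) ^ (2 * e + 10)))
        \<le> shell_const * (1 / (1 + real \<rho>) ^ (e + 2) * (1 / (1 + real k) ^ 2))"
      using shell_const_ge_1 by (intro mult_left_mono) auto
    then show "shell_const * (1 + real k) ^ (e + 6) * (1 / (1 + real k) ^ (2 * e + 10))
        \<le> shell_const / (1 + real \<rho>) ^ (e + 2) * (1 / (1 + real k) ^ 2)" by simp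
  qed
  also have "\<dots> = shell_const / (1 + real \<rho>) ^ (e + 2) * (\<Sum>k\<in>{\<rho>..M}. 1 / (1 + real k) ^ 2)"
    by (rule sum_distrib_left[symmetric])
  also have "\<dots> \<le> shell_const / (1 + real \<rho>) ^ (e + 2) * (2 / (1 + real \<rho>))"
  proof (intro mult_left_mono)
    show "(\<Sum>k\<in>{\<rho>..M}. 1 / (1 + real k) ^ 2) \<le> 2 / (1 + real \<rho>)"
      using sum_inverse_squares[OF \<open>\<rho> \<le> M\<close>] by (smt (verit) divide_nonneg_nonneg of_nat_0_le_iff)
  qed (use shell_const_ge_1 in simp)
  also have "\<dots> = 2 * shell_const / (1 + real \<rho>) ^ (e + 3)"
    using power_split[of "e + 3" "e + 2" 1 "1 + real \<rho>"] by simp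
  finally show ?thesis .
qed

text \<open>Let \<open>\<rho>\<close> be |v - u|. If \<open>w\<close> is within
  \<open>\<rho>\<close> of \<open>v\<close>, then |w - u| is at least half of \<open>\<rho>\<close>,
  that factor comes out and the other is summed. Further away, both factors are at most the one at
  \<open>v\<close>, and its square is summed.\<close>

lemma half_convolution:
  fixes u v :: "'d site"
  assumes B: "finite B" "\<And>w. w \<in> B \<Longrightarrow> nrm (w - v) \<le> nrm (w - u)"
  shows "(\<Sum>w\<in>B. 1 / wgt (w - v) ^ (e + 5) * (1 / wgt (w - u) ^ (e + 5)))
     \<le> (2 ^ (e + 5) + 2) * shell_const / wgt (v - u) ^ (e + 3)"
proof -
  define \<rho> where "\<rho> = nrm (v - u)"
  define B1 where "B1 = {w \<in> B. nrm (w - v) \<le> \<rho>}"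
  define B2 where "B2 = {w \<in> B. \<rho> \<le> nrm (w - v)}"
  let ?f = "\<lambda>w. 1 / wgt (w - v) ^ (e + 5) * (1 / wgt (w - u) ^ (e + 5))"
  have f0: "0 \<le> ?f w" for w using wgt_pos by (simp add: less_imp_le)
  have fin: "finite B1" "finite B2" using B by (auto simp: B1_def B2_def)
  have "B = B1 \<union> B2" by (auto simp: B1_def B2_def)
  then have "(\<Sum>w\<in>B. ?f w) \<le> (\<Sum>w\<in>B1. ?f w) + (\<Sum>w\<in>B2. ?f w)"
    using fin sum.union_inter[of B1 B2 ?f] sum_nonneg[of "B1 \<inter> B2" ?f, OF f0] by simp
  also have "(\<Sum>w\<in>B1. ?f w) \<le> 2 ^ (e + 5) * shell_const / wgt (v - u) ^ (e + 3)"
  proof -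
    have "(\<Sum>w\<in>B1. ?f w) \<le> (\<Sum>w\<in>B1. 1 / wgt (w - v) ^ (e + 5) * (2 ^ (e + 5) / (1 + real \<rho>) ^ (e + 5)))"
    proof (intro sum_mono mult_left_mono)
      fix w assume "w \<in> B1"
      then have "nrm (w - v) \<le> nrm (w - u)" using B by (auto simp: B1_def)
      moreover have "\<rho> \<le> nrm (w - v) + nrm (w - u)"
        unfolding \<rho>_def using nrm_diff_triangle[of v u w] nrm_minus_commute[of v w] by simp
      ultimately have "\<rho> \<le> 2 * nrm (w - u)" by simp
      then have "1 + real \<rho> \<le> 2 * wgt (w - u)" by (simp add: wgt_def)
      then have "(1 + real \<rho>) ^ (e + 5) \<le> 2 ^ (e + 5) * wgt (w - u) ^ (e + 5)"
        unfolding power_mult_distrib[symmetric] by (intro power_mono) auto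
      then show "1 / wgt (w - u) ^ (e + 5) \<le> 2 ^ (e + 5) / (1 + real \<rho>) ^ (e + 5)"
        using wgt_pos[of "w - u"] by (simp add: divide_simps mult.commute add_pos_nonneg)
      show "0 \<le> 1 / wgt (w - v) ^ (e + 5)" using wgt_pos[of "w - v"] by simp
    qed
    also have "\<dots> = (\<Sum>w\<in>B1. 1 / wgt (w - v) ^ (e + 5)) * (2 ^ (e + 5) / (1 + real \<rho>) ^ (e + 5))"
      by (rule sum_distrib_right[symmetric])
    also have "\<dots> \<le> shell_const * (1 + real \<rho>) ^ 2 * (2 ^ (e + 5) / (1 + real \<rho>) ^ (e + 5))"
      by (intro mult_right_mono near_sum fin) (auto simp: B1_def)
    also have "\<dots> = 2 ^ (e + 5) * shell_const / wgt (v - u) ^ (e + 3)"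
    proof -
      have "(1 + real \<rho>) ^ (e + 5) = (1 + real \<rho>) ^ 2 * (1 + real \<rho>) ^ (e + 3)"
        by (rule power_split) simp
      moreover have "0 < (1 + real \<rho>) ^ 2" by simp
      ultimately show ?thesis unfolding wgt_def \<rho>_def[symmetric] by simp
    qed
    finally show ?thesis .
  qed
  also have "(\<Sum>w\<in>B2. ?f w) \<le> 2 * shell_const / wgt (v - u) ^ (e + 3)"
  proof -
    have "(\<Sum>w\<in>B2. ?f w) \<le> (\<Sum>w\<in>B2. 1 / wgt (w - v) ^ (2 * e + 10))"
    proof (rule sum_mono)
      fix w assume "w \<in> B2"
      then have "wgt (w - v) \<le> wgt (w - u)" using B by (auto simp: B2_def wgt_def)
      then have "?f w \<le> 1 / wgt (w - v) ^ (e + 5) * (1 / wgt (w - v) ^ (e + 5))"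
        using wgt_pos by (intro mult_left_mono divide_left_mono power_mono mult_pos_pos zero_less_power) (auto simp: less_imp_le)
      also have "\<dots> = 1 / wgt (w - v) ^ (2 * e + 10)"
        using power_split[of "2 * e + 10" "e + 5" "e + 5" "wgt (w - v)"] by simp
      finally show "?f w \<le> 1 / wgt (w - v) ^ (2 * e + 10)" .
    qed
    also have "\<dots> \<le> 2 * shell_const / (1 + real \<rho>) ^ (e + 3)"
      using fin by (intro far_sum) (auto simp: B2_def)
    finally show ?thesis by (simp add: wgt_def \<rho>_def)
  qed
  finally show ?thesis by (simp add: add_divide_distrib distrib_right)
qed

definition conv_const :: real where
  "conv_const = 2 * (2 ^ (e + 5) + 2) * shell_const"

lemma convolution:
  fixes u v :: "'d site"
  assumes "finite B"
  shows "(\<Sum>w\<in>B. 1 / wgt (w - v) ^ (e + 5) * (1 / wgt (w - u) ^ (e + 5)))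
     \<le> conv_const / wgt (v - u) ^ (e + 3)"
proof -
  let ?f = "\<lambda>w. 1 / wgt (w - v) ^ (e + 5) * (1 / wgt (w - u) ^ (e + 5))"
  define B1 where "B1 = {w \<in> B. nrm (w - v) \<le> nrm (w - u)}"
  define B2 where "B2 = {w \<in> B. nrm (w - u) \<le> nrm (w - v)}"
  have f0: "0 \<le> ?f w" for w using wgt_pos by (simp add: less_imp_le)
  have fin: "finite B1" "finite B2" using assms by (auto simp: B1_def B2_def)
  have "B = B1 \<union> B2" by (auto simp: B1_def B2_def)
  then have "(\<Sum>w\<in>B. ?f w) \<le> (\<Sum>w\<in>B1. ?f w) + (\<Sum>w\<in>B2. ?f w)"
    using fin sum.union_inter[of B1 B2 ?f] sum_nonneg[of "B1 \<inter> B2" ?f, OF f0] by simp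
  also have "(\<Sum>w\<in>B1. ?f w) \<le> (2 ^ (e + 5) + 2) * shell_const / wgt (v - u) ^ (e + 3)"
    using fin by (intro half_convolution) (auto simp: B1_def)
  also have "(\<Sum>w\<in>B2. ?f w) = (\<Sum>w\<in>B2. 1 / wgt (w - u) ^ (e + 5) * (1 / wgt (w - v) ^ (e + 5)))"
    by (simp add: mult.commute)
  also have "\<dots> \<le> (2 ^ (e + 5) + 2) * shell_const / wgt (v - u) ^ (e + 3)"
    unfolding wgt_commute[of v u] using fin by (intro half_convolution) (auto simp: B2_def)
  moreover have "conv_const / wgt (v - u) ^ (e + 3) = 2 * ((2 ^ (e + 5) + 2) * shell_const / wgt (v - u) ^ (e + 3))"
    by (simp only: conv_const_def mult.assoc times_divide_eq_right)
  ultimately show ?thesis by linarith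
qed

definition cube_const :: real where
  "cube_const = shell_const + 2 ^ (e + 7)"

text \<open>The cube need not be centred at \<open>w\<close>. Sites within \<open>r\<close> of
  \<open>w\<close> form part of a centred cube, and the others have a uniformly small summand, so
  counting them suffices.\<close>

lemma cube_sum:
  fixes w :: "'d site"
  assumes B: "B \<subseteq> cube a r"
  shows "(\<Sum>z\<in>B. 1 / wgt (z - w) ^ (e + 5)) \<le> cube_const * (1 + real r) ^ 2"
proof -
  let ?f = "\<lambda>z. 1 / wgt (z - w) ^ (e + 5)"
  define B1 where "B1 = {z \<in> B. nrm (z - w) \<le> r}"
  define B2 where "B2 = {z \<in> B. r < nrm (z - w)}"
  have finB: "finite B" using B finite_cube finite_subset by blast
  then have fin: "finite B1" "finite B2" by (auto simp: B1_def B2_def)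
  have "B = B1 \<union> B2" "B1 \<inter> B2 = {}" by (auto simp: B1_def B2_def)
  then have "(\<Sum>z\<in>B. ?f z) = (\<Sum>z\<in>B1. ?f z) + (\<Sum>z\<in>B2. ?f z)"
    using fin sum.union_disjoint by metis
  also have "(\<Sum>z\<in>B1. ?f z) \<le> shell_const * (1 + real r) ^ 2"
    using fin by (intro near_sum) (auto simp: B1_def)
  also have "(\<Sum>z\<in>B2. ?f z) \<le> 2 ^ (e + 7) * (1 + real r) ^ 2"
  proof -
    have "(\<Sum>z\<in>B2. ?f z) \<le> (\<Sum>z\<in>B2. 1 / (1 + real r) ^ (e + 5))"
      by (intro sum_mono divide_left_mono power_mono mult_pos_pos zero_less_power wgt_pos) (auto simp: B2_def wgt_def)
    also have "\<dots> = real (card B2) * (1 / (1 + real r) ^ (e + 5))" by simp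
    also have "\<dots> \<le> (2 * (1 + real r)) ^ (e + 7) * (1 / (1 + real r) ^ (e + 5))"
    proof (intro mult_right_mono)
      have "card B2 \<le> card (cube a r)" using B by (intro card_mono) (auto simp: B2_def)
      then have "real (card B2) \<le> real ((2 * r + 1) ^ (e + 7))" by (simp add: card_cube dim del: of_nat_power)
      also have "\<dots> \<le> (2 * (1 + real r)) ^ (e + 7)" unfolding of_nat_power by (intro power_mono) auto
      finally show "real (card B2) \<le> (2 * (1 + real r)) ^ (e + 7)" .
    qed simp
    also have "\<dots> = 2 ^ (e + 7) * (1 + real r) ^ 2"
    proof -
      have "(1 + real r) ^ (e + 7) = (1 + real r) ^ (e + 5) * (1 + real r) ^ 2"
        by (rule power_split) simp
      then show ?thesis
        unfolding power_mult_distrib[of 2 "1 + real r"] by (simp only: mult.assoc) simp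
    qed
    finally show ?thesis .
  qed
  finally show ?thesis by (simp add: cube_const_def distrib_right)
qed

end

section \<open>Half-spaces under the two-point estimate\<close>

text \<open>This covers both graphs, the nearest-neighbour one being \<open>spread_out 1\<close>.
  Here \<open>h\<close> is the distinguished coordinate, called the height below.\<close>

locale critical_lattice = dim_gt_6 e dim for e and dim :: "'d::finite itself" +
  fixes E :: "'d site set set" and h :: 'd and L :: nat and p c C :: real
  assumes L_pos: "1 \<le> L" and E_eq: "E = spread_out L" and c_pos: "0 < c" and c_le: "c \<le> C"
    and lower: "\<And>x y. c / wgt (x - y) ^ (e + 5) \<le> two_point E p UNIV x y"
    and upper: "\<And>x y. two_point E p UNIV x y \<le> C / wgt (x - y) ^ (e + 5)"
begin

abbreviation P :: real where "P \<equiv> open_prob p"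

abbreviation box :: "nat \<Rightarrow> 'd site set" where "box N \<equiv> cube 0 N"

text \<open>One finite model for every box. Estimates are proved with constants independent of
  \<open>N\<close> and then passed to the limit.\<close>

sublocale fp: finite_percolation P "box N" "{e \<in> E. e \<subseteq> box N}" for N
  by (rule finite_percolation_open_prob) simp

lemma C_pos: "0 < C"
  using c_pos c_le by simp

lemma tau_two_point: "A \<subseteq> box N \<Longrightarrow> fp.tau N A x y = two_point E p A x y"
  by (rule two_point_finite[symmetric]) simp

lemma two_point_lim: "(\<lambda>N. two_point E p (A \<inter> box N) x y) \<longlonglongrightarrow> two_point E p A x y"
  by (rule two_point_exhaustion[OF finite_cube incseq_cube UN_cube])

lemma two_point_le: "two_point E p (A \<inter> box N) x y \<le> two_point E p A x y"
  by (rule two_point_exhaustion(2)[OF finite_cube incseq_cube UN_cube])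

lemma two_point_nonneg: "0 \<le> two_point E p A x y"
  by (simp add: two_point_def)

lemma tau_upper: "A \<subseteq> box N \<Longrightarrow> fp.tau N A x y \<le> C / wgt (x - y) ^ (e + 5)"
  using fp.tau_mono[of A "box N" N x y] tau_two_point[of "box N" N x y]
    two_point_le[of UNIV N x y] upper[of x y] by simp

lemma two_point_harris: "two_point E p A x y * two_point E p A y z \<le> two_point E p A x z"
proof (rule LIMSEQ_le[OF tendsto_mult[OF two_point_lim two_point_lim] two_point_lim])
  have "two_point E p (A \<inter> box N) x y * two_point E p (A \<inter> box N) y z \<le> two_point E p (A \<inter> box N) x z" for N
    using fp.tau_harris[of N "A \<inter> box N" x y z] tau_two_point[of "A \<inter> box N" N] by simp
  then show "\<exists>N. \<forall>n\<ge>N. two_point E p (A \<inter> box n) x y * two_point E p (A \<inter> box n) y z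
      \<le> two_point E p (A \<inter> box n) x z" by blast
qed

lemma two_point_le_1: "two_point E p A x y \<le> 1"
  unfolding two_point_def using prob_space.prob_le_1[OF prob_space_percolation] .

definition dir :: "'d site" where
  "dir = axis h 1"

lemma dir_nth: "dir $ i = (if i = h then 1 else 0)"
  by (simp add: dir_def axis_def)

lemma nrm_dir: "nrm (of_nat j *s dir) = j"
proof (rule order.antisym)
  show "nrm (of_nat j *s dir) \<le> j" unfolding nrm_le_iff by (simp add: dir_nth)
  show "j \<le> nrm (of_nat j *s dir)" using nrm_component[of "of_nat j *s dir" h] by (simp add: dir_nth)
qed

lemma edge_nrm: "{x, y} \<in> E \<Longrightarrow> nrm (x - y) \<le> L"
proof -
  assume "{x, y} \<in> E"
  then obtain u v where uv: "{x, y} = {u, v}" "l1_norm (u - v) \<le> int L"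
    unfolding E_eq spread_out_def by blast
  have "\<bar>(u - v) $ i\<bar> \<le> l1_norm (u - v)" for i
    unfolding l1_norm_def by (intro member_le_sum) auto
  then have "nrm (u - v) \<le> L" using uv(2) unfolding nrm_le_iff by (meson order_trans)
  then show ?thesis using uv(1) nrm_minus_commute[of u v] by (auto simp: doubleton_eq_iff)
qed

lemma edge_height: "{x, y} \<in> E \<Longrightarrow> \<bar>x $ h - y $ h\<bar> \<le> int L"
  using edge_nrm[of x y] unfolding nrm_le_iff by (metis vector_minus_component)

lemma vertical_edge:
  assumes "1 \<le> j" "j \<le> L"
  shows "{x, x - of_nat j *s dir} \<in> E"
proof -
  have "l1_norm (of_nat j *s dir) = (\<Sum>i\<in>UNIV. if i = h then int j else 0)"
    unfolding l1_norm_def by (intro sum.cong) (auto simp: dir_nth)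
  then have "l1_norm (of_nat j *s dir) = int j" by simp
  moreover have "(of_nat j *s dir) $ h \<noteq> 0" using assms by (simp add: dir_nth)
  then have "of_nat j *s dir \<noteq> (0 :: 'd site)" by (metis zero_index)
  ultimately show ?thesis
    unfolding E_eq spread_out_def using assms
    by (intro CollectI exI[of _ x] exI[of _ "x - of_nat j *s dir"]) auto
qed

abbreviation H :: "nat \<Rightarrow> 'd site set" where "H n \<equiv> half_space h n"

text \<open>An edge changes the height by at most \<open>L\<close>, so a layer of thickness
  \<open>L\<close> contains every site from which an edge can leave the half-space.\<close>

definition bd :: "nat \<Rightarrow> 'd site set" where
  "bd n = {x. - int n \<le> x $ h \<and> x $ h < - int n + int L}"

lemma exit_bd: "x \<in> H n \<Longrightarrow> y \<notin> H n \<Longrightarrow> {x, y} \<in> E \<Longrightarrow> x \<in> bd n"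
  using edge_height[of x y] by (auto simp: half_space_def bd_def)

text \<open>If the cluster of \<open>v\<close> within \<open>H n \<inter> D\<close> missed the
  layer, no open edge inside \<open>D\<close> could leave it, and \<open>z\<close> would be out of
  reach.\<close>

lemma exit_sum:
  assumes D: "D \<subseteq> box N" and v: "v \<in> H n" and z: "z \<notin> H n"
  shows "fp.tau N D v z \<le> (\<Sum>x\<in>bd n \<inter> D. fp.tau N (H n \<inter> box N) v x)"
  unfolding fp.tau_def
proof (rule fp.bprob_union)
  show "finite (bd n \<inter> D)" using D finite_cube finite_subset by blast
  fix \<omega> assume \<omega>: "\<omega> \<subseteq> {e \<in> E. e \<subseteq> box N}" and c: "conn \<omega> D v z"
  define A where "A = {u. conn \<omega> (H n \<inter> D) v u}"
  show "\<exists>x\<in>bd n \<inter> D. conn \<omega> (H n \<inter> box N) v x"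
  proof (rule ccontr)
    assume neg: "\<not> ?thesis"
    have "z \<in> A"
    proof (rule conn_closed[OF c])
      show "v \<in> A" using conn_in(1)[OF c] v by (simp add: A_def)
      fix u w assume u: "u \<in> A" and uw: "{u, w} \<in> \<omega>" and w: "w \<in> D"
      have cu: "conn \<omega> (H n \<inter> D) v u" using u by (simp add: A_def)
      have uHD: "u \<in> H n \<inter> D" by (rule conn_in(2)[OF cu])
      show "w \<in> A"
      proof (cases "w \<in> H n")
        case True
        have "conn \<omega> (H n \<inter> D) w v"
          by (rule conn_step[OF conn_sym[OF cu]]) (use True w uw in \<open>auto simp: insert_commute\<close>)
        then show ?thesis unfolding A_def mem_Collect_eq by (rule conn_sym)
      next
        case False
        have "u \<in> bd n" by (rule exit_bd[of u n w]) (use uHD False uw \<omega> in auto)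
        moreover have "conn \<omega> (H n \<inter> box N) v u" by (rule conn_mono[OF cu]) (use D in auto)
        ultimately show ?thesis using neg uHD by blast
      qed
    qed
    then show False using z conn_in(2)[of \<omega> "H n \<inter> D" v z] by (simp add: A_def)
  qed
qed

text \<open>A site at distance at least \<open>\<rho>\<close> from \<open>v\<close>, with
  \<open>\<rho>\<close> at least twice |v - z|, is comparably far from \<open>z\<close>. Both
  factors then decay alike, and the squares are summed over the exterior of a cube.\<close>

lemma tail_sum:
  fixes v z :: "'d site"
  assumes \<rho>: "2 * nrm (v - z) \<le> \<rho>" and B: "finite B" "\<And>w. w \<in> B \<Longrightarrow> \<rho> \<le> nrm (w - v)"
  shows "(\<Sum>w\<in>B. C / wgt (v - w) ^ (e + 5) * (C / wgt (w - z) ^ (e + 5)))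
    \<le> C\<^sup>2 * 2 ^ (e + 5) * (2 * shell_const / (1 + real \<rho>) ^ (e + 3))"
proof -
  let ?f = "\<lambda>w. C / wgt (v - w) ^ (e + 5) * (C / wgt (w - z) ^ (e + 5))"
  have "(\<Sum>w\<in>B. ?f w)
     \<le> (\<Sum>w\<in>B. C\<^sup>2 * 2 ^ (e + 5) * (1 / wgt (w - v) ^ (2 * e + 10)))"
  proof (rule sum_mono)
    fix w assume "w \<in> B"
    then have "\<rho> \<le> nrm (w - v)" using B by simp
    moreover have "nrm (w - v) \<le> nrm (w - z) + nrm (v - z)"
      using nrm_diff_triangle[of w v z] nrm_minus_commute[of z v] by simp
    ultimately have "nrm (w - v) \<le> 2 * nrm (w - z)" using \<rho> by linarith
    then have "wgt (w - v) \<le> 2 * wgt (w - z)" by (simp add: wgt_def)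
    then have *: "wgt (w - v) ^ (e + 5) \<le> 2 ^ (e + 5) * wgt (w - z) ^ (e + 5)"
      unfolding power_mult_distrib[symmetric] using wgt_pos[of "w - v"] by (intro power_mono) auto
    have pos: "0 < wgt (w - v) ^ (e + 5)" "0 < wgt (w - z) ^ (e + 5)" by (simp_all add: wgt_pos)
    have "1 / wgt (w - z) ^ (e + 5) \<le> 2 ^ (e + 5) / wgt (w - v) ^ (e + 5)"
      using * pos by (simp add: divide_simps mult.commute)
    then have "C * (1 / wgt (w - z) ^ (e + 5)) \<le> C * (2 ^ (e + 5) / wgt (w - v) ^ (e + 5))"
      using C_pos by (intro mult_left_mono) auto
    then have "C / wgt (w - z) ^ (e + 5) \<le> C * 2 ^ (e + 5) / wgt (w - v) ^ (e + 5)" by simp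
    then have "?f w
        \<le> C / wgt (w - v) ^ (e + 5) * (C * 2 ^ (e + 5) / wgt (w - v) ^ (e + 5))"
      unfolding wgt_commute[of v w] using C_pos wgt_pos[of "w - v"] by (intro mult_left_mono) auto
    also have "\<dots> = C\<^sup>2 * 2 ^ (e + 5) * (1 / wgt (w - v) ^ (2 * e + 10))"
      using power_split[of "2 * e + 10" "e + 5" "e + 5" "wgt (w - v)"] by (simp add: power2_eq_square)
    finally show "?f w
        \<le> C\<^sup>2 * 2 ^ (e + 5) * (1 / wgt (w - v) ^ (2 * e + 10))" .
  qed
  also have "\<dots> = C\<^sup>2 * 2 ^ (e + 5) * (\<Sum>w\<in>B. 1 / wgt (w - v) ^ (2 * e + 10))"
    by (rule sum_distrib_left[symmetric])
  also have "\<dots> \<le> C\<^sup>2 * 2 ^ (e + 5) * (2 * shell_const / (1 + real \<rho>) ^ (e + 3))"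
    by (intro mult_left_mono far_sum B) auto
  finally show ?thesis .
qed

text \<open>For the Harnack-type estimate: the reflected point \<open>z\<close> just below the
  half-space is connected to \<open>v\<close> with polynomially small probability, and most of the time
  within a cube of radius quadratic in the height of \<open>v\<close>; the connection leaves the half-space
  through its boundary layer.\<close>

definition harnack_radius :: nat where
  "harnack_radius = nat \<lceil>4 * (2 ^ (2 * e + 11) * C\<^sup>2 * shell_const) / c\<rceil> + 2"

text \<open>A quarter of the lower bound for reaching the reflected point, divided by the number of
  candidate exit sites, with the powers of the height taken out.\<close>

definition harnack_const :: real where
  "harnack_const = c / 4 / 2 ^ (e + 5) / (3 * real harnack_radius) ^ (e + 7)"

lemma harnack_const_pos: "0 < harnack_const"
  using c_pos by (simp add: harnack_const_def harnack_radius_def)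

text \<open>A radius quadratic in the height suffices because 2(d-4) is at least d-2: the tail then
  decays at least as fast as the two-point function. The factor \<open>harnack_radius\<close>
  absorbs the constants.\<close>

lemma harnack_tail:
  "C\<^sup>2 * 2 ^ (e + 5) * (2 * shell_const / (1 + real (harnack_radius * (m + 1)\<^sup>2)) ^ (e + 3))
    \<le> c / 4 / (2 + real m) ^ (e + 5)"
proof -
  define R where "R = real harnack_radius"
  define s where "s = 1 + real m"
  have s1: "1 \<le> s" by (simp add: s_def)
  have "4 * (2 ^ (2 * e + 11) * C\<^sup>2 * shell_const) / c \<le> R"
    unfolding R_def harnack_radius_def by (simp add: of_nat_nat le_ceiling_iff[symmetric]) linarith
  then have R: "4 * (2 ^ (2 * e + 11) * C\<^sup>2 * shell_const) \<le> R * c"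
    using c_pos by (simp add: divide_simps)
  have R1: "1 \<le> R" by (simp add: R_def harnack_radius_def)
  have "R * s ^ (e + 5) \<le> (1 + R * s\<^sup>2) ^ (e + 3)"
  proof -
    have "R * s ^ (e + 5) \<le> R ^ (e + 3) * s ^ (2 * (e + 3))"
      using R1 s1 self_le_power[OF R1, of "e + 3"] by (intro mult_mono power_increasing) auto
    also have "\<dots> = (R * s\<^sup>2) ^ (e + 3)" by (simp only: power_mult_distrib power_mult)
    also have "\<dots> \<le> (1 + R * s\<^sup>2) ^ (e + 3)" using R1 by (intro power_mono) auto
    finally show ?thesis .
  qed
  then have A: "1 / (1 + R * s\<^sup>2) ^ (e + 3) \<le> 1 / (R * s ^ (e + 5))"
    using R1 s1 by (intro divide_left_mono mult_pos_pos) (auto intro!: zero_less_power add_pos_nonneg)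
  have "C\<^sup>2 * 2 ^ (e + 5) * (2 * shell_const / (1 + R * s\<^sup>2) ^ (e + 3))
      = C\<^sup>2 * 2 ^ (e + 5) * (2 * shell_const) * (1 / (1 + R * s\<^sup>2) ^ (e + 3))" by simp
  also have "\<dots> \<le> C\<^sup>2 * 2 ^ (e + 5) * (2 * shell_const) * (1 / (R * s ^ (e + 5)))"
    using shell_const_ge_1 by (intro mult_left_mono A) auto
  also have "\<dots> \<le> c / 4 / (2 * s) ^ (e + 5)"
  proof -
    have "2 ^ (2 * e + 11) = 2 ^ (e + 5) * (2 * 2 ^ (e + 5) :: real)"
      using power_split[of "2 * e + 11" "e + 5" "e + 6" 2] power_split[of "e + 6" 1 "e + 5" 2] by simp
    then have "4 * (C\<^sup>2 * 2 ^ (e + 5) * (2 * shell_const)) * 2 ^ (e + 5) \<le> R * c"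
      using R by (simp only: mult_ac)
    then show ?thesis using R1 s1 by (simp add: power_mult_distrib divide_simps mult_ac)
  qed
  also have "\<dots> \<le> c / 4 / (2 + real m) ^ (e + 5)"
    using c_pos by (intro divide_left_mono power_mono mult_pos_pos) (auto simp: s_def)
  finally show ?thesis unfolding R_def s_def by (simp add: add.commute)
qed

lemma harnack:
  assumes v: "v \<in> H n" and m: "v $ h + int n = int m"
  shows "\<exists>x\<in>bd n. nrm (x - v) \<le> harnack_radius * (m + 1)\<^sup>2 \<and>
    harnack_const / (1 + real m) ^ (3 * e + 19) \<le> two_point E p (H n) v x"
proof (rule ccontr)
  let ?h = "harnack_const / (1 + real m) ^ (3 * e + 19)"
  assume neg: "\<not> ?thesis"
  define z where "z = v - of_nat (m + 1) *s dir"
  define \<rho> where "\<rho> = harnack_radius * (m + 1)\<^sup>2"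
  define W where "W = {w. \<rho> \<le> nrm (w - v)}"
  have vz: "nrm (v - z) = m + 1" using nrm_dir[of "m + 1"] by (simp add: z_def)
  have zH: "z \<notin> H n" using m by (simp add: z_def half_space_def dir_nth)
  have \<rho>2: "2 * nrm (v - z) \<le> \<rho>"
    unfolding vz \<rho>_def
  proof (rule mult_le_mono)
    show "2 \<le> harnack_radius" by (simp add: harnack_radius_def)
    show "m + 1 \<le> (m + 1)\<^sup>2" by (simp add: power2_eq_square)
  qed
  \<comment> \<open>Budget for the lower bound \<open>q\<close>: half of it survives in a finite
    box, a quarter is lost to paths leaving the cube, and the remaining quarter has to pass through
    the boundary layer.\<close>
  define q where "q = c / (2 + real m) ^ (e + 5)"
  have q4: "c / 4 / (2 + real m) ^ (e + 5) = q / 4" by (simp add: q_def)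
  have lowvz: "q \<le> two_point E p UNIV v z"
    using lower[of v z] by (simp add: wgt_def vz add.commute q_def)
  have q0: "0 < q" using c_pos by (simp add: q_def)
  have "\<forall>\<^sub>F N in sequentially. q / 2 < two_point E p (UNIV \<inter> box N) v z"
    by (rule order_tendstoD[OF two_point_lim]) (use lowvz q0 in linarith)
  then obtain N where N: "q / 2 < two_point E p (UNIV \<inter> box N) v z"
    using eventually_happens'[OF sequentially_bot] by blast
  define D where "D = box N - W"
  have D: "D \<subseteq> box N" by (auto simp: D_def)
  have finD: "finite D" by (simp add: D_def)
  have "fp.tau N (box N) v z \<le> fp.tau N D v z + (\<Sum>w\<in>W \<inter> box N. fp.tau N (box N) v w * fp.tau N (box N) w z)"
    unfolding D_def by (intro fp.tau_remove) simp
  also have "(\<Sum>w\<in>W \<inter> box N. fp.tau N (box N) v w * fp.tau N (box N) w z)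
      \<le> (\<Sum>w\<in>W \<inter> box N. C / wgt (v - w) ^ (e + 5) * (C / wgt (w - z) ^ (e + 5)))"
    using C_pos wgt_pos by (intro sum_mono mult_mono tau_upper fp.tau_nonneg) (auto simp: less_imp_le)
  also have "\<dots> \<le> C\<^sup>2 * 2 ^ (e + 5) * (2 * shell_const / (1 + real \<rho>) ^ (e + 3))"
    by (intro tail_sum \<rho>2) (auto simp: W_def)
  also have "\<dots> \<le> q / 4"
    unfolding \<rho>_def q4[symmetric] by (rule harnack_tail)
  finally have "q / 2 - q / 4 < fp.tau N D v z"
    using N tau_two_point[of "box N" N v z] by simp
  then have big: "q / 4 < fp.tau N D v z" by simp
  have "fp.tau N D v z \<le> (\<Sum>x\<in>bd n \<inter> D. fp.tau N (H n \<inter> box N) v x)"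
    by (rule exit_sum[OF D v zH])
  also have "\<dots> \<le> (\<Sum>x\<in>bd n \<inter> D. ?h)"
  proof (rule sum_mono)
    fix x assume x: "x \<in> bd n \<inter> D"
    then have "nrm (x - v) \<le> \<rho>" by (auto simp: D_def W_def)
    then have "two_point E p (H n) v x < ?h"
      using neg x unfolding \<rho>_def by auto
    then show "fp.tau N (H n \<inter> box N) v x \<le> ?h"
      using two_point_le[of "H n" N v x] tau_two_point[of "H n \<inter> box N" N v x] by simp
  qed
  also have "\<dots> = real (card (bd n \<inter> D)) * (?h)" by simp
  also have "\<dots> \<le> (3 * real harnack_radius * (1 + real m)\<^sup>2) ^ (e + 7) * (?h)"
  proof (intro mult_right_mono)
    have "bd n \<inter> D \<subseteq> cube v \<rho>" by (auto simp: D_def W_def cube_def)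
    then have "card (bd n \<inter> D) \<le> card (cube v \<rho>)" by (intro card_mono) auto
    then have "real (card (bd n \<inter> D)) \<le> real ((2 * \<rho> + 1) ^ (e + 7))"
      by (simp add: card_cube dim del: of_nat_power)
    also have "\<dots> \<le> (3 * real harnack_radius * (1 + real m)\<^sup>2) ^ (e + 7)"
      unfolding of_nat_power
    proof (intro power_mono)
      have "0 < harnack_radius" by (simp add: harnack_radius_def)
      then have "0 < \<rho>" by (simp add: \<rho>_def)
      then have "real (2 * \<rho> + 1) \<le> 3 * real \<rho>" by simp
      then show "real (2 * \<rho> + 1) \<le> 3 * real harnack_radius * (1 + real m)\<^sup>2"
        by (simp add: \<rho>_def add.commute)
    qed simp
    finally show "real (card (bd n \<inter> D)) \<le> (3 * real harnack_radius * (1 + real m)\<^sup>2) ^ (e + 7)" .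
  qed (use harnack_const_pos in simp)
  also have "\<dots> = c / 4 / (2 * (1 + real m)) ^ (e + 5)"
  proof -
    \<comment> \<open>The exponent collects 2d from the volume of a cube of quadratic radius and d -
      2 from the two-point bound.\<close>
    have "(1 + real m) ^ (3 * e + 19) = ((1 + real m)\<^sup>2) ^ (e + 7) * (1 + real m) ^ (e + 5)"
      unfolding power_mult[symmetric] by (rule power_split) simp
    moreover have "0 < real harnack_radius" by (simp add: harnack_radius_def)
    moreover have "0 < 1 + real m" by simp
    ultimately show ?thesis
      unfolding harnack_const_def power_mult_distrib by simp
  qed
  also have "\<dots> \<le> q / 4"
    unfolding q4[symmetric] using c_pos by (intro divide_left_mono power_mono mult_pos_pos) auto
  finally show False using big by linarith
qed


section \<open>Boundary mass and its control of the bulk mass\<close>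

definition bsum :: "nat \<Rightarrow> nat \<Rightarrow> real" where
  "bsum n R = (\<Sum>x\<in>bd n \<inter> box R. two_point E p (H n) 0 x)"

lemma bsum_nonneg: "0 \<le> bsum n R"
  unfolding bsum_def by (intro sum_nonneg two_point_nonneg)

lemma bsum_mono: "R \<le> R' \<Longrightarrow> bsum n R \<le> bsum n R'"
  unfolding bsum_def using cube_mono[of R R' 0] by (intro sum_mono2 two_point_nonneg) auto

lemma bsum_crude: "bsum n R \<le> (2 * real R + 1) ^ (e + 7)"
proof -
  have "bsum n R \<le> (\<Sum>x\<in>bd n \<inter> box R. 1)"
    unfolding bsum_def by (intro sum_mono two_point_le_1)
  also have "\<dots> \<le> real (card (box R))" by (simp add: card_mono)
  also have "\<dots> = (2 * real R + 1) ^ (e + 7)" by (simp add: card_cube dim add.commute)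
  finally show ?thesis .
qed

definition bulk_radius :: nat where
  "bulk_radius = L + 3 + harnack_radius"

definition bulk_const :: real where
  "bulk_const = (6 * real harnack_radius * (real L + 3)) ^ (e + 7) / harnack_const"

lemma bulk_const_pos: "0 < bulk_const"
  using harnack_const_pos by (simp add: bulk_const_def harnack_radius_def)

text \<open>As \<open>y x\<close> lies at or below the bottom, a site \<open>v\<close> of the cube
  has height at most \<open>r\<close> above it. \<open>harnack\<close> and Harris trade the mass at
  \<open>v\<close> for that at a boundary site \<open>xh v\<close>, and each boundary site serves
  only polynomially many pairs \<open>(x, v)\<close>.\<close>

lemma bulk_sum:
  fixes y :: "'d site \<Rightarrow> 'd site"
  assumes X: "X \<subseteq> bd n \<inter> box R" and s: "\<And>x. x \<in> X \<Longrightarrow> nrm (y x - x) \<le> s" "s \<le> (L + 2) * (1 + r)"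
    and y: "\<And>x. x \<in> X \<Longrightarrow> y x $ h \<le> - int n"
  shows "(\<Sum>x\<in>X. \<Sum>v\<in>cube (y x) r \<inter> H n. two_point E p (H n) 0 v)
    \<le> bulk_const * (1 + real r) ^ (6 * e + 40) * bsum n (R + bulk_radius * (1 + r)\<^sup>2)"
proof -
  let ?F = "(6 * real harnack_radius * (real L + 3) * (1 + real r) ^ 3) ^ (e + 7)"
  define t where "t = two_point E p (H n) 0"
  define \<rho> where "\<rho> = harnack_radius * (1 + r)\<^sup>2"
  define G where "G = (1 + real r) ^ (3 * e + 19) / harnack_const"
  define R' where "R' = R + bulk_radius * (1 + r)\<^sup>2"
  define T where "T = bd n \<inter> box R'"
  define I where "I = Sigma X (\<lambda>x. cube (y x) r \<inter> H n)"
  have finX: "finite X" using X finite_cube finite_subset by blast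
  have "(L + 3) * (1 + r) = (L + 2) * (1 + r) + (1 + r)" by (simp add: distrib_right)
  with s(2) have sr: "s + r + 1 \<le> (L + 3) * (1 + r)" by linarith
  have finI: "finite I" unfolding I_def using finX by auto
  have G0: "0 < G" using harnack_const_pos by (simp add: G_def)
  have t0: "0 \<le> t v" for v by (simp add: t_def two_point_nonneg)
  have "\<exists>x. x \<in> bd n \<and> nrm (x - v) \<le> \<rho> \<and> t v \<le> G * t x" if v: "v \<in> H n" "v $ h + int n \<le> int r" for v
  proof -
    define m where "m = nat (v $ h + int n)"
    have m: "v $ h + int n = int m" "m \<le> r" using v by (auto simp: m_def half_space_def)
    obtain x where x: "x \<in> bd n" "nrm (x - v) \<le> harnack_radius * (m + 1)\<^sup>2"
      "harnack_const / (1 + real m) ^ (3 * e + 19) \<le> two_point E p (H n) v x"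
      using harnack[OF v(1) m(1)] by blast
    have le\<rho>: "harnack_radius * (m + 1)\<^sup>2 \<le> \<rho>"
      unfolding \<rho>_def using m(2) by (intro mult_le_mono2 power_mono) auto
    have "1 / G \<le> harnack_const / (1 + real m) ^ (3 * e + 19)"
      unfolding G_def using harnack_const_pos m(2)
      by (simp add: divide_left_mono power_mono mult_pos_pos add_pos_nonneg)
    then have "1 / G \<le> two_point E p (H n) v x" using x(3) by linarith
    then have "t v * (1 / G) \<le> t v * two_point E p (H n) v x" by (intro mult_left_mono t0)
    also have "\<dots> \<le> t x" unfolding t_def by (rule two_point_harris)
    finally have "t v \<le> G * t x" using G0 by (simp add: divide_simps mult.commute)
    then show ?thesis using x le\<rho> by (meson order_trans)
  qed
  then obtain xh where xh: "\<And>v. v \<in> H n \<Longrightarrow> v $ h + int n \<le> int r \<Longrightarrow>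
      xh v \<in> bd n \<and> nrm (xh v - v) \<le> \<rho> \<and> t v \<le> G * t (xh v)" by metis
  have I: "xh v \<in> bd n" "nrm (xh v - v) \<le> \<rho>" "t v \<le> G * t (xh v)" "xh v \<in> T" "nrm (x - v) \<le> s + r"
    if xv: "(x, v) \<in> I" for x v
  proof -
    have x: "x \<in> X" and v: "v \<in> H n" "nrm (v - y x) \<le> r" using xv by (auto simp: I_def cube_def)
    have "\<bar>(v - y x) $ h\<bar> \<le> int r" using v(2) nrm_component[of "v - y x" h] by linarith
    then have "v $ h + int n \<le> int r" using y[OF x] by simp
    then show 1: "xh v \<in> bd n" "nrm (xh v - v) \<le> \<rho>" "t v \<le> G * t (xh v)" using xh[OF v(1)] by auto
    show 2: "nrm (x - v) \<le> s + r"
      using nrm_diff_triangle[of x v "y x"] s(1)[OF x] v(2) nrm_minus_commute[of x "y x"]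
        nrm_minus_commute[of v "y x"] by linarith
    have "nrm (xh v) \<le> nrm (xh v - v) + nrm (v - x) + nrm x"
      using nrm_triangle[of "xh v - v" v] nrm_triangle[of "v - x" x] by simp
    also have "\<dots> \<le> \<rho> + (s + r) + R"
      using 1 2 x X nrm_minus_commute[of x v] by (intro add_mono) (auto simp: cube_def)
    also have "s + r \<le> (L + 3) * (1 + r)\<^sup>2"
    proof -
      have "s + r \<le> (L + 3) * (1 + r)" using sr by linarith
      also have "\<dots> \<le> (L + 3) * (1 + r)\<^sup>2" by (intro mult_le_mono2) (simp add: power2_eq_square)
      finally show ?thesis .
    qed
    finally have "nrm (xh v) \<le> R'" unfolding R'_def \<rho>_def bulk_radius_def by (simp add: distrib_right)
    then show "xh v \<in> T" using 1 by (simp add: T_def cube_def)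
  qed
  have "(\<Sum>x\<in>X. \<Sum>v\<in>cube (y x) r \<inter> H n. t v) = (\<Sum>(x, v)\<in>I. t v)"
    unfolding I_def using finX by (subst sum.Sigma) auto
  also have "\<dots> \<le> (\<Sum>(x, v)\<in>I. G * t (xh v))"
    by (rule sum_mono) (use I(3) in auto)
  also have "\<dots> = (\<Sum>u\<in>T. \<Sum>(x, v)\<in>{(x, v) \<in> I. xh v = u}. G * t (xh v))"
  proof -
    have "(\<Sum>u\<in>T. \<Sum>xv\<in>{xv \<in> I. xh (snd xv) = u}. G * t (xh (snd xv))) = (\<Sum>xv\<in>I. G * t (xh (snd xv)))"
      using finI I(4) by (intro sum.group) (auto simp: T_def)
    then show ?thesis by (simp add: case_prod_unfold)
  qed
  also have "\<dots> = (\<Sum>u\<in>T. real (card {(x, v) \<in> I. xh v = u}) * (G * t u))"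
  proof (intro sum.cong refl)
    fix u :: "'d site"
    have "(\<Sum>(x, v)\<in>{(x, v) \<in> I. xh v = u}. G * t (xh v)) = (\<Sum>xv\<in>{(x, v) \<in> I. xh v = u}. G * t u)"
      by (intro sum.cong) auto
    then show "(\<Sum>(x, v)\<in>{(x, v) \<in> I. xh v = u}. G * t (xh v)) = real (card {(x, v) \<in> I. xh v = u}) * (G * t u)"
      by simp
  qed
  also have "\<dots> \<le> (\<Sum>u\<in>T. ?F * (G * t u))"
  proof (intro sum_mono mult_right_mono mult_nonneg_nonneg t0)
    fix u :: "'d site"
    let ?J = "Sigma (cube u \<rho>) (\<lambda>v. cube v (s + r))"
    have "card {(x, v) \<in> I. xh v = u} = card (prod.swap ` {(x, v) \<in> I. xh v = u})"
      by (rule card_image[symmetric]) simp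
    also have "\<dots> \<le> card ?J"
    proof (rule card_mono)
      show "finite ?J" by auto
      show "prod.swap ` {(x, v) \<in> I. xh v = u} \<subseteq> ?J"
      proof
        fix vx assume "vx \<in> prod.swap ` {(x, v) \<in> I. xh v = u}"
        then obtain x v where *: "vx = (v, x)" "(x, v) \<in> I" "xh v = u" by auto
        then show "vx \<in> ?J"
          using I(2)[OF *(2)] I(5)[OF *(2)] nrm_minus_commute[of u v] by (simp add: cube_def)
      qed
    qed
    also have "\<dots> = (2 * \<rho> + 1) ^ (e + 7) * (2 * (s + r) + 1) ^ (e + 7)"
      by (simp add: card_SigmaI card_cube dim)
    also have "\<dots> = ((2 * \<rho> + 1) * (2 * (s + r) + 1)) ^ (e + 7)" by (rule power_mult_distrib[symmetric])
    also have "\<dots> \<le> ((3 * (harnack_radius * (1 + r)\<^sup>2)) * (2 * (L + 3) * (1 + r))) ^ (e + 7)"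
    proof (intro power_mono mult_le_mono)
      have "0 < harnack_radius" by (simp add: harnack_radius_def)
      then have "0 < \<rho>" by (simp add: \<rho>_def)
      then show "2 * \<rho> + 1 \<le> 3 * (harnack_radius * (1 + r)\<^sup>2)" unfolding \<rho>_def[symmetric] by simp
      have "2 * (s + r) + 1 \<le> 2 * (s + r + 1)" by simp
      also have "\<dots> \<le> 2 * ((L + 3) * (1 + r))" by (rule mult_le_mono2[OF sr])
      finally have "2 * (s + r) + 1 \<le> 2 * ((L + 3) * (1 + r))" .
      then show "2 * (s + r) + 1 \<le> 2 * (L + 3) * (1 + r)" by (simp only: mult.assoc)
    qed simp
    finally have "real (card {(x, v) \<in> I. xh v = u})
        \<le> real (((3 * (harnack_radius * (1 + r)\<^sup>2)) * (2 * (L + 3) * (1 + r))) ^ (e + 7))"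
      by (simp only: of_nat_le_iff)
    also have "\<dots> = ?F"
    proof -
      have "real ((3 * (harnack_radius * (1 + r)\<^sup>2)) * (2 * (L + 3) * (1 + r)))
          = 6 * real harnack_radius * (real L + 3) * (1 + real r) ^ 3"
        by (simp add: power3_eq_cube power2_eq_square algebra_simps)
      then show ?thesis by (simp only: of_nat_power)
    qed
    finally show "real (card {(x, v) \<in> I. xh v = u})
        \<le> ?F" .
  qed (use G0 in simp)
  also have "\<dots> = ?F * G * bsum n R'"
    unfolding bsum_def T_def t_def by (simp add: sum_distrib_left mult.assoc)
  also have "?F * G
      = bulk_const * (1 + real r) ^ (6 * e + 40)"
  proof -
    \<comment> \<open>Counting pairs costs 3d powers, two per dimension for \<open>v\<close> near
      the boundary site and one for \<open>x\<close> near \<open>v\<close>; Harnack costs the other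
      \<open>3 * e + 19\<close>.\<close>
    have "(1 + real r) ^ (6 * e + 40) = ((1 + real r) ^ 3) ^ (e + 7) * (1 + real r) ^ (3 * e + 19)"
      unfolding power_mult[symmetric] by (rule power_split) simp
    then show ?thesis unfolding G_def bulk_const_def power_mult_distrib[of _ "(1 + real r) ^ 3"] by simp
  qed
  finally show ?thesis unfolding t_def R'_def .
qed

section \<open>The error term, scale by scale\<close>

lemma scale_decomposition:
  assumes "4 ^ k0 < nrm (v - y)" "nrm (v - y) \<le> 4 ^ k1"
  shows "1 / wgt (v - y) ^ (e + 3)
    \<le> (\<Sum>j\<in>{k0<..k1}. 4 ^ (e + 3) / 4 ^ (j * (e + 3)) * of_bool (v \<in> cube y (4 ^ j)))"
proof -
  \<comment> \<open>The first scale whose cube contains \<open>v\<close>: the distance exceeds the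
    previous radius, and \<open>4 ^ (e + 3)\<close> makes up for the ratio. Radii are powers of 4 so
    that r^(5/2) becomes \<open>32 ^ j\<close>.\<close>
  define j where "j = (LEAST j. nrm (v - y) \<le> 4 ^ j)"
  have j: "nrm (v - y) \<le> 4 ^ j" unfolding j_def using assms(2) by (rule LeastI)
  have jk1: "j \<le> k1" unfolding j_def using assms(2) by (rule Least_le)
  have "k0 < j"
  proof (rule ccontr)
    assume "\<not> k0 < j"
    then have "(4::nat) ^ j \<le> 4 ^ k0" by (intro power_increasing) auto
    then show False using j assms(1) by linarith
  qed
  then obtain i where i: "j = Suc i" using gr0_conv_Suc by (metis not_less_zero zero_less_iff_neq_zero)
  have "\<not> nrm (v - y) \<le> 4 ^ i" using not_less_Least[of i "\<lambda>j. nrm (v - y) \<le> 4 ^ j"] i unfolding j_def by simp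
  then have "4 ^ i \<le> wgt (v - y)" unfolding wgt_def
    by (metis add_increasing linear numeral_power_le_of_nat_cancel_iff zero_le_one)
  then have "(4 ^ i) ^ (e + 3) \<le> wgt (v - y) ^ (e + 3)" by (intro power_mono) auto
  moreover have "4 ^ (e + 3) * (4 ^ i) ^ (e + 3) = (4 ^ (j * (e + 3)) :: real)"
    unfolding i power_mult by (simp add: power_mult_distrib)
  ultimately have "4 ^ (j * (e + 3)) \<le> 4 ^ (e + 3) * wgt (v - y) ^ (e + 3)"
    by (metis mult_left_mono zero_le_numeral zero_le_power)
  then have "1 / wgt (v - y) ^ (e + 3) \<le> 4 ^ (e + 3) / 4 ^ (j * (e + 3))"
    using wgt_pos[of "v - y"] by (simp add: divide_simps mult.commute)
  also have "\<dots> = 4 ^ (e + 3) / 4 ^ (j * (e + 3)) * of_bool (v \<in> cube y (4 ^ j))"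
    using j by (simp add: cube_def)
  also have "\<dots> \<le> (\<Sum>j\<in>{k0<..k1}. 4 ^ (e + 3) / 4 ^ (j * (e + 3)) * of_bool (v \<in> cube y (4 ^ j)))"
    using \<open>k0 < j\<close> jk1 by (intro member_le_sum) auto
  finally show ?thesis .
qed

definition visit_const :: real where
  "visit_const = 4 * C * cube_const"

lemma cube_const_pos: "0 < cube_const"
  using shell_const_ge_1 by (simp add: cube_const_def add_pos_pos)

lemma one_plus_scale: "1 + (4::real) ^ j \<le> 2 * 4 ^ j"
  using one_le_power[of "4::real" j] by simp

lemma tau_cube_sum:
  assumes "A \<subseteq> box N" "B \<subseteq> cube y r"
  shows "(\<Sum>u\<in>B. fp.tau N A v u) \<le> C * cube_const * (1 + real r)\<^sup>2"
proof -
  have "(\<Sum>u\<in>B. fp.tau N A v u) \<le> (\<Sum>u\<in>B. C * (1 / wgt (u - v) ^ (e + 5)))"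
    using tau_upper[OF assms(1), of v] wgt_commute[of v] by (intro sum_mono) simp
  also have "\<dots> = C * (\<Sum>u\<in>B. 1 / wgt (u - v) ^ (e + 5))" by (rule sum_distrib_left[symmetric])
  also have "\<dots> \<le> C * (cube_const * (1 + real r)\<^sup>2)"
    using C_pos cube_sum[OF assms(2)] by (intro mult_left_mono) auto
  finally show ?thesis by simp
qed

text \<open>The choice \<open>l = 32 ^ j\<close> lies between the typical number \<open>16 ^ j\<close> of visits of the path to a
  cube of radius \<open>4 ^ j\<close> and the value \<open>64 ^ j\<close> at which the error sum over scales would diverge.\<close>

lemma visits_scale:
  assumes S: "S \<subseteq> box N"
  shows "(\<Sum>xs\<in>fp.paths S 0 x. fp.wt N S 0 x xs * real (card (set xs \<inter> cube y (4 ^ j))))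
    \<le> real (Suc q) * 32 ^ j * fp.tau N S 0 x
      + real (Suc q) * visit_const ^ q / 2 ^ (j * q) * (\<Sum>u\<in>cube y (4 ^ j) \<inter> S. fp.tau N S 0 u)"
proof -
  define B where "B = cube y (4 ^ j) \<inter> S"
  have "(\<Sum>u\<in>B. fp.tau N S v u) \<le> visit_const * 16 ^ j" for v
  proof -
    have "(\<Sum>u\<in>B. fp.tau N S v u) \<le> C * cube_const * (1 + real (4 ^ j))\<^sup>2"
      by (rule tau_cube_sum[OF S]) (auto simp: B_def)
    also have "\<dots> \<le> C * cube_const * (2 * 4 ^ j)\<^sup>2"
      using C_pos cube_const_pos one_plus_scale[of j] by (intro mult_left_mono power_mono) auto
    also have "\<dots> = visit_const * 16 ^ j"
      by (simp add: visit_const_def power_mult_distrib power2_eq_square[of "4 ^ j"] flip: power_mult_distrib[of 4 4])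
    finally show ?thesis .
  qed
  then have "(\<Sum>xs\<in>fp.paths S 0 x. fp.wt N S 0 x xs * real (card (set xs \<inter> B)))
      \<le> real (Suc q) * 32 ^ j * fp.tau N S 0 x
        + real (Suc q) * 32 ^ j / (32 ^ j) ^ Suc q * ((visit_const * 16 ^ j) ^ q * (\<Sum>u\<in>B. fp.tau N S 0 u))"
    using S by (intro fp.visits_bound) (auto simp: B_def)
  also have "real (Suc q) * 32 ^ j / (32 ^ j) ^ Suc q * ((visit_const * 16 ^ j) ^ q * (\<Sum>u\<in>B. fp.tau N S 0 u))
      = real (Suc q) * visit_const ^ q / 2 ^ (j * q) * (\<Sum>u\<in>B. fp.tau N S 0 u)"
  proof -
    \<comment> \<open>The threshold exceeds the typical number of visits by \<open>2 ^ j\<close>, so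
      a moment of order \<open>q\<close> gains \<open>2 ^ (j * q)\<close>, enough to absorb any
      fixed power of the radius.\<close>
    have "(32 ^ j) ^ q = (16 ^ j) ^ q * (2 ^ (j * q) :: real)"
      by (simp add: power_mult flip: power_mult_distrib)
    then show ?thesis by (simp add: power_mult_distrib)
  qed
  also have "(\<Sum>xs\<in>fp.paths S 0 x. fp.wt N S 0 x xs * real (card (set xs \<inter> B)))
      = (\<Sum>xs\<in>fp.paths S 0 x. fp.wt N S 0 x xs * real (card (set xs \<inter> cube y (4 ^ j))))"
  proof (rule sum.cong[OF refl])
    fix xs assume "xs \<in> fp.paths S 0 x"
    then have "set xs \<inter> B = set xs \<inter> cube y (4 ^ j)" by (auto simp: B_def fp.paths_def)
    then show "fp.wt N S 0 x xs * real (card (set xs \<inter> B)) = fp.wt N S 0 x xs * real (card (set xs \<inter> cube y (4 ^ j)))"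
      by simp
  qed
  finally show ?thesis unfolding B_def .
qed

text \<open>If the enlargement is at most \<open>R\<close>, doubling covers it. Otherwise the whole
  radius is of order \<open>16 ^ j\<close> and the trivial bound is polynomial in it. In this way
  only the boundary mass at \<open>2 * R\<close> enters the recursion, whatever the scale.\<close>

lemma bsum_scale:
  "bsum n (R + bulk_radius * (1 + 4 ^ j)\<^sup>2) \<le> (20 * real bulk_radius * 16 ^ j) ^ (e + 7) * (bsum n (2 * R) + 1)"
proof -
  have R1: "1 \<le> bulk_radius" by (simp add: bulk_radius_def)
  have F1: "1 \<le> (20 * real bulk_radius * 16 ^ j) ^ (e + 7)"
  proof (rule one_le_power)
    have "1 * 1 \<le> (20 * real bulk_radius) * 16 ^ j" using R1 by (intro mult_mono one_le_power) auto
    then show "1 \<le> 20 * real bulk_radius * 16 ^ j" by simp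
  qed
  show ?thesis
  proof (cases "bulk_radius * (1 + 4 ^ j)\<^sup>2 \<le> R")
    case True
    then have "bsum n (R + bulk_radius * (1 + 4 ^ j)\<^sup>2) \<le> bsum n (2 * R)" by (intro bsum_mono) simp
    also have "\<dots> \<le> 1 * (bsum n (2 * R) + 1)" by simp
    also have "\<dots> \<le> (20 * real bulk_radius * 16 ^ j) ^ (e + 7) * (bsum n (2 * R) + 1)"
      using F1 bsum_nonneg[of n "2 * R"] by (intro mult_right_mono) auto
    finally show ?thesis .
  next
    case False
    let ?R = "R + bulk_radius * (1 + 4 ^ j)\<^sup>2"
    define b where "b = bulk_radius * (1 + 4 ^ j)\<^sup>2"
    have "R < b" using False unfolding b_def by simp
    then have "2 * (R + b) + 1 \<le> 5 * b" by arith
    then have "2 * ?R + 1 \<le> 5 * (bulk_radius * (1 + 4 ^ j)\<^sup>2)" unfolding b_def .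
    then have "real (2 * ?R + 1) \<le> real (5 * (bulk_radius * (1 + 4 ^ j)\<^sup>2))" by (simp only: of_nat_le_iff)
    then have "2 * real ?R + 1 \<le> 5 * (real bulk_radius * (1 + 4 ^ j)\<^sup>2)" by simp
    also have "\<dots> \<le> 5 * (real bulk_radius * (2 * 4 ^ j)\<^sup>2)"
      using one_plus_scale[of j] by (intro mult_left_mono power_mono) auto
    also have "\<dots> = 20 * real bulk_radius * 16 ^ j"
      by (simp add: power_mult_distrib power2_eq_square[of "4 ^ j"] flip: power_mult_distrib[of 4 4])
    finally have *: "2 * real ?R + 1 \<le> 20 * real bulk_radius * 16 ^ j" .
    have "bsum n ?R \<le> (2 * real ?R + 1) ^ (e + 7)" by (rule bsum_crude)
    also have "\<dots> \<le> (20 * real bulk_radius * 16 ^ j) ^ (e + 7) * 1"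
      using * by (simp only: mult_1_right) (intro power_mono, auto)
    also have "\<dots> \<le> (20 * real bulk_radius * 16 ^ j) ^ (e + 7) * (bsum n (2 * R) + 1)"
      using F1 bsum_nonneg[of n "2 * R"] by (intro mult_left_mono) auto
    finally show ?thesis .
  qed
qed


text \<open>Chosen so that \<open>2 ^ (j * moment)\<close> cancels
  \<open>(4 ^ j) ^ (6 * e + 40)\<close> from \<open>bulk_sum\<close> and
  \<open>(16 ^ j) ^ (e + 7)\<close> from \<open>bsum_scale\<close>, with a factor
  \<open>2 ^ j\<close> to spare for the sum over scales.\<close>

definition moment :: nat where
  "moment = 2 * (6 * e + 40) + 4 * (e + 7) + 1"

definition bulk_factor :: real where
  "bulk_factor = visit_const ^ moment * (bulk_const * 2 ^ (6 * e + 40) * (20 * real bulk_radius) ^ (e + 7))"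

definition err_const :: real where
  "err_const = 4 ^ (e + 3) * real (Suc moment) * (1 + bulk_factor)"

lemma visit_const_pos: "0 < visit_const"
  using C_pos cube_const_pos by (simp add: visit_const_def)

lemma bulk_factor_nonneg: "0 \<le> bulk_factor"
  using visit_const_pos bulk_const_pos by (simp add: bulk_factor_def less_imp_le)

lemma err_const_nonneg: "0 \<le> err_const"
  using bulk_factor_nonneg by (simp add: err_const_def)

text \<open>Here d > 6 is decisive: r^(d-4) is at least r^3, that is \<open>64 ^ j\<close>, against
  \<open>32 ^ j\<close> visits.\<close>

lemma scale_first: "32 ^ j / 4 ^ (j * (e + 3)) \<le> (1 / 2 ^ j :: real)"
proof -
  have "(4::real) ^ (j * 3) = (4 ^ 3) ^ j" by (simp only: power_mult[symmetric] mult.commute)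
  then have "(32::real) ^ j * 2 ^ j = 4 ^ (j * 3)" by (simp flip: power_mult_distrib)
  also have "\<dots> \<le> 4 ^ (j * (e + 3))" by (intro power_increasing mult_le_mono2) auto
  finally show ?thesis by (simp add: divide_simps)
qed

lemma scale_second:
  "(1 + 4 ^ j) ^ (6 * e + 40) * (16 ^ j) ^ (e + 7) / 2 ^ (j * moment) \<le> (2 ^ (6 * e + 40) / 2 ^ j :: real)"
proof -
  have "(1 + 4 ^ j :: real) ^ (6 * e + 40) \<le> (2 * 4 ^ j) ^ (6 * e + 40)"
    using one_plus_scale[of j] by (intro power_mono) auto
  also have "\<dots> = 2 ^ (6 * e + 40) * (4 ^ j) ^ (6 * e + 40)" by (rule power_mult_distrib)
  finally have 1: "(1 + 4 ^ j :: real) ^ (6 * e + 40) \<le> 2 ^ (6 * e + 40) * (4 ^ j) ^ (6 * e + 40)" .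
  have 4: "(4::real) ^ j = 2 ^ (2 * j)" by (simp add: power_mult)
  have 16: "(16::real) ^ j = 2 ^ (4 * j)" by (simp add: power_mult)
  have "(4 ^ j) ^ (6 * e + 40) * (16 ^ j) ^ (e + 7) * 2 ^ j = (2 ^ (2 * j * (6 * e + 40) + 4 * j * (e + 7) + j) :: real)"
    unfolding 4 16 power_mult[symmetric] power_add[of 2 "2 * j * (6 * e + 40) + 4 * j * (e + 7)" j]
      power_add[of 2 "2 * j * (6 * e + 40)" "4 * j * (e + 7)"] ..
  also have "2 * j * (6 * e + 40) + 4 * j * (e + 7) + j = j * moment"
    by (simp add: moment_def algebra_simps)
  finally have 2: "(4 ^ j) ^ (6 * e + 40) * (16 ^ j) ^ (e + 7) * 2 ^ j = (2 ^ (j * moment) :: real)" .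
  have "(1 + 4 ^ j) ^ (6 * e + 40) * (16 ^ j) ^ (e + 7) * 2 ^ j
      \<le> 2 ^ (6 * e + 40) * (4 ^ j) ^ (6 * e + 40) * (16 ^ j) ^ (e + 7) * (2 ^ j :: real)"
    by (intro mult_right_mono 1) auto
  also have "\<dots> = 2 ^ (6 * e + 40) * 2 ^ (j * moment)"
    using 2 by (simp only: mult.assoc)
  finally show ?thesis by (simp add: divide_simps)
qed

text \<open>At each scale \<open>visits_scale\<close> charges the typical number of visits to the
  mass at \<open>x\<close>, hence to the boundary sum, and the excess to the bulk mass of a cube.
  Since \<open>y x\<close> is more than \<open>4 ^ k0\<close> below the half-space, only scales
  above \<open>k0\<close> occur, and their geometric sum gives \<open>1 / 2 ^ k0\<close>.\<close>

lemma error_sum: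
  fixes y :: "'d site \<Rightarrow> 'd site"
  assumes S: "S = H n \<inter> box N" and X: "X \<subseteq> bd n \<inter> box R"
    and y: "\<And>x. x \<in> X \<Longrightarrow> nrm (y x - x) \<le> L + 4 ^ k0" "\<And>x. x \<in> X \<Longrightarrow> y x $ h + 4 ^ k0 < - int n"
  shows "(\<Sum>x\<in>X. \<Sum>xs\<in>fp.paths S 0 x. \<Sum>v\<in>set xs. fp.wt N S 0 x xs * (1 / wgt (v - y x) ^ (e + 3)))
    \<le> err_const / 2 ^ k0 * (bsum n (2 * R) + 1)"
proof -
  let ?w = "\<lambda>x xs j. fp.wt N S 0 x xs * real (card (set xs \<inter> cube (y x) (4 ^ j)))"
  let ?V = "\<lambda>x j. \<Sum>xs\<in>fp.paths S 0 x. fp.wt N S 0 x xs * real (card (set xs \<inter> cube (y x) (4 ^ j)))"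
  \<comment> \<open>Large enough that every site of \<open>box N\<close> is within
    \<open>4 ^ k1\<close> of each \<open>y x\<close>; the final bound does not depend on it.\<close>
  define k1 where "k1 = N + R + L + 4 ^ k0"
  define a where "a j = (4 ^ (e + 3) / 4 ^ (j * (e + 3)) :: real)" for j
  define Bq where "Bq = bsum n (2 * R)"
  have SN: "S \<subseteq> box N" using S by simp
  have finX: "finite X" using X finite_cube finite_subset by blast
  have a0: "0 \<le> a j" for j by (simp add: a_def)
  have "(\<Sum>x\<in>X. \<Sum>xs\<in>fp.paths S 0 x. \<Sum>v\<in>set xs. fp.wt N S 0 x xs * (1 / wgt (v - y x) ^ (e + 3)))
    \<le> (\<Sum>x\<in>X. \<Sum>xs\<in>fp.paths S 0 x. \<Sum>v\<in>set xs. fp.wt N S 0 x xs *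
        (\<Sum>j\<in>{k0<..k1}. a j * of_bool (v \<in> cube (y x) (4 ^ j))))"
  proof (intro sum_mono mult_left_mono fp.wt_nonneg)
    fix x xs v assume x: "x \<in> X" and xs: "xs \<in> fp.paths S 0 x" and v: "v \<in> set xs"
    have vS: "v \<in> S" using xs v by (auto simp: fp.paths_def)
    have "int (4 ^ k0) < (v - y x) $ h" using vS y(2)[OF x] S by (simp add: half_space_def)
    also have "\<dots> \<le> int (nrm (v - y x))" using nrm_component[of "v - y x" h] by linarith
    finally have low: "4 ^ k0 < nrm (v - y x)" by (simp only: of_nat_less_iff)
    have "nrm (v - y x) \<le> nrm (v - x) + nrm (x - y x)" by (rule nrm_diff_triangle)
    also have "nrm (x - y x) \<le> L + 4 ^ k0" using y(1)[OF x] nrm_minus_commute[of x "y x"] by simp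
    also have "nrm (v - x) \<le> N + R"
      using nrm_diff_triangle[of v x 0] nrm_minus_commute[of 0 x] vS S x X by (auto simp: cube_def)
    finally have "nrm (v - y x) \<le> k1" by (simp add: k1_def)
    also have "k1 \<le> 4 ^ k1" by (rule less_imp_le[OF power_gt_expt]) simp
    finally have "nrm (v - y x) \<le> 4 ^ k1" .
    with low show "1 / wgt (v - y x) ^ (e + 3) \<le> (\<Sum>j\<in>{k0<..k1}. a j * of_bool (v \<in> cube (y x) (4 ^ j)))"
      unfolding a_def by (rule scale_decomposition)
  qed
  also have "\<dots> = (\<Sum>x\<in>X. \<Sum>xs\<in>fp.paths S 0 x. \<Sum>j\<in>{k0<..k1}.
      a j * (?w x xs j))"
  proof (intro sum.cong refl)
    fix x xs
    have "(\<Sum>v\<in>set xs. fp.wt N S 0 x xs * (\<Sum>j\<in>{k0<..k1}. a j * of_bool (v \<in> cube (y x) (4 ^ j))))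
      = (\<Sum>j\<in>{k0<..k1}. \<Sum>v\<in>set xs. a j * (fp.wt N S 0 x xs * of_bool (v \<in> cube (y x) (4 ^ j))))"
      unfolding sum_distrib_left by (subst sum.swap) (simp only: mult_ac)
    also have "\<dots> = (\<Sum>j\<in>{k0<..k1}. a j * (fp.wt N S 0 x xs * (\<Sum>v\<in>set xs. of_bool (v \<in> cube (y x) (4 ^ j)))))"
      by (simp only: sum_distrib_left)
    finally show "(\<Sum>v\<in>set xs. fp.wt N S 0 x xs * (\<Sum>j\<in>{k0<..k1}. a j * of_bool (v \<in> cube (y x) (4 ^ j))))
      = (\<Sum>j\<in>{k0<..k1}. a j * (?w x xs j))"
      by (simp add: sum_of_bool_eq Int_def)
  qed
  also have "\<dots> = (\<Sum>j\<in>{k0<..k1}. a j * (\<Sum>x\<in>X. \<Sum>xs\<in>fp.paths S 0 x.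
      ?w x xs j))"
  proof -
    have "(\<Sum>x\<in>X. \<Sum>xs\<in>fp.paths S 0 x. \<Sum>j\<in>{k0<..k1}.
        a j * (?w x xs j))
      = (\<Sum>x\<in>X. \<Sum>j\<in>{k0<..k1}. \<Sum>xs\<in>fp.paths S 0 x.
        a j * (?w x xs j))"
      by (intro sum.cong refl sum.swap)
    also have "\<dots> = (\<Sum>j\<in>{k0<..k1}. \<Sum>x\<in>X. \<Sum>xs\<in>fp.paths S 0 x.
        a j * (?w x xs j))"
      by (rule sum.swap)
    finally show ?thesis by (simp only: sum_distrib_left)
  qed
  also have "\<dots> \<le> (\<Sum>j\<in>{k0<..k1}. err_const * (Bq + 1) * (1 / 2 ^ j))"
  proof (rule sum_mono)
    fix j assume j: "j \<in> {k0<..k1}"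
    let ?q = moment
    have "(\<Sum>x\<in>X. ?V x j)
      \<le> (\<Sum>x\<in>X. real (Suc ?q) * 32 ^ j * fp.tau N S 0 x
        + real (Suc ?q) * visit_const ^ ?q / 2 ^ (j * ?q) * (\<Sum>u\<in>cube (y x) (4 ^ j) \<inter> S. fp.tau N S 0 u))"
      by (intro sum_mono visits_scale SN)
    also have "\<dots> = real (Suc ?q) * 32 ^ j * (\<Sum>x\<in>X. fp.tau N S 0 x)
        + real (Suc ?q) * visit_const ^ ?q / 2 ^ (j * ?q) * (\<Sum>x\<in>X. \<Sum>u\<in>cube (y x) (4 ^ j) \<inter> S. fp.tau N S 0 u)"
      by (simp only: sum.distrib sum_distrib_left)
    also have "\<dots> \<le> real (Suc ?q) * 32 ^ j * Bq
        + real (Suc ?q) * visit_const ^ ?q / 2 ^ (j * ?q) *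
          (bulk_const * (1 + 4 ^ j) ^ (6 * e + 40) * ((20 * real bulk_radius * 16 ^ j) ^ (e + 7) * (Bq + 1)))"
    proof (intro add_mono mult_left_mono)
      have tl: "fp.tau N S 0 u \<le> two_point E p (H n) 0 u" for u
        using tau_two_point[OF SN] two_point_le[of "H n" N 0 u] S by simp
      have "(\<Sum>x\<in>X. fp.tau N S 0 x) \<le> (\<Sum>x\<in>X. two_point E p (H n) 0 x)" by (intro sum_mono tl)
      also have "\<dots> \<le> bsum n R" unfolding bsum_def using X by (intro sum_mono2 two_point_nonneg) auto
      also have "\<dots> \<le> Bq" unfolding Bq_def by (intro bsum_mono) simp
      finally show "(\<Sum>x\<in>X. fp.tau N S 0 x) \<le> Bq" .
      have "(\<Sum>x\<in>X. \<Sum>u\<in>cube (y x) (4 ^ j) \<inter> S. fp.tau N S 0 u)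
          \<le> (\<Sum>x\<in>X. \<Sum>u\<in>cube (y x) (4 ^ j) \<inter> H n. two_point E p (H n) 0 u)"
      proof (intro sum_mono)
        fix x
        have "(\<Sum>u\<in>cube (y x) (4 ^ j) \<inter> S. fp.tau N S 0 u) \<le> (\<Sum>u\<in>cube (y x) (4 ^ j) \<inter> S. two_point E p (H n) 0 u)"
          by (intro sum_mono tl)
        also have "\<dots> \<le> (\<Sum>u\<in>cube (y x) (4 ^ j) \<inter> H n. two_point E p (H n) 0 u)"
          using S by (intro sum_mono2 two_point_nonneg) auto
        finally show "(\<Sum>u\<in>cube (y x) (4 ^ j) \<inter> S. fp.tau N S 0 u)
            \<le> (\<Sum>u\<in>cube (y x) (4 ^ j) \<inter> H n. two_point E p (H n) 0 u)" .
      qed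
      also have "\<dots> \<le> bulk_const * (1 + real (4 ^ j)) ^ (6 * e + 40) * bsum n (R + bulk_radius * (1 + 4 ^ j)\<^sup>2)"
      proof (rule bulk_sum[OF X y(1)])
        have "(4::nat) ^ k0 \<le> 4 ^ j" using j by (intro power_increasing) auto
        moreover have "(4::nat) ^ j \<le> (L + 2) * 4 ^ j" by simp
        ultimately have "L + 4 ^ k0 \<le> (L + 2) + (L + 2) * 4 ^ j" by linarith
        then show "L + 4 ^ k0 \<le> (L + 2) * (1 + 4 ^ j)" by simp
        fix x assume "x \<in> X"
        then show "y x $ h \<le> - int n" using y(2)[of x] zero_le_power[of "4::int" k0] by linarith
      qed
      also have "\<dots> \<le> bulk_const * (1 + real (4 ^ j)) ^ (6 * e + 40) * ((20 * real bulk_radius * 16 ^ j) ^ (e + 7) * (Bq + 1))"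
        unfolding Bq_def using bulk_const_pos by (intro mult_left_mono bsum_scale) simp
      finally show "(\<Sum>x\<in>X. \<Sum>u\<in>cube (y x) (4 ^ j) \<inter> S. fp.tau N S 0 u)
          \<le> bulk_const * (1 + 4 ^ j) ^ (6 * e + 40) * ((20 * real bulk_radius * 16 ^ j) ^ (e + 7) * (Bq + 1))" by simp
    qed (use visit_const_pos in auto)
    finally have "a j * (\<Sum>x\<in>X. ?V x j)
      \<le> a j * (real (Suc ?q) * 32 ^ j * Bq
        + real (Suc ?q) * visit_const ^ ?q / 2 ^ (j * ?q) *
          (bulk_const * (1 + 4 ^ j) ^ (6 * e + 40) * ((20 * real bulk_radius * 16 ^ j) ^ (e + 7) * (Bq + 1))))"
      by (intro mult_left_mono a0)
    also have "\<dots> = 4 ^ (e + 3) * real (Suc ?q) * Bq * (32 ^ j / 4 ^ (j * (e + 3)))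
        + real (Suc ?q) * visit_const ^ ?q * bulk_const * (20 * real bulk_radius) ^ (e + 7) * (Bq + 1) * (4 ^ (e + 3) / 4 ^ (j * (e + 3))) *
          ((1 + 4 ^ j) ^ (6 * e + 40) * (16 ^ j) ^ (e + 7) / 2 ^ (j * ?q))"
      unfolding a_def power_mult_distrib[of "20 * real bulk_radius"] by (simp add: distrib_left mult_ac)
    \<comment> \<open>In the second summand the decay \<open>4 ^ (j * (e + 3))\<close> is given
      away: the moment alone already yields \<open>1 / 2 ^ j\<close>.\<close>
    also have "\<dots> \<le> 4 ^ (e + 3) * real (Suc ?q) * Bq * (1 / 2 ^ j)
        + real (Suc ?q) * visit_const ^ ?q * bulk_const * (20 * real bulk_radius) ^ (e + 7) * (Bq + 1) * (4 ^ (e + 3) / 1) *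
          (2 ^ (6 * e + 40) / 2 ^ j)"
      using visit_const_pos bulk_const_pos bsum_nonneg[of n "2 * R"]
      by (intro add_mono mult_mono mult_left_mono divide_left_mono scale_first scale_second one_le_power)
        (auto simp: Bq_def intro!: mult_nonneg_nonneg)
    also have "\<dots> = 4 ^ (e + 3) * real (Suc ?q) * (1 / 2 ^ j) * Bq
        + 4 ^ (e + 3) * real (Suc ?q) * (1 / 2 ^ j) * bulk_factor * (Bq + 1)"
      unfolding bulk_factor_def by (simp add: mult_ac)
    also have "\<dots> \<le> 4 ^ (e + 3) * real (Suc ?q) * (1 / 2 ^ j) * (Bq + 1)
        + 4 ^ (e + 3) * real (Suc ?q) * (1 / 2 ^ j) * bulk_factor * (Bq + 1)"
      by (intro add_right_mono mult_left_mono) auto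
    also have "\<dots> = err_const * (Bq + 1) * (1 / 2 ^ j)"
      unfolding err_const_def by (simp only: distrib_left distrib_right mult_ac add_ac mult_1_left mult_1_right)
    finally show "a j * (\<Sum>x\<in>X. ?V x j)
      \<le> err_const * (Bq + 1) * (1 / 2 ^ j)" .
  qed
  also have "\<dots> = err_const * (Bq + 1) * (\<Sum>j\<in>{k0<..k1}. 1 / 2 ^ j)" by (rule sum_distrib_left[symmetric])
  also have "\<dots> \<le> err_const * (Bq + 1) * (1 / 2 ^ k0)"
    using err_const_nonneg bsum_nonneg[of n "2 * R"]
    by (intro mult_left_mono geometric_tail) (auto simp: Bq_def)
  finally show ?thesis unfolding Bq_def by simp
qed


section \<open>Vertical segments hanging from the boundary layer\<close>

definition layer :: "nat \<Rightarrow> nat \<Rightarrow> nat \<Rightarrow> 'd site set" where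
  "layer i n R = {x \<in> box R. x $ h = - int n + int i}"

lemma layer_bd: "i < L \<Longrightarrow> layer i n R \<subseteq> bd n \<inter> box R"
  by (auto simp: layer_def bd_def)

lemma finite_layer: "finite (layer i n R)"
  by (rule finite_subset[of _ "box R"]) (auto simp: layer_def)

text \<open>From height \<open>i\<close> above the bottom, the first edge has length
  \<open>i + 1\<close>, at most \<open>L\<close>, and lands just below the half-space; unit steps
  follow. Hence no edge of the segment lies in the half-space, and point \<open>t\<close> with
  \<open>t > 0\<close> is \<open>t\<close> levels below the bottom.\<close>

definition line_pt :: "nat \<Rightarrow> 'd site \<Rightarrow> nat \<Rightarrow> 'd site" where
  "line_pt i x t = x - of_nat (if t = 0 then 0 else i + t) *s dir"

definition line :: "nat \<Rightarrow> nat \<Rightarrow> 'd site \<Rightarrow> 'd site list" where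
  "line i K x = map (line_pt i x) [0..<K + 2]"

lemma line_pt_height: "line_pt i x t $ h = x $ h - int (if t = 0 then 0 else i + t)"
  by (simp add: line_pt_def dir_nth)

lemma line_pt_nrm: "nrm (line_pt i x t - x) = (if t = 0 then 0 else i + t)"
  using nrm_dir[of "if t = 0 then 0 else i + t"] nrm_minus_commute[of "line_pt i x t" x]
  unfolding line_pt_def by simp

lemma hd_line: "hd (line i K x) = x"
proof -
  have "hd (line i K x) = line_pt i x (hd [0..<K + 2])" unfolding line_def by (rule hd_map) simp
  also have "hd [0..<K + 2] = 0" by (rule hd_upt) simp
  also have "line_pt i x 0 = x" by (simp add: line_pt_def)
  finally show ?thesis .
qed

lemma last_line: "last (line i K x) = line_pt i x (K + 1)"
  unfolding line_def by (simp add: last_map)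

lemma line_edge:
  assumes "ed \<in> pedges (line i K x)"
  obtains t where "t < K + 1" "ed = {line_pt i x t, line_pt i x (Suc t)}"
proof -
  obtain t where t: "Suc t < length (line i K x)" "ed = {line i K x ! t, line i K x ! Suc t}"
    using pedges_nth[OF assms] by blast
  then have "ed = {line_pt i x t, line_pt i x (Suc t)}" by (simp add: line_def del: upt_Suc)
  then show ?thesis using t that[of t] by (simp add: line_def)
qed

lemma good_line_line:
  assumes x: "x \<in> layer i n R" and i: "i < L" and N: "R + L + K + 1 \<le> N"
  shows "fp.good_line N (H n \<inter> box N) (line i K x)"
proof -
  have nr: "nrm x \<le> R" and hx: "x $ h = - int n + int i" using x by (auto simp: layer_def cube_def)
  have inN: "line_pt i x t \<in> box N" if "t < K + 2" for t
  proof -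
    have "nrm (line_pt i x t) \<le> nrm (line_pt i x t - x) + nrm x"
      using nrm_triangle[of "line_pt i x t - x" x] by simp
    also have "\<dots> \<le> (i + K + 1) + R" using that nr by (simp add: line_pt_nrm)
    finally show ?thesis using i N by (simp add: cube_def)
  qed
  have "inj_on (line_pt i x) {0..<K + 2}"
  proof (rule inj_onI)
    fix s t assume "line_pt i x s = line_pt i x t"
    then have "line_pt i x s $ h = line_pt i x t $ h" by simp
    then show "s = t" unfolding line_pt_height by (auto split: if_splits)
  qed
  then have "distinct (line i K x)" unfolding line_def by (simp add: distinct_map del: upt_Suc)
  moreover have "set (line i K x) \<subseteq> box N" unfolding line_def using inN by auto
  moreover have "ed \<in> E \<and> \<not> ed \<subseteq> H n \<inter> box N" if ed: "ed \<in> pedges (line i K x)" for ed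
  proof -
    obtain t where t: "t < K + 1" "ed = {line_pt i x t, line_pt i x (Suc t)}" using line_edge[OF ed] .
    have "line_pt i x (Suc t) \<notin> H n" unfolding half_space_def using hx by (simp add: line_pt_height)
    moreover have "ed \<in> E"
    proof (cases "t = 0")
      case True
      have "{x, x - of_nat (i + 1) *s dir} \<in> E" using i by (intro vertical_edge) auto
      then show ?thesis using True t by (simp add: line_pt_def add.commute)
    next
      case False
      have "line_pt i x (Suc t) = line_pt i x t - of_nat 1 *s dir"
        using False unfolding line_pt_def by (simp add: vec_eq_iff algebra_simps)
      then show ?thesis using vertical_edge[of 1 "line_pt i x t"] L_pos t by simp
    qed
    ultimately show ?thesis using t by auto
  qed
  moreover have "ed \<subseteq> box N" if "ed \<in> pedges (line i K x)" for ed
    using pedges_subset[OF that] \<open>set (line i K x) \<subseteq> box N\<close> by blast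
  ultimately show ?thesis unfolding fp.good_line_def by (auto simp: line_def)
qed

text \<open>The lower endpoint of an edge determines the column, and at a common starting height
  also the start. Segments from different heights of one column would overlap, which is why the
  boundary layer is treated one height at a time.\<close>

lemma lines_disjoint:
  assumes "x \<in> layer i n R" "x' \<in> layer i n R" "x \<noteq> x'"
  shows "pedges (line i K x) \<inter> pedges (line i K x') = {}"
proof (rule equals0I)
  fix ed assume ed: "ed \<in> pedges (line i K x) \<inter> pedges (line i K x')"
  obtain t where t: "ed = {line_pt i x t, line_pt i x (Suc t)}" using ed line_edge by blast
  have "ed \<subseteq> set (line i K x')" using ed pedges_subset by blast
  then obtain s where s: "line_pt i x (Suc t) = line_pt i x' s" using t by (auto simp: line_def)
  have "x $ h = x' $ h" using assms by (simp add: layer_def)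
  moreover have "line_pt i x (Suc t) $ h = line_pt i x' s $ h" using s by simp
  ultimately have "(if s = 0 then 0 else i + s) = i + Suc t" by (simp add: line_pt_height)
  then have "x = x'" using s unfolding line_pt_def by simp
  then show False using assms by simp
qed

definition green_const :: real where
  "green_const = C * cube_const"

lemma green_const_pos: "0 < green_const"
  using C_pos cube_const_pos by (simp add: green_const_def)

lemma convolution_tau:
  "(\<Sum>w\<in>box N. fp.tau N (box N) v w * fp.tau N (box N) y w) \<le> C\<^sup>2 * conv_const * (1 / wgt (v - y) ^ (e + 3))"
proof -
  have "(\<Sum>w\<in>box N. fp.tau N (box N) v w * fp.tau N (box N) y w)
      \<le> (\<Sum>w\<in>box N. C / wgt (v - w) ^ (e + 5) * (C / wgt (y - w) ^ (e + 5)))"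
    using C_pos wgt_pos by (intro sum_mono mult_mono tau_upper fp.tau_nonneg) (auto simp: less_imp_le)
  also have "\<dots> = C\<^sup>2 * (\<Sum>w\<in>box N. 1 / wgt (w - v) ^ (e + 5) * (1 / wgt (w - y) ^ (e + 5)))"
    unfolding sum_distrib_left wgt_commute[of v] wgt_commute[of y] by (simp add: power2_eq_square)
  also have "\<dots> \<le> C\<^sup>2 * (conv_const / wgt (v - y) ^ (e + 3))"
    by (intro mult_left_mono convolution) auto
  finally show ?thesis by simp
qed

text \<open>\<open>extension_sum\<close> is summed over \<open>z\<close> in \<open>box R2\<close>.
  The total mass on the right, the main term and the error are then all compared with
  \<open>(1 + real R2)\<^sup>2\<close>, which cancels, so the bound has no explicit dependence on
  \<open>R\<close>.\<close>

lemma main_finite: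
  fixes i k0 R n N :: nat
  assumes i: "i < L"
  defines "K \<equiv> 4 ^ k0"
  defines "R2 \<equiv> R + L + K + 1"
  assumes N: "R2 \<le> N"
    and low: "\<And>x z. x \<in> box R2 \<Longrightarrow> z \<in> box R2 \<Longrightarrow> c / 2 / (1 + 2 * real R2) ^ (e + 5) \<le> fp.tau N (box N) x z"
  shows "P ^ (K + 1) * (c / 2 * (\<Sum>x\<in>layer i n R. two_point E p (H n \<inter> box N) 0 x))
    \<le> green_const + P ^ (K + 1) * (green_const * (C\<^sup>2 * conv_const * (err_const / 2 ^ k0 * (bsum n (2 * R) + 1))))"
proof -
  define S where "S = H n \<inter> box N"
  define X where "X = layer i n R"
  define y where "y x = last (line i K x)" for x
  define Br where "Br x w = (\<Sum>xs\<in>fp.paths S 0 x. \<Sum>v\<in>set xs. fp.wt N S 0 x xs * fp.tau N (box N) v w)" for x w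
  define q where "q = (1 + real R2)\<^sup>2"
  define T where "T = (\<Sum>x\<in>X. \<Sum>xs\<in>fp.paths S 0 x. \<Sum>v\<in>set xs. fp.wt N S 0 x xs * (1 / wgt (v - y x) ^ (e + 3)))"
  let ?t = "fp.tau N (box N)" and ?tS = "fp.tau N S"
  let ?T = "\<lambda>x. \<Sum>xs\<in>fp.paths S 0 x. \<Sum>v\<in>set xs. fp.wt N S 0 x xs * (1 / wgt (v - y x) ^ (e + 3))"
  let ?main = "\<Sum>x\<in>X. P ^ (K + 1) * (?tS 0 x * (\<Sum>z\<in>box R2. ?t (y x) z)
      - (\<Sum>w\<in>box N. Br x w * (?t (y x) w * (\<Sum>z\<in>box R2. ?t w z))))"
  let ?diff = "P ^ (K + 1) * (c / 2 * (\<Sum>x\<in>X. ?tS 0 x)) - P ^ (K + 1) * (green_const * (C\<^sup>2 * conv_const * T))"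
  have q0: "0 < q" by (simp add: q_def)
  have SN: "S \<subseteq> box N" by (simp add: S_def)
  have S0: "0 \<in> box N" by (simp add: cube_def)
  have P0: "0 \<le> P ^ (K + 1)" using open_prob_bounds by simp
  have yK: "y x = line_pt i x (K + 1)" for x by (simp add: y_def last_line)
  have yR2: "y x \<in> box R2" if x: "x \<in> X" for x
  proof -
    have "nrm (y x) \<le> nrm (y x - x) + nrm x" using nrm_triangle[of "y x - x" x] by simp
    also have "\<dots> \<le> (i + K + 1) + R" using x by (simp add: yK line_pt_nrm X_def layer_def cube_def)
    finally show ?thesis using i by (simp add: cube_def R2_def)
  qed
  have Br0: "0 \<le> Br x w" for x w
    unfolding Br_def by (intro sum_nonneg mult_nonneg_nonneg fp.wt_nonneg fp.tau_nonneg)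
  have ext: "(\<Sum>x\<in>X. P ^ (K + 1) * (?tS 0 x * ?t (y x) z - (\<Sum>w\<in>box N. Br x w * (?t (y x) w * ?t w z)))) \<le> ?t 0 z" for z
    unfolding Br_def y_def
  proof (rule fp.extension_sum[OF SN S0])
    show "finite X" by (simp add: X_def finite_layer)
    fix x assume x: "x \<in> X"
    show "fp.good_line N S (line i K x) \<and> hd (line i K x) = x \<and> length (line i K x) \<le> Suc (K + 1)"
      using good_line_line[OF _ i, of x n R K N] x N unfolding S_def X_def R2_def
      by (simp add: hd_line) (simp add: line_def)
    fix x' assume "x' \<in> X" "x \<noteq> x'"
    then show "pedges (line i K x) \<inter> pedges (line i K x') = {}"
      using lines_disjoint x unfolding X_def by blast
  qed
  have box_sum: "(\<Sum>z\<in>box R2. ?t w z) \<le> green_const * q" for w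
    using tau_cube_sum[of "box N" N "box R2" 0 R2 w] by (simp add: green_const_def q_def)
  have "(\<Sum>z\<in>box R2. \<Sum>x\<in>X. P ^ (K + 1) * (?tS 0 x * ?t (y x) z - (\<Sum>w\<in>box N. Br x w * (?t (y x) w * ?t w z))))
      \<le> (\<Sum>z\<in>box R2. ?t 0 z)"
    by (intro sum_mono ext)
  also have "\<dots> \<le> green_const * q" by (rule box_sum)
  also have "(\<Sum>z\<in>box R2. \<Sum>x\<in>X. P ^ (K + 1) * (?tS 0 x * ?t (y x) z - (\<Sum>w\<in>box N. Br x w * (?t (y x) w * ?t w z))))
     = ?main"
  proof -
    have "(\<Sum>z\<in>box R2. \<Sum>w\<in>box N. Br x w * (?t (y x) w * ?t w z))
        = (\<Sum>w\<in>box N. Br x w * (?t (y x) w * (\<Sum>z\<in>box R2. ?t w z)))" for x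
      unfolding sum_distrib_left by (rule sum.swap)
    then show ?thesis
      by (subst sum.swap) (simp only: sum_distrib_left[symmetric] sum_subtractf)
  qed
  finally have upper1: "?main \<le> green_const * q" .
  have conv: "(\<Sum>w\<in>box N. Br x w * ?t (y x) w)
      \<le> C\<^sup>2 * conv_const * ?T x" for x
  proof -
    have "(\<Sum>w\<in>box N. Br x w * ?t (y x) w)
        = (\<Sum>w\<in>box N. \<Sum>xs\<in>fp.paths S 0 x. \<Sum>v\<in>set xs. fp.wt N S 0 x xs * (?t v w * ?t (y x) w))"
      unfolding Br_def sum_distrib_right by (simp only: mult.assoc)
    also have "\<dots> = (\<Sum>xs\<in>fp.paths S 0 x. \<Sum>w\<in>box N. \<Sum>v\<in>set xs. fp.wt N S 0 x xs * (?t v w * ?t (y x) w))"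
      by (rule sum.swap)
    also have "\<dots> = (\<Sum>xs\<in>fp.paths S 0 x. \<Sum>v\<in>set xs. fp.wt N S 0 x xs * (\<Sum>w\<in>box N. ?t v w * ?t (y x) w))"
      unfolding sum_distrib_left by (intro sum.cong refl sum.swap)
    also have "\<dots> \<le> (\<Sum>xs\<in>fp.paths S 0 x. \<Sum>v\<in>set xs. fp.wt N S 0 x xs * (C\<^sup>2 * conv_const * (1 / wgt (v - y x) ^ (e + 3))))"
      by (intro sum_mono mult_left_mono convolution_tau fp.wt_nonneg)
    also have "\<dots> = C\<^sup>2 * conv_const * ?T x"
      unfolding sum_distrib_left by (simp only: mult_ac)
    finally show ?thesis .
  qed
  \<comment> \<open>The cube has d powers of its side length as cardinality and every site
    contributes d - 2 inverse powers by \<open>low\<close>, so two powers remain.\<close>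
  have lowG: "c / 2 * q \<le> (\<Sum>z\<in>box R2. ?t (y x) z)" if x: "x \<in> X" for x
  proof -
    have "c / 2 * q \<le> c / 2 * (1 + 2 * real R2)\<^sup>2"
      unfolding q_def using c_pos by (intro mult_left_mono power_mono) auto
    also have "\<dots> = real (card (box R2)) * (c / 2 / (1 + 2 * real R2) ^ (e + 5))"
    proof -
      have "real (card (box R2)) = (1 + 2 * real R2) ^ (e + 7)" by (simp add: card_cube dim add.commute)
      also have "\<dots> = (1 + 2 * real R2)\<^sup>2 * (1 + 2 * real R2) ^ (e + 5)" by (rule power_split) simp
      finally show ?thesis by (simp add: add_pos_nonneg)
    qed
    also have "\<dots> = (\<Sum>z\<in>box R2. c / 2 / (1 + 2 * real R2) ^ (e + 5))" by simp
    also have "\<dots> \<le> (\<Sum>z\<in>box R2. ?t (y x) z)" by (intro sum_mono low yR2 x)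
    finally show ?thesis .
  qed
  have lower1: "q * ?diff
     \<le> ?main"
  proof -
    have "q * ?diff
      = (\<Sum>x\<in>X. P ^ (K + 1) * (?tS 0 x * (c / 2 * q) - green_const * q * (C\<^sup>2 * conv_const *
          ?T x)))"
      unfolding T_def by (simp only: right_diff_distrib sum_subtractf sum_distrib_left mult_ac)
    also have "\<dots> \<le> ?main"
    proof (intro sum_mono mult_left_mono diff_mono lowG P0 fp.tau_nonneg)
      fix x assume "x \<in> X"
      have "(\<Sum>w\<in>box N. Br x w * (?t (y x) w * (\<Sum>z\<in>box R2. ?t w z)))
          \<le> (\<Sum>w\<in>box N. Br x w * (?t (y x) w * (green_const * q)))"
        by (intro sum_mono mult_left_mono box_sum Br0 fp.tau_nonneg)
      also have "\<dots> = green_const * q * (\<Sum>w\<in>box N. Br x w * ?t (y x) w)"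
        unfolding sum_distrib_left by (simp only: mult_ac)
      also have "\<dots> \<le> green_const * q * (C\<^sup>2 * conv_const *
          ?T x)"
        using green_const_pos q0 by (intro mult_left_mono conv) auto
      finally show "(\<Sum>w\<in>box N. Br x w * (?t (y x) w * (\<Sum>z\<in>box R2. ?t w z))) \<le> green_const * q * (C\<^sup>2 * conv_const *
          ?T x)" .
    qed
    finally show ?thesis .
  qed
  have "q * ?diff \<le> q * green_const"
    using lower1 upper1 by (simp only: mult.commute[of q green_const])
  then have h1: "?diff \<le> green_const"
    by (rule mult_left_le_imp_le[OF _ q0])
  have h2: "P ^ (K + 1) * (green_const * (C\<^sup>2 * conv_const * T))
      \<le> P ^ (K + 1) * (green_const * (C\<^sup>2 * conv_const * (err_const / 2 ^ k0 * (bsum n (2 * R) + 1))))"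
  proof (intro mult_left_mono)
    show "T \<le> err_const / 2 ^ k0 * (bsum n (2 * R) + 1)"
      unfolding T_def
    proof (rule error_sum[OF S_def])
      show "X \<subseteq> bd n \<inter> box R" unfolding X_def by (rule layer_bd[OF i])
      fix x assume x: "x \<in> X"
      show "nrm (y x - x) \<le> L + 4 ^ k0" using i by (simp add: yK line_pt_nrm K_def)
      show "y x $ h + 4 ^ k0 < - int n" using x by (simp add: yK line_pt_height K_def X_def layer_def)
    qed
    show "0 \<le> C\<^sup>2 * conv_const" using shell_const_ge_1 by (simp add: conv_const_def)
  qed (use green_const_pos P0 in auto)
  have eq: "(\<Sum>x\<in>X. ?tS 0 x) = (\<Sum>x\<in>layer i n R. two_point E p (H n \<inter> box N) 0 x)"
    unfolding X_def S_def by (intro sum.cong refl tau_two_point) auto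
  show ?thesis
    unfolding eq[symmetric] using add_mono[OF h1 h2] by (simp only: diff_add_cancel)
qed


text \<open>Limit of \<open>main_finite\<close>. Only finitely many pairs of sites occur in its
  assumption \<open>low\<close>, so half of the two-point lower bound holds for all of them at once
  in large boxes.\<close>

lemma layer_bound:
  assumes i: "i < L"
  shows "P ^ (4 ^ k0 + 1) * (c / 2 * (\<Sum>x\<in>layer i n R. two_point E p (H n) 0 x))
    \<le> green_const + P ^ (4 ^ k0 + 1) * (green_const * (C\<^sup>2 * conv_const * (err_const / 2 ^ k0 * (bsum n (2 * R) + 1))))"
proof -
  let ?rhs = "green_const + P ^ (4 ^ k0 + 1) * (green_const * (C\<^sup>2 * conv_const * (err_const / 2 ^ k0 * (bsum n (2 * R) + 1))))"
  let ?lhs = "\<lambda>N. P ^ (4 ^ k0 + 1) * (c / 2 * (\<Sum>x\<in>layer i n R. two_point E p (H n \<inter> box N) 0 x))"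
  define R2 where "R2 = R + L + 4 ^ k0 + 1"
  define l where "l = c / 2 / (1 + 2 * real R2) ^ (e + 5)"
  have ev: "\<forall>\<^sub>F N in sequentially. l < two_point E p (UNIV \<inter> box N) x z" if "x \<in> box R2" "z \<in> box R2" for x z
  proof (rule order_tendstoD[OF two_point_lim])
    have "nrm (x - z) \<le> 2 * R2"
      using nrm_diff_triangle[of x z 0] nrm_minus_commute[of 0 z] that by (simp add: cube_def)
    then have "wgt (x - z) \<le> 1 + 2 * real R2" by (simp add: wgt_def)
    then have "c / (1 + 2 * real R2) ^ (e + 5) \<le> c / wgt (x - z) ^ (e + 5)"
      using c_pos wgt_pos[of "x - z"] by (intro divide_left_mono power_mono mult_pos_pos) auto
    moreover have "l < c / (1 + 2 * real R2) ^ (e + 5)"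
      unfolding l_def using c_pos by (intro divide_strict_right_mono) auto
    ultimately show "l < two_point E p UNIV x z" using lower[of x z] by linarith
  qed
  have "\<forall>\<^sub>F N in sequentially. \<forall>x\<in>box R2. \<forall>z\<in>box R2. l < two_point E p (UNIV \<inter> box N) x z"
    by (intro eventually_ball_finite ballI ev) auto
  then obtain N0 where N0: "\<And>N x z. N0 \<le> N \<Longrightarrow> x \<in> box R2 \<Longrightarrow> z \<in> box R2 \<Longrightarrow> l < two_point E p (UNIV \<inter> box N) x z"
    unfolding eventually_sequentially by blast
  show ?thesis
  proof (rule LIMSEQ_le_const2)
    show "(\<lambda>N. ?lhs N)
      \<longlonglongrightarrow> P ^ (4 ^ k0 + 1) * (c / 2 * (\<Sum>x\<in>layer i n R. two_point E p (H n) 0 x))"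
      by (intro tendsto_mult tendsto_const tendsto_sum two_point_lim)
    show "\<exists>N0. \<forall>N\<ge>N0. ?lhs N
      \<le> ?rhs"
    proof (intro exI allI impI)
      fix N assume N: "max N0 R2 \<le> N"
      show "?lhs N
        \<le> ?rhs"
      proof (rule main_finite[OF i])
        show "R + L + 4 ^ k0 + 1 \<le> N" using N by (simp add: R2_def)
        fix x z assume "x \<in> box (R + L + 4 ^ k0 + 1)" "z \<in> box (R + L + 4 ^ k0 + 1)"
        then have "l < two_point E p (UNIV \<inter> box N) x z" using N by (intro N0) (auto simp: R2_def)
        then show "c / 2 / (1 + 2 * real (R + L + 4 ^ k0 + 1)) ^ (e + 5) \<le> fp.tau N (box N) x z"
          using tau_two_point[of "box N" N x z] unfolding l_def R2_def by simp
      qed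
    qed
  qed
qed

text \<open>Without open edges distinct sites are never connected, against the lower bound on the
  two-point function. Positivity is needed to divide by the price of the segment.\<close>

lemma open_prob_pos: "0 < P"
proof (rule ccontr)
  assume "\<not> 0 < P"
  then have P: "P = 0" using open_prob_bounds(1)[of p] by linarith
  have "two_point E p (UNIV \<inter> box N) 0 dir = 0" for N
  proof -
    have "fp.tau N (box N) 0 dir = 0"
      unfolding fp.tau_def fp.bexp_def
    proof (intro sum.neutral ballI)
      fix \<omega> assume "\<omega> \<in> Pow {ed \<in> E. ed \<subseteq> box N}"
      then have fin: "finite \<omega>" using fp.finite_E finite_subset by blast
      have "\<not> conn {} (box N) 0 dir"
      proof
        assume "conn {} (box N) 0 dir"
        then have "dir \<in> {0 :: 'd site}" by (rule conn_closed) auto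
        then show False using dir_nth[of h] by simp
      qed
      then show "P ^ card \<omega> * (1 - P) ^ card ({ed \<in> E. ed \<subseteq> box N} - \<omega>) * of_bool (conn \<omega> (box N) 0 dir) = 0"
        using fin P by (cases "\<omega> = {}") auto
    qed
    then show ?thesis using tau_two_point[of "box N" N] by simp
  qed
  then have "two_point E p UNIV 0 dir = 0"
    using two_point_lim[of UNIV 0 dir] LIMSEQ_unique[OF _ tendsto_const] by simp
  moreover have "0 < c / wgt (0 - dir) ^ (e + 5)" using c_pos wgt_pos by simp
  ultimately show False using lower[of 0 dir] by simp
qed

section \<open>Contraction under doubling, and its iteration\<close>

lemma bsum_layers: "bsum n R = (\<Sum>i<L. \<Sum>x\<in>layer i n R. two_point E p (H n) 0 x)"
proof -
  have "bd n \<inter> box R = (\<Union>i<L. layer i n R)"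
  proof
    show "bd n \<inter> box R \<subseteq> (\<Union>i<L. layer i n R)"
    proof
      fix x assume x: "x \<in> bd n \<inter> box R"
      then have "x \<in> layer (nat (x $ h + int n)) n R" "nat (x $ h + int n) < L"
        by (auto simp: bd_def layer_def)
      then show "x \<in> (\<Union>i<L. layer i n R)" by blast
    qed
    show "(\<Union>i<L. layer i n R) \<subseteq> bd n \<inter> box R" by (intro UN_least layer_bd) simp
  qed
  moreover have "(\<Sum>x\<in>(\<Union>i<L. layer i n R). two_point E p (H n) 0 x) = (\<Sum>i<L. \<Sum>x\<in>layer i n R. two_point E p (H n) 0 x)"
    by (intro sum.UNION_disjoint) (auto simp: finite_layer, auto simp: layer_def)
  ultimately show ?thesis unfolding bsum_def by simp
qed

lemma bsum_contraction: "\<exists>M\<ge>0. \<forall>n R. bsum n R \<le> M + 1 / 2 ^ (e + 8) * bsum n (2 * R)"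
proof -
  let ?s = "\<lambda>n i R. \<Sum>x\<in>layer i n R. two_point E p (H n) 0 x"
  define gain where "gain = real L * (2 / c * (green_const * (C\<^sup>2 * conv_const * err_const)))"
  \<comment> \<open>The segment length is fixed only here. The price \<open>Q\<close> of the segment
    does not occur in \<open>gain\<close>, so a long segment makes the coefficient small and merely
    enlarges \<open>M\<close>.\<close>
  obtain k0 where k0: "gain * 2 ^ (e + 8) < 2 ^ k0" using real_arch_pow[of 2 "gain * 2 ^ (e + 8)"] by auto
  define Q where "Q = P ^ (4 ^ k0 + 1)"
  have Q0: "0 < Q" using open_prob_pos by (simp add: Q_def)
  define M where "M = real L * (2 / c * (green_const / Q)) + 1 / 2 ^ (e + 8)"
  have gain: "gain / 2 ^ k0 \<le> 1 / 2 ^ (e + 8)" using k0 by (simp add: divide_simps)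
  have "bsum n R \<le> M + 1 / 2 ^ (e + 8) * bsum n (2 * R)" for n R
  proof -
    define D where "D = green_const * (C\<^sup>2 * conv_const * (err_const / 2 ^ k0 * (bsum n (2 * R) + 1)))"
    have "bsum n R \<le> (\<Sum>i<L. 2 / c * (green_const / Q + D))"
      unfolding bsum_layers[of n R]
    proof (rule sum_mono)
      fix i assume "i \<in> {..<L}"
      then have "Q * (c / 2 * (?s n i R)) \<le> green_const + Q * D"
        unfolding Q_def D_def by (intro layer_bound) simp
      then have "Q * (c / 2 * (?s n i R)) \<le> Q * (green_const / Q + D)"
        using Q0 by (simp add: distrib_left)
      then have "c / 2 * (?s n i R) \<le> green_const / Q + D"
        by (rule mult_left_le_imp_le[OF _ Q0])
      then have "2 / c * (c / 2 * (?s n i R)) \<le> 2 / c * (green_const / Q + D)"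
        using c_pos by (intro mult_left_mono) auto
      then show "(?s n i R) \<le> 2 / c * (green_const / Q + D)"
        using c_pos by simp
    qed
    also have "\<dots> = real L * (2 / c * (green_const / Q)) + real L * (2 / c * D)"
      by (simp add: distrib_left)
    also have "real L * (2 / c * D) = gain / 2 ^ k0 * (bsum n (2 * R) + 1)"
      unfolding gain_def D_def by simp
    also have "\<dots> \<le> 1 / 2 ^ (e + 8) * (bsum n (2 * R) + 1)"
      using bsum_nonneg[of n "2 * R"] by (intro mult_right_mono gain) auto
    finally show ?thesis unfolding M_def by (simp add: distrib_left)
  qed
  moreover have "0 \<le> M"
    unfolding M_def using c_pos Q0 green_const_pos by (intro add_nonneg_nonneg mult_nonneg_nonneg) auto
  ultimately show ?thesis by blast
qed

text \<open>After \<open>j\<close> doublings the trivial bound has grown by at most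
  \<open>2 ^ (j * (e + 7))\<close>, while the contraction has gained
  \<open>2 ^ (j * (e + 8))\<close>; the remainder vanishes as \<open>j\<close> grows and the
  geometric series of constants is at most \<open>2 * M\<close>.\<close>

lemma bsum_bounded: "\<exists>B\<ge>0. \<forall>n R. bsum n R \<le> B"
proof -
  define d where "d = (1 / 2 ^ (e + 8) :: real)"
  obtain M where M: "0 \<le> M" "\<And>n R. bsum n R \<le> M + d * bsum n (2 * R)"
    using bsum_contraction unfolding d_def by blast
  have d0: "0 \<le> d" by (simp add: d_def)
  have "(2::real) ^ 1 \<le> 2 ^ (e + 8)" by (intro power_increasing) auto
  then have d2: "2 * d \<le> 1" by (simp add: d_def divide_simps)
  have iter: "bsum n R \<le> 2 * M + d ^ j * bsum n (2 ^ j * R)" for n R j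
  proof (induction j arbitrary: R)
    case 0
    then show ?case using M(1) by simp
  next
    case (Suc j)
    have "bsum n R \<le> M + d * bsum n (2 * R)" by (rule M)
    also have "\<dots> \<le> M + d * (2 * M + d ^ j * bsum n (2 ^ j * (2 * R)))"
      by (intro add_left_mono mult_left_mono Suc.IH d0)
    also have "\<dots> = M + 2 * d * M + d ^ Suc j * bsum n (2 ^ Suc j * R)"
      by (simp add: algebra_simps)
    also have "\<dots> \<le> M + 1 * M + d ^ Suc j * bsum n (2 ^ Suc j * R)"
      using d2 M(1) by (intro add_right_mono add_left_mono mult_right_mono) auto
    finally show ?case by simp
  qed
  have "bsum n R \<le> 2 * M" for n R
  proof (rule LIMSEQ_le_const)
    show "(\<lambda>j. 2 * M + (2 * real R + 1) ^ (e + 7) * (1 / 2) ^ j) \<longlonglongrightarrow> 2 * M"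
      using tendsto_add[OF tendsto_const tendsto_mult[OF tendsto_const LIMSEQ_realpow_zero[of "1 / 2"]],
          of "2 * M" "(2 * real R + 1) ^ (e + 7)"] by simp
    have "bsum n R \<le> 2 * M + (2 * real R + 1) ^ (e + 7) * (1 / 2) ^ j" for j
    proof -
      have "bsum n (2 ^ j * R) \<le> (2 * real (2 ^ j * R) + 1) ^ (e + 7)" by (rule bsum_crude)
      also have "\<dots> \<le> (2 ^ j * (2 * real R + 1)) ^ (e + 7)"
        by (intro power_mono) (auto simp: algebra_simps)
      finally have "d ^ j * bsum n (2 ^ j * R) \<le> d ^ j * (2 ^ j * (2 * real R + 1)) ^ (e + 7)"
        using d0 by (intro mult_left_mono) auto
      also have "\<dots> = (2 * real R + 1) ^ (e + 7) * (d ^ j * (2 ^ j) ^ (e + 7))"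
        by (simp only: power_mult_distrib mult_ac)
      also have "d ^ j * (2 ^ j) ^ (e + 7) = (1 / 2) ^ j"
      proof -
        have "(2 ^ j) ^ (e + 7) = (2 ^ (e + 7) :: real) ^ j" by (simp only: power_mult[symmetric] mult.commute)
        then have "d ^ j * (2 ^ j) ^ (e + 7) = (d * 2 ^ (e + 7)) ^ j" by (simp only: power_mult_distrib)
        also have "d * 2 ^ (e + 7) = 1 / 2"
          using power_split[of "e + 8" 1 "e + 7" 2] by (simp add: d_def)
        finally show ?thesis .
      qed
      finally show ?thesis using iter[of n R j] by linarith
    qed
    then show "\<exists>N. \<forall>j\<ge>N. bsum n R \<le> 2 * M + (2 * real R + 1) ^ (e + 7) * (1 / 2) ^ j" by blast
  qed
  then show ?thesis using M(1) by (intro exI[of _ "2 * M"]) auto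
qed

text \<open>In \<open>ennreal\<close> the sum is the supremum of its finite partial sums. Each of
  these lives in some cube, where a boundary site \<open>x\<close> has at most (2L+1)^d neighbours
  \<open>y\<close>, and \<open>bsum_bounded\<close> is uniform in the cube.\<close>

lemma phi_bounded: "\<exists>B\<ge>0. \<forall>n. phi E p (H n) \<le> ennreal B"
proof -
  obtain B where B: "0 \<le> B" "\<And>n R. bsum n R \<le> B" using bsum_bounded by blast
  define D where "D = real ((2 * L + 1) ^ (e + 7)) * B"
  have D0: "0 \<le> D" using B by (simp add: D_def)
  have "(\<Sum>\<^sub>\<infinity>(x, y)\<in>{(x, y). x \<in> H n \<and> y \<notin> H n \<and> {x, y} \<in> E}. ennreal (two_point E p (H n) 0 x)) \<le> ennreal D" for n
  proof -
    let ?A = "{(x, y). x \<in> H n \<and> y \<notin> H n \<and> {x, y} \<in> E}"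
    have "(\<Sum>(x, y)\<in>F. ennreal (two_point E p (H n) 0 x)) \<le> ennreal D" if F: "finite F" "F \<subseteq> ?A" for F
    proof -
      define R where "R = Max (insert 0 (nrm ` fst ` F))"
      have R: "nrm x \<le> R" if "(x, y) \<in> F" for x y
        unfolding R_def using F(1) that by (intro Max_ge) force+
      define J where "J = Sigma (bd n \<inter> box R) (\<lambda>x. cube x L)"
      have finJ: "finite J" by (auto simp: J_def)
      have FJ: "F \<subseteq> J"
      proof
        fix xy assume xy: "xy \<in> F"
        then obtain x y where *: "xy = (x, y)" "x \<in> H n" "y \<notin> H n" "{x, y} \<in> E" using F(2) by auto
        then show "xy \<in> J"
          using exit_bd[of x n y] R[of x y] xy edge_nrm[of x y] nrm_minus_commute[of x y]
          by (simp add: J_def cube_def)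
      qed
      have "(\<Sum>(x, y)\<in>F. two_point E p (H n) 0 x) \<le> (\<Sum>(x, y)\<in>J. two_point E p (H n) 0 x)"
        using finJ FJ by (intro sum_mono2) (auto simp: two_point_nonneg)
      also have "\<dots> = (\<Sum>x\<in>bd n \<inter> box R. \<Sum>y\<in>cube x L. two_point E p (H n) 0 x)"
        unfolding J_def by (subst sum.Sigma) auto
      also have "\<dots> = real ((2 * L + 1) ^ (e + 7)) * bsum n R"
        by (simp add: bsum_def card_cube dim sum_distrib_left)
      also have "\<dots> \<le> D" unfolding D_def by (intro mult_left_mono B) simp
      finally have "ennreal (\<Sum>(x, y)\<in>F. two_point E p (H n) 0 x) \<le> ennreal D" by (rule ennreal_leI)
      then show ?thesis by (simp add: case_prod_unfold sum_ennreal two_point_nonneg)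
    qed
    then show ?thesis
      by (subst nonneg_infsum_complete) (auto intro!: SUP_least)
  qed
  then have "phi E p (H n) \<le> ennreal p * ennreal D" for n
    unfolding phi_def by (intro mult_left_mono) auto
  \<comment> \<open>\<open>ennreal\<close> sends negative reals to 0, so \<open>max 0 p\<close>
    yields a real bound without knowing the sign of \<open>p\<close>.\<close>
  also have "ennreal p * ennreal D = ennreal (max 0 p * D)"
    using D0 by (cases "0 \<le> p") (simp_all add: ennreal_mult ennreal_neg max_def)
  finally show ?thesis using D0 by (intro exI[of _ "max 0 p * D"]) auto
qed

end

section \<open>Reduction of the theorem to the spread-out setting\<close>

lemma nearest_neighbour_spread_out: "nearest_neighbour = (spread_out 1 :: 'd::finite site set set)"
proof -
  have "l1_norm (x - y) = 1 \<longleftrightarrow> x \<noteq> y \<and> l1_norm (x - y) \<le> int 1" for x y :: "'d site"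
  proof -
    have nonneg: "0 \<le> l1_norm (x - y)" unfolding l1_norm_def by (intro sum_nonneg) simp
    have "l1_norm (x - y) = 0 \<longleftrightarrow> x = y"
      unfolding l1_norm_def by (subst sum_nonneg_eq_0_iff) (auto simp: vec_eq_iff)
    with nonneg show ?thesis by auto
  qed
  then show ?thesis unfolding nearest_neighbour_def spread_out_def by simp
qed

lemma one_plus_power_le: "1 + real k ^ Suc m \<le> (1 + real k) ^ Suc m"
proof (induction m)
  case (Suc m)
  have "1 + real k ^ Suc (Suc m) \<le> (1 + real k) * (1 + real k ^ Suc m)" by (simp add: algebra_simps)
  also have "\<dots> \<le> (1 + real k) * (1 + real k) ^ Suc m" by (intro mult_left_mono Suc.IH) simp
  finally show ?case by simp
qed simp

lemma power_one_plus_le: "(1 + real k) ^ m \<le> 2 ^ m * (1 + real k ^ m)"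
proof -
  have "(1 + real k) ^ m \<le> (2 * max 1 (real k)) ^ m" by (intro power_mono) auto
  also have "\<dots> = 2 ^ m * max 1 (real k) ^ m" by (rule power_mult_distrib)
  also have "\<dots> \<le> 2 ^ m * (1 + real k ^ m)" by (intro mult_left_mono) (auto simp: max_def)
  finally show ?thesis .
qed

theorem corollary1p6:
  fixes E :: "'d::finite site set set" and k :: 'd and c C' :: real
  assumes "CARD('d) > 6"
    and "E = nearest_neighbour \<or> (\<exists>L\<ge>1. E = spread_out L)"
    and "0 < c" and "c \<le> C'"
    and "\<And>x y. c / (1 + linf_norm (x - y) ^ (CARD('d) - 2)) \<le> two_point E (p_crit E) UNIV x y"
    and "\<And>x y. two_point E (p_crit E) UNIV x y \<le> C' / (1 + linf_norm (x - y) ^ (CARD('d) - 2))"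
  shows "\<exists>C::real. C > 0 \<and> (\<forall>n. phi E (p_crit E) (half_space k n) \<le> ennreal C)"
proof -
  obtain L where L: "1 \<le> L" "E = spread_out L"
    using assms(2) nearest_neighbour_spread_out by (metis order.refl)
  define e where "e = CARD('d) - 7"
  have e: "CARD('d) = e + 7" using assms(1) by (simp add: e_def)
  interpret dim_gt_6 e "TYPE('d)"
    by standard (rule e)
  have exponent: "CARD('d) - 2 = e + 5" using e by simp
  have C': "0 < C'" using assms(3,4) by linarith
  \<comment> \<open>Passing from 1 + |x|^(d-2) to (1 + |x|)^(d-2) keeps the lower constant and costs
    a factor 2^(d-2) in the upper one.\<close>
  interpret critical_lattice e "TYPE('d)" E k L "p_crit E" c "C' * 2 ^ (e + 5)"
  proof
    have "C' * 1 \<le> C' * 2 ^ (e + 5)" using C' by (intro mult_left_mono one_le_power) auto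
    then show "c \<le> C' * 2 ^ (e + 5)" using assms(4) by linarith
    fix x y :: "'d site"
    let ?m = "real (nrm (x - y))"
    have "1 + ?m ^ (e + 5) \<le> wgt (x - y) ^ (e + 5)"
      using one_plus_power_le[of "nrm (x - y)" "e + 4"] by (simp add: wgt_def add.commute)
    then have "c / wgt (x - y) ^ (e + 5) \<le> c / (1 + ?m ^ (e + 5))"
      using assms(3) wgt_pos[of "x - y"]
      by (intro divide_left_mono mult_pos_pos) (auto simp: add_pos_nonneg)
    then show "c / wgt (x - y) ^ (e + 5) \<le> two_point E (p_crit E) UNIV x y"
      using assms(5)[of x y] unfolding exponent linf_norm_nrm by linarith
    have "wgt (x - y) ^ (e + 5) \<le> 2 ^ (e + 5) * (1 + ?m ^ (e + 5))"
      using power_one_plus_le[of "nrm (x - y)" "e + 5"] by (simp add: wgt_def)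
    moreover have "0 < 1 + ?m ^ (e + 5)" "0 < wgt (x - y) ^ (e + 5)"
      by (simp_all add: add_pos_nonneg wgt_pos)
    ultimately have "C' / (1 + ?m ^ (e + 5)) \<le> C' * 2 ^ (e + 5) / wgt (x - y) ^ (e + 5)"
      using C' by (simp add: divide_simps mult.assoc)
    then show "two_point E (p_crit E) UNIV x y \<le> C' * 2 ^ (e + 5) / wgt (x - y) ^ (e + 5)"
      using assms(6)[of x y] unfolding exponent linf_norm_nrm by linarith
  qed (use L assms(3) in auto)
  obtain B where B: "0 \<le> B" "\<And>n. phi E (p_crit E) (half_space k n) \<le> ennreal B"
    using phi_bounded by blast
  show ?thesis
  proof (intro exI conjI allI)
    show "0 < B + 1" using B(1) by simp
    fix n
    have "phi E (p_crit E) (half_space k n) \<le> ennreal B" by (rule B(2))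
    also have "\<dots> \<le> ennreal (B + 1)" by (intro ennreal_leI) simp
    finally show "phi E (p_crit E) (half_space k n) \<le> ennreal (B + 1)" .
  qed
qed

end
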